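(* The Lie algebra of infinitesimal point symmetries of the PDE system $$\begin{array}{l} 2EF_u-FE_u-EE_v=0,\\ 2GF_v-FG_v-GG_u=0,\\ GE_u+EG_v-2F(F_u+F_v)+(3F-2G)E_v+(3F-2E)G_u=0\end{array}$$ for functions $E,F,G$ of $(u,v)$ is generated by the vector fields $$T_1=\partial_u,\quad T_2=\partial_v,\quad D_1=u\partial_u+v\partial_v,\quad D_2=E\partial_E+F\partial_F+G\partial_G .$$
   Context: Any local solution $(E(u,v),F(u,v),G(u,v))$ defines a surface $\Sigma=\{(u,v,E(u,v),F(u,v),G(u,v))\}\subset\mathbb R^5$. A vector field $X=\alpha\partial_u+\beta\partial_v+\varepsilon\partial_E+\varphi\partial_F+\gamma\partial_G$ on (a domain of) $\mathbb R^5$, with coefficients being functions of $(u,v,E,F,G)$, is an infinitesimal (point) symmetry of the system if its local flow moves the surface $\Sigma$ defined by any solution to a surface that is again defined by some solution. The system is considered where $E>0$, $EG-F^2>0$, i.e. where $E\,du^2+2F\,du\,dv+G\,dv^2$ is a Riemannian metric. *)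

theory Defs
  imports "HOL-Analysis.Analysis"
begin

section \<open>Smooth maps\<close>

fun Ck_on :: "nat \<Rightarrow> ('a::real_normed_vector \<Rightarrow> 'b::real_normed_vector) \<Rightarrow> 'a set \<Rightarrow> bool" where
  "Ck_on 0 f S \<longleftrightarrow> continuous_on S f"
| "Ck_on (Suc k) f S \<longleftrightarrow>
     (\<forall>x\<in>S. f differentiable (at x)) \<and>
     (\<forall>h. Ck_on k (\<lambda>x. frechet_derivative f (at x) h) S)"

text \<open>Used below only for open \<open>S\<close> and finite-dimensional domains, where \<open>Ck_on k\<close> is the
  usual class \<open>C\<^sup>k\<close>.\<close>

definition smooth_on :: "('a::real_normed_vector \<Rightarrow> 'b::real_normed_vector) \<Rightarrow> 'a set \<Rightarrow> bool" where
  "smooth_on f S \<longleftrightarrow> (\<forall>k. Ck_on k f S)"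


section \<open>The PDE system and its solution surfaces\<close>

type_synonym pt = "real \<times> real \<times> real \<times> real \<times> real"  \<comment> \<open>coordinates \<open>(u, v, E, F, G)\<close>\<close>

definition metric_domain :: "pt set" where
  "metric_domain = {(u, v, E, F, G). E > 0 \<and> E * G - F\<^sup>2 > 0}"

definition pd_u :: "(real \<Rightarrow> real \<Rightarrow> real) \<Rightarrow> real \<Rightarrow> real \<Rightarrow> real" where
  "pd_u f u v = deriv (\<lambda>x. f x v) u"

definition pd_v :: "(real \<Rightarrow> real \<Rightarrow> real) \<Rightarrow> real \<Rightarrow> real \<Rightarrow> real" where
  "pd_v f u v = deriv (\<lambda>y. f u y) v"

definition pde_system_at ::
  "(real \<Rightarrow> real \<Rightarrow> real) \<Rightarrow> (real \<Rightarrow> real \<Rightarrow> real) \<Rightarrow> (real \<Rightarrow> real \<Rightarrow> real) \<Rightarrow> real \<Rightarrow> real \<Rightarrow> bool" where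
  "pde_system_at E F G u v \<longleftrightarrow>
     2 * E u v * pd_u F u v - F u v * pd_u E u v - E u v * pd_v E u v = 0 \<and>
     2 * G u v * pd_v F u v - F u v * pd_v G u v - G u v * pd_u G u v = 0 \<and>
     G u v * pd_u E u v + E u v * pd_v G u v - 2 * F u v * (pd_u F u v + pd_v F u v)
       + (3 * F u v - 2 * G u v) * pd_v E u v + (3 * F u v - 2 * E u v) * pd_u G u v = 0"

definition surface ::
  "(real \<times> real) set \<Rightarrow> (real \<Rightarrow> real \<Rightarrow> real) \<Rightarrow> (real \<Rightarrow> real \<Rightarrow> real) \<Rightarrow> (real \<Rightarrow> real \<Rightarrow> real) \<Rightarrow> pt set" where
  "surface W E F G = {(u, v, E u v, F u v, G u v) | u v. (u, v) \<in> W}"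

definition is_local_solution ::
  "(real \<times> real) set \<Rightarrow> (real \<Rightarrow> real \<Rightarrow> real) \<Rightarrow> (real \<Rightarrow> real \<Rightarrow> real) \<Rightarrow> (real \<Rightarrow> real \<Rightarrow> real) \<Rightarrow> bool" where
  "is_local_solution W E F G \<longleftrightarrow>
     open W \<and>
     smooth_on (\<lambda>(u, v). E u v) W \<and> smooth_on (\<lambda>(u, v). F u v) W \<and> smooth_on (\<lambda>(u, v). G u v) W \<and>
     surface W E F G \<subseteq> metric_domain \<and>
     (\<forall>(u, v)\<in>W. pde_system_at E F G u v)"


section \<open>Vector fields on a domain and their Lie algebras\<close>

text \<open>A vector field on \<open>U\<close> is normalised to vanish outside \<open>U\<close>, so that two vector fields on \<open>U\<close>
  are equal as functions iff they agree on \<open>U\<close>.\<close>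

definition vector_fields :: "pt set \<Rightarrow> (pt \<Rightarrow> pt) set" where
  "vector_fields U = {X. smooth_on X U \<and> (\<forall>p. p \<notin> U \<longrightarrow> X p = 0)}"

definition restrict_vf :: "pt set \<Rightarrow> (pt \<Rightarrow> pt) \<Rightarrow> pt \<Rightarrow> pt" where
  "restrict_vf U X = (\<lambda>p. if p \<in> U then X p else 0)"

definition lie_bracket :: "pt set \<Rightarrow> (pt \<Rightarrow> pt) \<Rightarrow> (pt \<Rightarrow> pt) \<Rightarrow> pt \<Rightarrow> pt" where
  "lie_bracket U X Y = restrict_vf U
     (\<lambda>p. frechet_derivative Y (at p) (X p) - frechet_derivative X (at p) (Y p))"

definition lie_subalgebra :: "pt set \<Rightarrow> (pt \<Rightarrow> pt) set \<Rightarrow> bool" where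
  "lie_subalgebra U L \<longleftrightarrow>
     L \<subseteq> vector_fields U \<and>
     (\<lambda>p. 0) \<in> L \<and>
     (\<forall>X\<in>L. \<forall>Y\<in>L. (\<lambda>p. X p + Y p) \<in> L) \<and>
     (\<forall>c. \<forall>X\<in>L. (\<lambda>p. c *\<^sub>R X p) \<in> L) \<and>
     (\<forall>X\<in>L. \<forall>Y\<in>L. lie_bracket U X Y \<in> L)"


section \<open>Local flows and infinitesimal point symmetries\<close>

text \<open>\<open>flows_to U X t p q\<close>: the integral curve of \<open>X\<close> in \<open>U\<close> starting at \<open>p\<close> exists up to the
  (possibly negative) time \<open>t\<close>, where it reaches \<open>q\<close>. For smooth \<open>X\<close> on open \<open>U\<close> the point \<open>q\<close> is
  unique, so this is the graph of the partial map given by the local flow at time \<open>t\<close>.\<close>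

definition flows_to :: "pt set \<Rightarrow> (pt \<Rightarrow> pt) \<Rightarrow> real \<Rightarrow> pt \<Rightarrow> pt \<Rightarrow> bool" where
  "flows_to U X t p q \<longleftrightarrow>
     (\<exists>c :: real \<Rightarrow> pt. c 0 = p \<and> c t = q \<and>
        (\<forall>s\<in>closed_segment 0 t. c s \<in> U \<and>
           (c has_vector_derivative X (c s)) (at s within closed_segment 0 t)))"

definition flow_image :: "pt set \<Rightarrow> (pt \<Rightarrow> pt) \<Rightarrow> real \<Rightarrow> pt set \<Rightarrow> pt set" where
  "flow_image U X t \<Sigma> = {q. \<exists>p\<in>\<Sigma>. flows_to U X t p q}"

text \<open>The flow is only local and a moved surface is a graph over the \<open>(u, v)\<close>-plane in general
  only for small times. So the condition is imposed near every point of a solution surface: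
  some neighbourhood of the point in the surface is moved, for all small \<open>t\<close>, to a surface that
  is again defined by a solution.\<close>

definition infinitesimal_symmetry :: "pt set \<Rightarrow> (pt \<Rightarrow> pt) \<Rightarrow> bool" where
  "infinitesimal_symmetry U X \<longleftrightarrow>
     X \<in> vector_fields U \<and>
     (\<forall>W E F G. is_local_solution W E F G \<and> surface W E F G \<subseteq> U \<longrightarrow>
       (\<forall>w\<in>W. \<exists>W\<^sub>0 \<delta>. open W\<^sub>0 \<and> w \<in> W\<^sub>0 \<and> W\<^sub>0 \<subseteq> W \<and> \<delta> > 0 \<and>
         (\<forall>t. \<bar>t\<bar> < \<delta> \<longrightarrow>
           (\<forall>p\<in>surface W\<^sub>0 E F G. \<exists>q. flows_to U X t p q) \<and>
           (\<exists>W' E' F' G'. is_local_solution W' E' F' G' \<and>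
              flow_image U X t (surface W\<^sub>0 E F G) = surface W' E' F' G'))))"

definition symmetry_algebra :: "pt set \<Rightarrow> (pt \<Rightarrow> pt) set" where
  "symmetry_algebra U = {X. infinitesimal_symmetry U X}"

definition vf_T1 :: "pt \<Rightarrow> pt" where
  "vf_T1 = (\<lambda>(u, v, E, F, G). (1, 0, 0, 0, 0))"

definition vf_T2 :: "pt \<Rightarrow> pt" where
  "vf_T2 = (\<lambda>(u, v, E, F, G). (0, 1, 0, 0, 0))"

definition vf_D1 :: "pt \<Rightarrow> pt" where
  "vf_D1 = (\<lambda>(u, v, E, F, G). (u, v, 0, 0, 0))"

definition vf_D2 :: "pt \<Rightarrow> pt" where
  "vf_D2 = (\<lambda>(u, v, E, F, G). (0, 0, E, F, G))"

end

theory Submission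
  imports Defs
begin

text \<open>Write \<open>\<sigma>\<close> for the \<open>(E, F, G)\<close>-part and \<open>\<xi>\<close> for the \<open>(u, v)\<close>-part of a symmetry. Comparing the tangent
  planes of a solution surface and of its images under the flow for \<open>t \<rightarrow> 0+\<close> gives, at every point,
  an equation that is quadratic in the 1-jet of the solution. The jets of two explicit families of
  solutions (metrics with straight geodesics, and exponentials) span the space of all admissible
  1-jets and are closed under scaling, so the parts of degree 0, 1, 2 vanish separately. Degree 2
  forces \<open>\<xi>\<close> to be independent of \<open>E, F, G\<close>; eliminating \<open>\<sigma>\<close> from degree 1 gives one relation that is
  linear in \<open>E, F, G\<close> with coefficients depending only on \<open>u, v\<close>, and it forces the derivative of \<open>\<xi>\<close> to
  be a multiple of the identity. Then \<open>\<sigma>\<close> is a multiple of \<open>(E, F, G)\<close>, and degrees 1 and 0 show that the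
  factor is constant.\<close>


section \<open>Integral curves over short times\<close>

text \<open>The definition of a symmetry supplies, separately for each small \<open>t\<close>, some
  solution whose surface is the moved one. Nothing relates the solutions for different
  \<open>t\<close>: their 1-jets at the moved point have no regularity in \<open>t\<close> and are
  not even known to be bounded. This shapes the analytic half. The flow enters only through mean
  value estimates along integral curves, with error \<eta> * t times the distance of the starting
  points for every \<eta> > 0. That precision is enough to compare tangent planes to first order in
  \<open>t\<close>, and it yields that the jets have a one-sided derivative at 0, namely the first
  prolongation of the field. The algebraic half never differentiates a field twice. Since the
  derivative of \<xi> does not change along a fibre and \<open>U\<close> is open, the relation left
  over from degree 1 holds for an open set of (E, F, G) with the same three unknowns, and comparing
  coefficients gives a nonsingular 3 by 3 system. Constancy of the remaining factors comes from
  translating along directions in which a component is constant, or from a vanishing first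
  derivative on the connected set \<open>U\<close>. The eliminations cancel only numbers and the
  factors E, G and EG - F^2, which are positive on \<open>metric_domain\<close>.\<close>

lemma integral_curve_stays:
  fixes c :: "real \<Rightarrow> 'a::real_inner"
  assumes der: "\<And>s. s \<in> {0..t} \<Longrightarrow> (c has_vector_derivative X (c s)) (at s within {0..t})"
    and bnd: "\<And>x. norm (x - p) < r \<Longrightarrow> norm (X x) \<le> M"
    and "0 \<le> M" and small: "norm (c 0 - p) + M * t < r" and s: "s \<in> {0..t}"
  shows "norm (c s - p) < r"
proof (rule ccontr)
  assume "\<not> norm (c s - p) < r"
  have cont: "continuous_on {0..t} c"
    using der has_vector_derivative_continuous continuous_on_eq_continuous_within by blast
  \<comment> \<open>\<open>X\<close> is bounded only inside the ball, so the estimate is run up to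
    the first exit time \<open>m\<close>, the least element of \<open>S\<close>: before
    \<open>m\<close> the curve is still inside, and the speed bound \<open>M\<close> does not let it
    get far enough.\<close>
  define S where "S = {x \<in> {0..t}. r \<le> norm (c x - p)}"
  have "closed S"
    unfolding S_def by (intro continuous_on_closed_Collect_le continuous_intros cont)
  moreover have "bounded S"
    by (rule bounded_subset[of "{0..t}"]) (auto simp: S_def)
  ultimately have "compact S"
    by (simp add: compact_eq_bounded_closed)
  moreover have "S \<noteq> {}"
    using s \<open>\<not> norm (c s - p) < r\<close> by (auto simp: S_def)
  ultimately obtain m where m: "m \<in> S" "\<And>x. x \<in> S \<Longrightarrow> m \<le> x"
    using compact_attains_inf by metis
  have m_t: "0 \<le> m" "m \<le> t" "r \<le> norm (c m - p)"
    using m(1) by (auto simp: S_def)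
  have "0 \<le> M * t"
    using \<open>0 \<le> M\<close> m_t by simp
  then have "m \<noteq> 0"
    using m_t small by auto
  with m_t have "0 < m" by simp
  have "\<exists>x\<in>{0<..<m}. norm (c m - c 0) \<le> norm ((m - 0) *\<^sub>R X (c x))"
  proof (rule mvt_general[OF \<open>0 < m\<close>])
    show "continuous_on {0..m} c"
      using cont m_t by (auto intro: continuous_on_subset)
    fix x assume x: "0 < x" "x < m"
    then have "(c has_vector_derivative X (c x)) (at x within {0..t})"
      using der[of x] m_t by auto
    then show "(c has_derivative (\<lambda>h. h *\<^sub>R X (c x))) (at x)"
      using x m_t at_within_Icc_at[of 0 x t] by (simp add: has_vector_derivative_def)
  qed
  then obtain x where x: "0 < x" "x < m" "norm (c m - c 0) \<le> m * norm (X (c x))"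
    using \<open>0 < m\<close> by auto
  then have "x \<notin> S" using m by force
  then have "norm (c x - p) < r"
    using x m_t by (auto simp: S_def)
  then have "m * norm (X (c x)) \<le> t * M"
    using bnd m_t by (intro mult_mono) auto
  then have "norm (c m - c 0) \<le> M * t"
    using x by (simp add: mult.commute)
  moreover have "norm (c m - p) \<le> norm (c m - c 0) + norm (c 0 - p)"
    by norm
  ultimately show False
    using m_t small by linarith
qed

lemma vector_derivative_norm_bound:
  fixes y :: "real \<Rightarrow> 'a::real_normed_vector"
  assumes der: "\<And>s. s \<in> {0..t} \<Longrightarrow> (y has_vector_derivative y' s) (at s within {0..t})"
    and bnd: "\<And>s. s \<in> {0..t} \<Longrightarrow> norm (y' s) \<le> B" and s: "s \<in> {0..t}"
  shows "norm (y s - y 0) \<le> B * s"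
proof -
  have "norm (y s - y 0) \<le> B * norm (s - 0)"
  proof (rule differentiable_bound)
    show "convex {0..t}" by simp
    show "(y has_derivative (\<lambda>h. h *\<^sub>R y' x)) (at x within {0..t})" if "x \<in> {0..t}" for x
      using der[OF that] by (simp add: has_vector_derivative_def)
    show "onorm (\<lambda>h. h *\<^sub>R y' x) \<le> B" if "x \<in> {0..t}" for x
      using bnd[OF that] onorm_scaleR_left[OF bounded_linear_ident, of "y' x"]
      by (simp add: onorm_id)
  qed (use s in auto)
  then show ?thesis using s by simp
qed

text \<open>A short-time substitute for Gronwall's inequality: compare the maximum of \<open>norm y\<close> with the
  mean value bound.\<close>

lemma linear_growth_bound:
  fixes y :: "real \<Rightarrow> 'a::real_normed_vector"
  assumes der: "\<And>s. s \<in> {0..t} \<Longrightarrow> (y has_vector_derivative y' s) (at s within {0..t})"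
    and bnd: "\<And>s. s \<in> {0..t} \<Longrightarrow> norm (y' s) \<le> K * norm (y s)"
    and "0 \<le> K" and "K * t \<le> 1/2" and s: "s \<in> {0..t}"
  shows "norm (y s) \<le> 2 * norm (y 0)"
proof -
  have "continuous_on {0..t} y"
    using der has_vector_derivative_continuous continuous_on_eq_continuous_within by blast
  then have "continuous_on {0..t} (\<lambda>x. norm (y x))"
    by (rule continuous_on_norm)
  then obtain m where m: "m \<in> {0..t}" "\<And>x. x \<in> {0..t} \<Longrightarrow> norm (y x) \<le> norm (y m)"
    using s continuous_attains_sup[of "{0..t}" "\<lambda>x. norm (y x)"] by fastforce
  have "norm (y m - y 0) \<le> K * norm (y m) * m"
  proof (rule vector_derivative_norm_bound[OF der _ m(1)])
    show "norm (y' s) \<le> K * norm (y m)" if "s \<in> {0..t}" for s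
      using bnd[OF that] mult_left_mono[OF m(2)[OF that] \<open>0 \<le> K\<close>] by linarith
  qed
  also have "\<dots> = K * m * norm (y m)" by simp
  also have "\<dots> \<le> 1/2 * norm (y m)"
    using m(1) \<open>0 \<le> K\<close> \<open>K * t \<le> 1/2\<close> mult_left_mono[of m t K]
    by (intro mult_right_mono) auto
  finally have "norm (y m) \<le> 2 * norm (y 0)"
    using norm_triangle_ineq2[of "y m" "y 0"] by simp
  with m(2)[OF s] show ?thesis by simp
qed

text \<open>Stands in for differentiability of the flow in its initial point: to first order in
  \<open>t\<close> the difference of two curves evolves by the map 1 + tA. The error carries the
  factor \<open>norm (c' 0 - c 0)\<close>, so it survives the division by this distance when tangent
  vectors are formed.\<close>

lemma integral_curve_difference:
  fixes c c' :: "real \<Rightarrow> 'a::real_normed_vector"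
  assumes der: "\<And>s. s \<in> {0..t} \<Longrightarrow> (c has_vector_derivative X (c s)) (at s within {0..t})"
    and der': "\<And>s. s \<in> {0..t} \<Longrightarrow> (c' has_vector_derivative X (c' s)) (at s within {0..t})"
    and S: "\<And>s. s \<in> {0..t} \<Longrightarrow> c s \<in> S" "\<And>s. s \<in> {0..t} \<Longrightarrow> c' s \<in> S"
    and lin: "linear A" and A: "\<And>x. norm (A x) \<le> K * norm x"
    and X: "\<And>x y. x \<in> S \<Longrightarrow> y \<in> S \<Longrightarrow> norm (X x - X y - A (x - y)) \<le> \<eta> * norm (x - y)"
    and "0 \<le> K" "0 \<le> \<eta>" "0 \<le> t" "(K + \<eta>) * t \<le> 1/2"
  shows "norm (c' t - c t - (c' 0 - c 0) - t *\<^sub>R A (c' 0 - c 0))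
           \<le> t * (2 * \<eta> + 2 * K * (K + \<eta>) * t) * norm (c' 0 - c 0)"
proof -
  define y where "y s = c' s - c s" for s
  have y: "(y has_vector_derivative X (c' s) - X (c s)) (at s within {0..t})" if "s \<in> {0..t}" for s
    unfolding y_def using der[OF that] der'[OF that] by (intro derivative_intros)
  have rem: "norm (X (c' s) - X (c s) - A (y s)) \<le> \<eta> * norm (y s)" if "s \<in> {0..t}" for s
    using X S that by (simp add: y_def)
  have y': "norm (X (c' s) - X (c s)) \<le> (K + \<eta>) * norm (y s)" if "s \<in> {0..t}" for s
    using rem[OF that] A[of "y s"] norm_triangle_sub[of "X (c' s) - X (c s)" "A (y s)"]
    by (simp add: algebra_simps)
  have y2: "norm (y s) \<le> 2 * norm (y 0)" if "s \<in> {0..t}" for s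
    by (rule linear_growth_bound[OF y y']) (use assms that in auto)
  have K: "(K + \<eta>) * norm (y s) \<le> (K + \<eta>) * (2 * norm (y 0))" if "s \<in> {0..t}" for s
    using y2[OF that] \<open>0 \<le> K\<close> \<open>0 \<le> \<eta>\<close> by (intro mult_left_mono) auto
  have drift: "norm (y s - y 0) \<le> (K + \<eta>) * (2 * norm (y 0)) * t" if "s \<in> {0..t}" for s
  proof -
    have "norm (y s - y 0) \<le> (K + \<eta>) * (2 * norm (y 0)) * s"
      by (rule vector_derivative_norm_bound[OF y _ that]) (auto intro: order_trans[OF y' K])
    also have "\<dots> \<le> (K + \<eta>) * (2 * norm (y 0)) * t"
      using that \<open>0 \<le> K\<close> \<open>0 \<le> \<eta>\<close> by (intro mult_left_mono) auto
    finally show ?thesis .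
  qed
  \<comment> \<open>The derivative of \<open>z\<close> splits into the linearization error of
    \<open>X\<close> and \<open>A (y s - y 0)\<close>; by \<open>drift\<close> the latter is of
    order \<open>t\<close>.\<close>
  define z where "z s = y s - s *\<^sub>R A (y 0)" for s
  have z: "(z has_vector_derivative (X (c' s) - X (c s)) - A (y 0)) (at s within {0..t})"
    if "s \<in> {0..t}" for s
    unfolding z_def using y[OF that] by (auto intro!: derivative_eq_intros)
  have "norm (z t - z 0) \<le> (2 * \<eta> + 2 * K * (K + \<eta>) * t) * norm (y 0) * t"
  proof (rule vector_derivative_norm_bound[OF z])
    fix s assume s: "s \<in> {0..t}"
    have "norm (A (y s - y 0)) \<le> K * ((K + \<eta>) * (2 * norm (y 0)) * t)"
      using A[of "y s - y 0"] drift[OF s] mult_left_mono[OF _ \<open>0 \<le> K\<close>] by (meson order_trans)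
    moreover have "norm (X (c' s) - X (c s) - A (y s)) \<le> \<eta> * (2 * norm (y 0))"
      using rem[OF s] y2[OF s] mult_left_mono[OF _ \<open>0 \<le> \<eta>\<close>] by (meson order_trans)
    moreover have "X (c' s) - X (c s) - A (y 0) = (X (c' s) - X (c s) - A (y s)) + A (y s - y 0)"
      by (simp add: linear_diff[OF lin])
    ultimately show "norm (X (c' s) - X (c s) - A (y 0)) \<le> (2 * \<eta> + 2 * K * (K + \<eta>) * t) * norm (y 0)"
      using norm_triangle_ineq[of "X (c' s) - X (c s) - A (y s)" "A (y s - y 0)"]
      by (simp add: algebra_simps)
  qed (use \<open>0 \<le> t\<close> in auto)
  then show ?thesis
    by (simp add: z_def y_def algebra_simps)
qed

text \<open>\<open>Ck_on\<close> provides continuity of the derivative only for each fixed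
  direction. The finitely many basis directions, each controlled up to \<eta> divided by the
  dimension, control the operator norm, and the mean value inequality on the ball does the
  rest.\<close>

lemma C1_strict_differentiability:
  fixes X :: "'a::euclidean_space \<Rightarrow> 'b::real_normed_vector"
  assumes C1: "Ck_on (Suc 0) X U" and "open U" "p \<in> U" "0 < \<eta>"
  obtains r where "0 < r" "ball p r \<subseteq> U"
    "\<And>x y. x \<in> ball p r \<Longrightarrow> y \<in> ball p r \<Longrightarrow>
       norm (X x - X y - frechet_derivative X (at p) (x - y)) \<le> \<eta> * norm (x - y)"
proof -
  let ?A = "frechet_derivative X (at p)"
  define \<kappa> where "\<kappa> = \<eta> / DIM('a)"
  have "0 < \<kappa>" using \<open>0 < \<eta>\<close> by (simp add: \<kappa>_def)
  have D: "(X has_derivative frechet_derivative X (at x)) (at x)" if "x \<in> U" for x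
    using C1 that by (simp add: frechet_derivative_works)
  have "eventually (\<lambda>x. norm (frechet_derivative X (at x) b - ?A b) < \<kappa>) (nhds p)" for b
  proof -
    have "isCont (\<lambda>x. frechet_derivative X (at x) b) p"
      using C1 \<open>open U\<close> \<open>p \<in> U\<close> by (auto simp: continuous_on_eq_continuous_at)
    then have "((\<lambda>x. frechet_derivative X (at x) b) \<longlongrightarrow> ?A b) (nhds p)"
      by (simp add: isCont_def tendsto_nhds_iff)
    then show ?thesis
      using \<open>0 < \<kappa>\<close> by (auto simp: tendsto_iff dist_norm)
  qed
  then have "eventually (\<lambda>x. x \<in> U \<and> (\<forall>b\<in>Basis. norm (frechet_derivative X (at x) b - ?A b) < \<kappa>)) (nhds p)"
    using eventually_nhds_in_open[OF \<open>open U\<close> \<open>p \<in> U\<close>]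
    by (auto intro!: eventually_conj eventually_ball_finite)
  then obtain r where "0 < r"
    and r: "\<And>x. x \<in> ball p r \<Longrightarrow> x \<in> U \<and> (\<forall>b\<in>Basis. norm (frechet_derivative X (at x) b - ?A b) < \<kappa>)"
    by (auto simp: eventually_nhds_metric dist_commute)
  have lin: "linear (frechet_derivative X (at x))" if "x \<in> U" for x
    using D[OF that] by (rule has_derivative_linear)
  have on: "onorm (\<lambda>h. frechet_derivative X (at x) h - ?A h) \<le> \<eta>" if x: "x \<in> ball p r" for x
  proof (rule onorm_le)
    fix h
    let ?L = "\<lambda>h. frechet_derivative X (at x) h - ?A h"
    have linL: "linear ?L"
      using lin r[OF x] \<open>p \<in> U\<close> by (intro linear_compose_sub) auto
    have "?L h = ?L (\<Sum>b\<in>Basis. (h \<bullet> b) *\<^sub>R b)"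
      by (simp add: euclidean_representation)
    also have "\<dots> = (\<Sum>b\<in>Basis. (h \<bullet> b) *\<^sub>R ?L b)"
      by (simp add: linear_sum[OF linL] linear_scale[OF linL])
    also have "norm \<dots> \<le> (\<Sum>b\<in>(Basis::'a set). norm h * \<kappa>)"
    proof (rule sum_norm_le)
      fix b :: 'a assume "b \<in> Basis"
      then have "norm (?L b) \<le> \<kappa>" "\<bar>h \<bullet> b\<bar> \<le> norm h"
        using r[OF x] by (auto simp: Basis_le_norm less_imp_le)
      then show "norm ((h \<bullet> b) *\<^sub>R ?L b) \<le> norm h * \<kappa>"
        by (simp add: mult_mono)
    qed
    also have "\<dots> = \<eta> * norm h" by (simp add: \<kappa>_def)
    finally show "norm (?L h) \<le> \<eta> * norm h" .
  qed
  show ?thesis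
  proof (rule that[OF \<open>0 < r\<close>])
    show "ball p r \<subseteq> U" using r by auto
    fix x y assume xy: "x \<in> ball p r" "y \<in> ball p r"
    have "norm ((X x - ?A x) - (X y - ?A y)) \<le> \<eta> * norm (x - y)"
    proof (rule differentiable_bound[OF convex_ball _ _ xy])
      fix z assume z: "z \<in> ball p r"
      have "(X has_derivative frechet_derivative X (at z)) (at z within ball p r)"
        using D r[OF z] by (meson has_derivative_at_withinI)
      moreover have "(?A has_derivative ?A) (at z within ball p r)"
        using has_derivative_bounded_linear[OF D[OF \<open>p \<in> U\<close>]]
        by (rule bounded_linear_imp_has_derivative)
      ultimately show "((\<lambda>x. X x - ?A x) has_derivative (\<lambda>h. frechet_derivative X (at z) h - ?A h)) (at z within ball p r)"
        by (rule has_derivative_diff)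
    qed (rule on)
    then show "norm (X x - X y - ?A (x - y)) \<le> \<eta> * norm (x - y)"
      by (simp add: linear_diff[OF lin[OF \<open>p \<in> U\<close>]] algebra_simps)
  qed
qed

text \<open>The denominator \<open>a + 1\<close> keeps the time bound positive also for
  \<open>a = 0\<close>.\<close>

lemma small_time: "a * t < b" if "0 \<le> a" "0 < b" "0 \<le> t" "t < b / (a + 1)" for a b t :: real
proof -
  have "(a + 1) * t < b"
    using that by (simp add: field_simps)
  moreover have "a * t \<le> (a + 1) * t"
    using that by (simp add: algebra_simps)
  ultimately show ?thesis by linarith
qed

text \<open>All that the linearization needs to know about the flow: how differences of moved points
  develop, which moves the tangent plane, and how \<open>p\<close> itself is displaced. Both hold
  for every endpoint reached, since \<open>flows_to\<close> is a relation.\<close>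

lemma flow_estimates:
  assumes "smooth_on X U" "open U" "p \<in> U" "0 < \<eta>"
  defines "A \<equiv> frechet_derivative X (at p)"
  obtains r \<delta> where "0 < r" "0 < \<delta>"
    "\<And>t p\<^sub>1 q\<^sub>1 p\<^sub>2 q\<^sub>2. \<lbrakk>0 < t; t < \<delta>; p\<^sub>1 \<in> ball p r; p\<^sub>2 \<in> ball p r; flows_to U X t p\<^sub>1 q\<^sub>1; flows_to U X t p\<^sub>2 q\<^sub>2\<rbrakk>
      \<Longrightarrow> norm (q\<^sub>2 - q\<^sub>1 - (p\<^sub>2 - p\<^sub>1) - t *\<^sub>R A (p\<^sub>2 - p\<^sub>1)) \<le> \<eta> * t * norm (p\<^sub>2 - p\<^sub>1)"
    "\<And>t q. \<lbrakk>0 < t; t < \<delta>; flows_to U X t p q\<rbrakk> \<Longrightarrow> norm (q - p - t *\<^sub>R X p) \<le> \<eta> * t"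
proof -
  have C1: "Ck_on (Suc 0) X U"
    using assms(1) unfolding smooth_on_def by blast
  define \<epsilon> where "\<epsilon> = \<eta> / 4"
  have "0 < \<epsilon>" using \<open>0 < \<eta>\<close> by (simp add: \<epsilon>_def)
  obtain r\<^sub>0 where r\<^sub>0: "0 < r\<^sub>0" "ball p r\<^sub>0 \<subseteq> U"
    "\<And>x y. x \<in> ball p r\<^sub>0 \<Longrightarrow> y \<in> ball p r\<^sub>0 \<Longrightarrow> norm (X x - X y - A (x - y)) \<le> \<epsilon> * norm (x - y)"
    using C1_strict_differentiability[OF C1 \<open>open U\<close> \<open>p \<in> U\<close> \<open>0 < \<epsilon>\<close>] unfolding A_def by blast
  have "(X has_derivative A) (at p)"
    using C1 \<open>p \<in> U\<close> by (simp add: A_def frechet_derivative_works)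
  then have blA: "bounded_linear A" by (rule has_derivative_bounded_linear)
  then have linA: "linear A" by (rule bounded_linear.linear)
  obtain K where "0 \<le> K" and K: "\<And>x. norm (A x) \<le> K * norm x"
    using bounded_linear.nonneg_bounded[OF blA] by (auto simp: mult.commute)
  \<comment> \<open>Within this radius the strict estimate is available and \<open>X\<close> differs
    from \<open>X p\<close> by at most \<eta>. The latter gives the speed bound \<open>M\<close> and
    the displacement estimate.\<close>
  define r where "r = min r\<^sub>0 (\<eta> / (K + \<epsilon> + 1))"
  have "0 < r" using \<open>0 < \<eta>\<close> \<open>0 < \<epsilon>\<close> \<open>0 \<le> K\<close> r\<^sub>0 by (simp add: r_def)
  have Kr: "(K + \<epsilon>) * s < \<eta>" if "0 \<le> s" "s < r" for s
    using that \<open>0 < \<eta>\<close> \<open>0 < \<epsilon>\<close> \<open>0 \<le> K\<close> by (intro small_time) (auto simp: r_def)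
  have near: "norm (X x - X p) \<le> \<eta>" if "norm (x - p) < r" for x
  proof -
    have "norm (X x - X p - A (x - p)) \<le> \<epsilon> * norm (x - p)"
      using that r\<^sub>0 by (intro r\<^sub>0) (auto simp: r_def dist_norm norm_minus_commute)
    then have "norm (X x - X p) \<le> (K + \<epsilon>) * norm (x - p)"
      using K[of "x - p"] norm_triangle_sub[of "X x - X p" "A (x - p)"] by (simp add: algebra_simps)
    with Kr[of "norm (x - p)"] that show ?thesis by simp
  qed
  define M where "M = norm (X p) + \<eta>"
  have M: "norm (X x) \<le> M" if "norm (x - p) < r" for x
    using near[OF that] norm_triangle_sub[of "X x" "X p"] by (simp add: M_def)
  have "0 \<le> M" using \<open>0 < \<eta>\<close> by (simp add: M_def)
  \<comment> \<open>Three demands on the time: curves starting within r / 2 stay within r, the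
    growth bound applies, and the second-order term stays below \<eta> / 2. The other half of the
    error is 2 \<epsilon> = \<eta> / 2.\<close>
  define \<delta> where "\<delta> = min (r / 2 / (M + 1)) (min (1 / 2 / (K + \<epsilon> + 1)) (\<eta> / 2 / (2 * K * (K + \<epsilon>) + 1)))"
  have \<delta>: "M * t < r / 2" "(K + \<epsilon>) * t < 1/2" "2 * K * (K + \<epsilon>) * t < \<eta> / 2" if "0 < t" "t < \<delta>" for t
    by (rule small_time; use that \<open>0 < r\<close> \<open>0 \<le> M\<close> \<open>0 \<le> K\<close> \<open>0 < \<epsilon>\<close> \<open>0 < \<eta>\<close> in \<open>simp add: \<delta>_def\<close>)+
  have curve: "\<exists>c. c 0 = p\<^sub>1 \<and> c t = q\<^sub>1 \<and>
      (\<forall>s\<in>{0..t}. (c has_vector_derivative X (c s)) (at s within {0..t})) \<and>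
      (\<forall>s\<in>{0..t}. norm (c s - p) < r)"
    if t: "0 < t" "t < \<delta>" "p\<^sub>1 \<in> ball p (r / 2)" "flows_to U X t p\<^sub>1 q\<^sub>1" for t p\<^sub>1 q\<^sub>1
  proof -
    obtain c where c: "c 0 = p\<^sub>1" "c t = q\<^sub>1"
      "\<And>s. s \<in> {0..t} \<Longrightarrow> (c has_vector_derivative X (c s)) (at s within {0..t})"
      using t by (auto simp: flows_to_def closed_segment_eq_real_ivl)
    have "norm (c 0 - p) + M * t < r"
      using t c \<delta>[of t] by (simp add: dist_norm norm_minus_commute)
    then have "norm (c s - p) < r" if "s \<in> {0..t}" for s
      using integral_curve_stays[OF c(3) M \<open>0 \<le> M\<close>] that by blast
    with c show ?thesis by blast
  qed
  show ?thesis
  proof (rule that)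
    show "0 < r / 2" using \<open>0 < r\<close> by simp
    show "0 < \<delta>"
      using \<open>0 < r\<close> \<open>0 \<le> M\<close> \<open>0 \<le> K\<close> \<open>0 < \<epsilon>\<close> \<open>0 < \<eta>\<close> by (simp add: \<delta>_def add_nonneg_pos)
  next
    fix t p\<^sub>1 q\<^sub>1 p\<^sub>2 q\<^sub>2
    assume t: "0 < t" "t < \<delta>" "p\<^sub>1 \<in> ball p (r/2)" "p\<^sub>2 \<in> ball p (r/2)"
      "flows_to U X t p\<^sub>1 q\<^sub>1" "flows_to U X t p\<^sub>2 q\<^sub>2"
    obtain c\<^sub>1 where c\<^sub>1: "c\<^sub>1 0 = p\<^sub>1" "c\<^sub>1 t = q\<^sub>1"
      "\<forall>s\<in>{0..t}. (c\<^sub>1 has_vector_derivative X (c\<^sub>1 s)) (at s within {0..t})"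
      "\<forall>s\<in>{0..t}. norm (c\<^sub>1 s - p) < r"
      using curve[OF t(1,2,3,5)] by blast
    obtain c\<^sub>2 where c\<^sub>2: "c\<^sub>2 0 = p\<^sub>2" "c\<^sub>2 t = q\<^sub>2"
      "\<forall>s\<in>{0..t}. (c\<^sub>2 has_vector_derivative X (c\<^sub>2 s)) (at s within {0..t})"
      "\<forall>s\<in>{0..t}. norm (c\<^sub>2 s - p) < r"
      using curve[OF t(1,2,4,6)] by blast
    have "norm (c\<^sub>2 t - c\<^sub>1 t - (c\<^sub>2 0 - c\<^sub>1 0) - t *\<^sub>R A (c\<^sub>2 0 - c\<^sub>1 0))
        \<le> t * (2 * \<epsilon> + 2 * K * (K + \<epsilon>) * t) * norm (c\<^sub>2 0 - c\<^sub>1 0)"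
      using c\<^sub>1 c\<^sub>2 \<delta>[OF t(1,2)] \<open>0 \<le> K\<close> \<open>0 < \<epsilon>\<close> t
      by (intro integral_curve_difference[where S = "ball p r" and X = X, OF _ _ _ _ linA K] r\<^sub>0)
         (auto simp: dist_norm norm_minus_commute r_def)
    also have "\<dots> \<le> t * \<eta> * norm (c\<^sub>2 0 - c\<^sub>1 0)"
      using \<delta>[OF t(1,2)] t by (intro mult_right_mono mult_left_mono) (auto simp: \<epsilon>_def)
    finally show "norm (q\<^sub>2 - q\<^sub>1 - (p\<^sub>2 - p\<^sub>1) - t *\<^sub>R A (p\<^sub>2 - p\<^sub>1)) \<le> \<eta> * t * norm (p\<^sub>2 - p\<^sub>1)"
      by (simp add: c\<^sub>1 c\<^sub>2 mult.commute)
  next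
    fix t q assume t: "0 < t" "t < \<delta>" "flows_to U X t p q"
    obtain c where c: "c 0 = p" "c t = q"
      "\<forall>s\<in>{0..t}. (c has_vector_derivative X (c s)) (at s within {0..t})"
      "\<forall>s\<in>{0..t}. norm (c s - p) < r"
      using curve[OF t(1,2) _ t(3)] \<open>0 < r\<close> by auto
    define z where "z s = c s - s *\<^sub>R X p" for s
    have z: "(z has_vector_derivative X (c s) - X p) (at s within {0..t})" if "s \<in> {0..t}" for s
      unfolding z_def using c(3) that by (auto intro!: derivative_eq_intros)
    have "norm (z t - z 0) \<le> \<eta> * t"
      by (rule vector_derivative_norm_bound[OF z]) (use c near t in auto)
    then show "norm (q - p - t *\<^sub>R X p) \<le> \<eta> * t"
      by (simp add: z_def c algebra_simps)
  qed
qed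


section \<open>Tangent planes of moved surfaces\<close>

definition hor :: "pt \<Rightarrow> real \<times> real" where "hor x = (fst x, fst (snd x))"

definition ver :: "pt \<Rightarrow> real \<times> real \<times> real" where "ver x = snd (snd x)"

definition lift :: "real \<times> real \<Rightarrow> real \<times> real \<times> real \<Rightarrow> pt" where "lift w s = (fst w, snd w, s)"

lemma hor_ver_lift [simp]: "hor (lift w s) = w" "ver (lift w s) = s" "lift (hor x) (ver x) = x"
  by (auto simp: hor_def ver_def lift_def)

lemma bounded_linear_hor: "bounded_linear hor"
  unfolding hor_def
  by (intro bounded_linear_Pair bounded_linear_fst bounded_linear_compose[OF bounded_linear_fst] bounded_linear_snd)

lemma bounded_linear_ver: "bounded_linear ver"
  unfolding ver_def by (intro bounded_linear_compose[OF bounded_linear_snd] bounded_linear_snd)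

lemma hor_add [simp]: "hor (x + y) = hor x + hor y" and hor_diff [simp]: "hor (x - y) = hor x - hor y"
  and hor_scaleR [simp]: "hor (c *\<^sub>R x) = c *\<^sub>R hor x"
  by (simp_all add: hor_def)

lemma ver_add [simp]: "ver (x + y) = ver x + ver y" and ver_diff [simp]: "ver (x - y) = ver x - ver y"
  and ver_scaleR [simp]: "ver (c *\<^sub>R x) = c *\<^sub>R ver x"
  by (simp_all add: ver_def)

lemma norm_ver_le: "norm (ver x) \<le> norm x"
  unfolding ver_def using norm_snd_le order_trans by (metis prod.collapse)

lemma abs_hor_le: "\<bar>fst (hor x)\<bar> \<le> norm x" "\<bar>snd (hor x)\<bar> \<le> norm x"
  using norm_fst_le[of "fst x" "snd x"] norm_fst_le[of "fst (snd x)" "snd (snd x)"]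
    norm_snd_le[of "snd x" "fst x"] by (auto simp: hor_def)

text \<open>The differential of a map of (u, v) with these partial derivatives. Its graph is the
  tangent plane of a solution surface, and
  \<open>ver x - jet_map j\<^sub>1 j\<^sub>2 (hor x)\<close> measures how far the vector
  \<open>x\<close> is off that plane.\<close>

definition jet_map :: "'a::real_vector \<Rightarrow> 'a \<Rightarrow> real \<times> real \<Rightarrow> 'a" where
  "jet_map j\<^sub>1 j\<^sub>2 h = fst h *\<^sub>R j\<^sub>1 + snd h *\<^sub>R j\<^sub>2"

lemma graph_defect_bound:
  "norm (ver x - jet_map j\<^sub>1 j\<^sub>2 (hor x)) \<le> (1 + norm j\<^sub>1 + norm j\<^sub>2) * norm x"
proof -
  have "norm (ver x - jet_map j\<^sub>1 j\<^sub>2 (hor x)) \<le> norm (ver x) + norm (jet_map j\<^sub>1 j\<^sub>2 (hor x))"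
    by (rule norm_triangle_ineq4)
  also have "norm (jet_map j\<^sub>1 j\<^sub>2 (hor x)) \<le> norm x * norm j\<^sub>1 + norm x * norm j\<^sub>2"
    unfolding jet_map_def using abs_hor_le[of x]
    by (intro order_trans[OF norm_triangle_ineq] add_mono) (auto intro: mult_right_mono)
  finally show ?thesis using norm_ver_le[of x] by (simp add: algebra_simps)
qed

lemma linear_graph_defect: "linear (\<lambda>x. ver x - jet_map j\<^sub>1 j\<^sub>2 (hor x))"
  by (rule linearI) (auto simp: jet_map_def algebra_simps)

text \<open>The moved points \<open>q h\<close> lie on the graph of \<open>f\<close>, so the limit direction of their difference
  quotients, which is \<open>\<tau> + t A \<tau>\<close> up to \<open>\<epsilon>\<close>, is tangent to that graph.\<close>

lemma moved_tangent:
  fixes p q :: "real \<Rightarrow> pt"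
  assumes f: "(f has_derivative jet_map j\<^sub>1 j\<^sub>2) (at (hor (q 0)))"
    and graph: "ver (q 0) = f (hor (q 0))" "\<forall>\<^sub>F h in at 0. ver (q h) = f (hor (q h))"
    and p: "(p has_vector_derivative \<tau>) (at 0)"
    and A: "bounded_linear A" and "0 \<le> \<epsilon>"
    and q: "\<forall>\<^sub>F h in at 0. norm (q h - q 0 - (p h - p 0) - t *\<^sub>R A (p h - p 0)) \<le> \<epsilon> * norm (p h - p 0)"
  shows "norm (ver (\<tau> + t *\<^sub>R A \<tau>) - jet_map j\<^sub>1 j\<^sub>2 (hor (\<tau> + t *\<^sub>R A \<tau>)))
    \<le> (1 + norm j\<^sub>1 + norm j\<^sub>2) * \<epsilon> * norm \<tau>"
proof -
  define Z where "Z x = ver x - jet_map j\<^sub>1 j\<^sub>2 (hor x)" for x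
  define B where "B = 1 + norm j\<^sub>1 + norm j\<^sub>2"
  have linZ: "linear Z" unfolding Z_def[abs_def] by (rule linear_graph_defect)
  have Z: "norm (Z x) \<le> B * norm x" for x
    unfolding Z_def B_def by (rule graph_defect_bound)
  have blZ: "bounded_linear Z"
    using linZ Z by (intro bounded_linear_intro[where K = B]) (auto simp: linear_add linear_scale mult.commute)
  have "0 \<le> B" by (simp add: B_def)
  obtain K where "0 \<le> K" and K: "\<And>x. norm (A x) \<le> K * norm x"
    using bounded_linear.nonneg_bounded[OF A] by (auto simp: mult.commute)
  define C where "C = 1 + \<bar>t\<bar> * K + \<epsilon>"
  have "0 < C" using \<open>0 \<le> K\<close> \<open>0 \<le> \<epsilon>\<close> by (simp add: C_def add_pos_nonneg)
  have q_le: "\<forall>\<^sub>F h in at 0. norm (q h - q 0) \<le> C * norm (p h - p 0)"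
    using q
  proof eventually_elim
    case (elim h)
    have "norm (q h - q 0) \<le> norm (q h - q 0 - (p h - p 0) - t *\<^sub>R A (p h - p 0))
        + norm (p h - p 0) + norm (t *\<^sub>R A (p h - p 0))"
      using norm_triangle_sub[of "q h - q 0" "p h - p 0"]
        norm_triangle_sub[of "q h - q 0 - (p h - p 0)" "t *\<^sub>R A (p h - p 0)"] by linarith
    moreover have "norm (t *\<^sub>R A (p h - p 0)) \<le> \<bar>t\<bar> * (K * norm (p h - p 0))"
      using K by (simp add: mult_left_mono)
    ultimately show ?case using elim by (simp add: C_def algebra_simps)
  qed
  have p_lim: "(p \<longlongrightarrow> p 0) (at 0)"
    using has_vector_derivative_continuous[OF p] by (simp add: continuous_at isCont_def)
  have q_lim: "(q \<longlongrightarrow> q 0) (at 0)"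
  proof -
    have "((\<lambda>h. C * norm (p h - p 0)) \<longlongrightarrow> C * norm (p 0 - p 0)) (at 0)"
      by (intro tendsto_intros p_lim)
    then have "((\<lambda>h. q h - q 0) \<longlongrightarrow> 0) (at 0)"
      by (intro Lim_null_comparison[OF q_le]) simp
    then show ?thesis by (simp add: LIM_zero_iff)
  qed
  have "((\<lambda>x. f (hor x)) has_derivative (\<lambda>h. jet_map j\<^sub>1 j\<^sub>2 (hor h))) (at (q 0))"
    using has_derivative_compose[of hor hor "q 0" UNIV f "jet_map j\<^sub>1 j\<^sub>2"] f
      bounded_linear_imp_has_derivative[OF bounded_linear_hor] by simp
  then have \<psi>: "((\<lambda>x. ver x - f (hor x)) has_derivative Z) (at (q 0))"
    unfolding Z_def[abs_def]
    by (intro has_derivative_diff bounded_linear_imp_has_derivative[OF bounded_linear_ver])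
  define g where "g h = (1 / h) *\<^sub>R (p h - p 0)" for h
  have g: "(g \<longlongrightarrow> \<tau>) (at 0)"
  proof -
    have "((\<lambda>h. norm (p h - p 0 - h *\<^sub>R \<tau>) / norm h) \<longlongrightarrow> 0) (at 0)"
      using p by (simp add: has_vector_derivative_def has_derivative_iff_norm)
    moreover have "\<forall>\<^sub>F h in at 0. norm (p h - p 0 - h *\<^sub>R \<tau>) / norm h = norm (g h - \<tau>)"
      using eventually_neq_at_within[of 0 0 UNIV]
    proof eventually_elim
      case (elim h)
      then have "g h - \<tau> = (1 / h) *\<^sub>R (p h - p 0 - h *\<^sub>R \<tau>)"
        by (simp add: g_def scaleR_diff_right)
      then show ?case by simp
    qed
    ultimately have "((\<lambda>h. norm (g h - \<tau>)) \<longlongrightarrow> 0) (at 0)"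
      by (simp add: tendsto_cong)
    then show ?thesis by (simp add: tendsto_norm_zero_iff LIM_zero_iff)
  qed
  \<comment> \<open>The slack \<kappa> is due to \<open>f\<close> being differentiated at one point
    only; it is removed at the end by letting it tend to 0.\<close>
  have "norm (Z (\<tau> + t *\<^sub>R A \<tau>)) \<le> (\<kappa> * C + B * \<epsilon>) * norm \<tau>" if \<kappa>: "0 < \<kappa>" for \<kappa>
  proof (rule tendsto_le[OF trivial_limit_at])
    show "((\<lambda>h. norm (Z (g h + t *\<^sub>R A (g h)))) \<longlongrightarrow> norm (Z (\<tau> + t *\<^sub>R A \<tau>))) (at 0)"
      using tendsto_norm[OF bounded_linear.tendsto[OF blZ
            tendsto_add[OF g tendsto_scaleR[OF tendsto_const bounded_linear.tendsto[OF A g]]]]] .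
    show "((\<lambda>h. (\<kappa> * C + B * \<epsilon>) * norm (g h)) \<longlongrightarrow> (\<kappa> * C + B * \<epsilon>) * norm \<tau>) (at 0)"
      by (intro tendsto_intros g)
    obtain d where "0 < d" and d: "\<And>x. norm (x - q 0) < d \<Longrightarrow>
        norm ((ver x - f (hor x)) - (ver (q 0) - f (hor (q 0))) - Z (x - q 0)) \<le> \<kappa> * norm (x - q 0)"
      using conjunct2[OF iffD1[OF has_derivative_at_alt \<psi>], rule_format, OF \<kappa>] by metis
    have "\<forall>\<^sub>F h in at 0. norm (q h - q 0) < d"
      using q_lim \<open>0 < d\<close> by (simp add: tendsto_iff dist_norm)
    then show "\<forall>\<^sub>F h in at 0. norm (Z (g h + t *\<^sub>R A (g h))) \<le> (\<kappa> * C + B * \<epsilon>) * norm (g h)"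
      using graph(2) q q_le
    proof eventually_elim
      case (elim h)
      define y where "y = p h - p 0"
      define e where "e = q h - q 0 - y - t *\<^sub>R A y"
      \<comment> \<open>Both points lie on the graph, where \<open>ver x - f (hor x)\<close>
        vanishes, so its derivative \<open>Z\<close> is small on their difference.\<close>
      have "norm (Z (q h - q 0)) \<le> \<kappa> * norm (q h - q 0)"
        using d[OF elim(1)] elim(2) graph(1) by simp
      also have "\<dots> \<le> \<kappa> * (C * norm y)"
        using elim(4) that by (simp add: y_def)
      finally have 1: "norm (Z (q h - q 0)) \<le> \<kappa> * C * norm y" by (simp add: mult.assoc)
      have "norm (Z e) \<le> B * norm e" by (rule Z)
      also have "\<dots> \<le> B * (\<epsilon> * norm y)"
        using elim(3) \<open>0 \<le> B\<close> by (intro mult_left_mono) (auto simp: e_def y_def)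
      finally have 2: "norm (Z e) \<le> B * \<epsilon> * norm y" by (simp add: mult.assoc)
      have Zy: "Z (y + t *\<^sub>R A y) = Z (q h - q 0) - Z e"
        by (simp add: e_def add.commute flip: linear_diff[OF linZ])
      have "norm (Z (y + t *\<^sub>R A y)) \<le> (\<kappa> * C + B * \<epsilon>) * norm y"
        unfolding Zy using 1 2 norm_triangle_ineq4[of "Z (q h - q 0)" "Z e"] unfolding distrib_right by linarith
      moreover have "g h + t *\<^sub>R A (g h) = (1 / h) *\<^sub>R (y + t *\<^sub>R A y)"
        by (simp add: g_def y_def linear_scale[OF bounded_linear.linear[OF A]] scaleR_add_right)
      moreover have "norm (g h) = \<bar>1 / h\<bar> * norm y"
        by (simp add: g_def y_def)
      ultimately show ?case
        using mult_left_mono[of "norm (Z (y + t *\<^sub>R A y))" "(\<kappa> * C + B * \<epsilon>) * norm y" "\<bar>1 / h\<bar>"]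
        by (simp add: linear_scale[OF linZ] mult.left_commute)
    qed
  qed
  then have "norm (Z (\<tau> + t *\<^sub>R A \<tau>)) \<le> B * \<epsilon> * norm \<tau> + \<kappa>" if "0 < \<kappa>" for \<kappa>
  proof -
    have "0 \<le> C * norm \<tau>" using \<open>0 < C\<close> by simp
    then have "\<kappa> / (C * norm \<tau> + 1) * (C * norm \<tau>) \<le> \<kappa>" "0 < \<kappa> / (C * norm \<tau> + 1)"
      using that by (auto simp: field_simps)
    with \<open>\<And>\<kappa>. 0 < \<kappa> \<Longrightarrow> norm (Z (\<tau> + t *\<^sub>R A \<tau>)) \<le> (\<kappa> * C + B * \<epsilon>) * norm \<tau>\<close>[of "\<kappa> / (C * norm \<tau> + 1)"]
    show ?thesis by (simp add: algebra_simps)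
  qed
  then have "norm (Z (\<tau> + t *\<^sub>R A \<tau>)) \<le> B * \<epsilon> * norm \<tau>"
    by (rule field_le_epsilon)
  then show ?thesis by (simp add: Z_def B_def)
qed

text \<open>The moved tangent vectors lie, up to o(t), in the plane with the unknown jet
  \<open>(j\<^sub>1 t, j\<^sub>2 t)\<close>. As the error bound contains that jet too, the case
  \<eta> = 1 is used to bound the jet, then to show that it converges, and only then are the
  quotients identified. The limits are the first prolongation formula: the total derivative of the
  fibre part minus the jet applied to the total derivative of the base part.\<close>

lemma jet_difference_quotient:
  fixes j\<^sub>1 j\<^sub>2 :: "real \<Rightarrow> 'a::real_normed_vector"
  assumes est: "\<And>\<eta>. 0 < \<eta> \<Longrightarrow> \<forall>\<^sub>F t in at_right 0.
      norm (a\<^sub>1 + t *\<^sub>R s\<^sub>1 - (j\<^sub>1 t + t *\<^sub>R jet_map (j\<^sub>1 t) (j\<^sub>2 t) \<omega>\<^sub>1)) \<le> (1 + norm (j\<^sub>1 t) + norm (j\<^sub>2 t)) * (\<eta> * t) \<and>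
      norm (a\<^sub>2 + t *\<^sub>R s\<^sub>2 - (j\<^sub>2 t + t *\<^sub>R jet_map (j\<^sub>1 t) (j\<^sub>2 t) \<omega>\<^sub>2)) \<le> (1 + norm (j\<^sub>1 t) + norm (j\<^sub>2 t)) * (\<eta> * t)"
  shows "((\<lambda>t. (1 / t) *\<^sub>R (j\<^sub>1 t - a\<^sub>1)) \<longlongrightarrow> s\<^sub>1 - jet_map a\<^sub>1 a\<^sub>2 \<omega>\<^sub>1) (at_right 0)"
    and "((\<lambda>t. (1 / t) *\<^sub>R (j\<^sub>2 t - a\<^sub>2)) \<longlongrightarrow> s\<^sub>2 - jet_map a\<^sub>1 a\<^sub>2 \<omega>\<^sub>2) (at_right 0)"
proof -
  define m where "m t = norm (j\<^sub>1 t) + norm (j\<^sub>2 t)" for t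
  define N where "N = \<bar>fst \<omega>\<^sub>1\<bar> + \<bar>snd \<omega>\<^sub>1\<bar> + \<bar>fst \<omega>\<^sub>2\<bar> + \<bar>snd \<omega>\<^sub>2\<bar>"
  have jm: "norm (jet_map (j\<^sub>1 t) (j\<^sub>2 t) \<omega>) \<le> N * m t" if "\<omega> = \<omega>\<^sub>1 \<or> \<omega> = \<omega>\<^sub>2" for t \<omega>
  proof -
    have "norm (jet_map (j\<^sub>1 t) (j\<^sub>2 t) \<omega>) \<le> \<bar>fst \<omega>\<bar> * norm (j\<^sub>1 t) + \<bar>snd \<omega>\<bar> * norm (j\<^sub>2 t)"
      unfolding jet_map_def by (rule order_trans[OF norm_triangle_ineq]) simp
    also have "\<dots> \<le> N * norm (j\<^sub>1 t) + N * norm (j\<^sub>2 t)"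
      using that by (intro add_mono mult_right_mono) (auto simp: N_def)
    finally show ?thesis by (simp add: m_def algebra_simps)
  qed
  define c where "c = norm s\<^sub>1 + norm s\<^sub>2 + N + 1"
  have "0 < c" by (simp add: c_def N_def add_nonneg_pos)
  have step: "norm (j t - a) \<le> c * t * (1 + m t)"
    if "norm (a + t *\<^sub>R s - (j t + t *\<^sub>R jet_map (j\<^sub>1 t) (j\<^sub>2 t) \<omega>)) \<le> (1 + m t) * t"
      "0 < t" "norm s \<le> norm s\<^sub>1 + norm s\<^sub>2" "\<omega> = \<omega>\<^sub>1 \<or> \<omega> = \<omega>\<^sub>2" for j :: "real \<Rightarrow> 'a" and a s t \<omega>
  proof -
    let ?e = "a + t *\<^sub>R s - (j t + t *\<^sub>R jet_map (j\<^sub>1 t) (j\<^sub>2 t) \<omega>)"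
    have eq: "j t - a = t *\<^sub>R s - t *\<^sub>R jet_map (j\<^sub>1 t) (j\<^sub>2 t) \<omega> - ?e"
      by simp
    have "norm (j t - a) \<le> norm (t *\<^sub>R s) + norm (t *\<^sub>R jet_map (j\<^sub>1 t) (j\<^sub>2 t) \<omega>) + norm ?e"
      by (subst eq) (rule order_trans[OF norm_triangle_ineq4] add_right_mono norm_triangle_ineq4)+
    also have "\<dots> \<le> t * (norm s\<^sub>1 + norm s\<^sub>2) + t * (N * m t) + (1 + m t) * t"
    proof (intro add_mono that(1))
      show "norm (t *\<^sub>R s) \<le> t * (norm s\<^sub>1 + norm s\<^sub>2)"
        using that(2,3) by simp
      show "norm (t *\<^sub>R jet_map (j\<^sub>1 t) (j\<^sub>2 t) \<omega>) \<le> t * (N * m t)"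
        using that(2) jm[OF that(4), of t] by simp
    qed
    also have "\<dots> \<le> c * t * (1 + m t)"
    proof -
      have "0 \<le> t * (norm s\<^sub>1 + norm s\<^sub>2) * m t + t * N"
        using that by (simp add: m_def N_def)
      then show ?thesis by (simp add: c_def algebra_simps)
    qed
    finally show ?thesis .
  qed
  have small: "\<forall>\<^sub>F t in at_right 0. norm (j\<^sub>1 t - a\<^sub>1) \<le> c * t * (1 + m t) \<and> norm (j\<^sub>2 t - a\<^sub>2) \<le> c * t * (1 + m t)"
    using est[of 1, simplified] eventually_at_right_less[of "0::real"]
  proof eventually_elim
    case (elim t)
    have "1 + norm (j\<^sub>1 t) + norm (j\<^sub>2 t) = 1 + m t" by (simp add: m_def)
    note e = elim(1)[unfolded this]
    show ?case
      using step[of a\<^sub>1 t s\<^sub>1 j\<^sub>1 \<omega>\<^sub>1, OF conjunct1[OF e] elim(2)]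
        step[of a\<^sub>2 t s\<^sub>2 j\<^sub>2 \<omega>\<^sub>2, OF conjunct2[OF e] elim(2)] by simp
  qed
  \<comment> \<open>Once \<open>c * t \<le> 1/4\<close>, adding the two bounds in
    \<open>small\<close> gives
    \<open>m t \<le> norm a\<^sub>1 + norm a\<^sub>2 + (1 + m t) / 2\<close>, which is
    \<open>m t \<le> M\<close>.\<close>
  define M where "M = 1 + 2 * (norm a\<^sub>1 + norm a\<^sub>2)"
  have "0 \<le> M" by (simp add: M_def)
  have t_small: "\<forall>\<^sub>F t in at_right 0. t < 1 / (4 * c)"
    using \<open>0 < c\<close> by (auto intro: eventually_at_rightI[of 0 "1 / (4 * c)"])
  have bdd: "\<forall>\<^sub>F t in at_right 0. m t \<le> M"
    using small t_small eventually_at_right_less[of "0::real"]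
  proof eventually_elim
    case (elim t)
    have "c * t \<le> 1/4"
      using elim \<open>0 < c\<close> by (simp add: field_simps)
    then have "c * t * (1 + m t) \<le> 1/4 * (1 + m t)"
      by (intro mult_right_mono) (auto simp: m_def)
    then show ?case
      using elim norm_triangle_sub[of "j\<^sub>1 t" a\<^sub>1] norm_triangle_sub[of "j\<^sub>2 t" a\<^sub>2]
      by (simp add: M_def m_def)
  qed
  have to_a: "(j \<longlongrightarrow> a) (at_right 0)"
    if "\<forall>\<^sub>F t in at_right 0. norm (j t - a) \<le> c * t * (1 + m t)" for j :: "real \<Rightarrow> 'a" and a
  proof -
    have "\<forall>\<^sub>F t in at_right 0. norm (j t - a) \<le> c * t * (1 + M)"
      using that bdd eventually_at_right_less[of "0::real"]
    proof eventually_elim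
      case (elim t)
      have "c * t * (1 + m t) \<le> c * t * (1 + M)"
        using elim \<open>0 < c\<close> by (intro mult_left_mono) auto
      with elim show ?case by linarith
    qed
    moreover have "((\<lambda>t. c * t * (1 + M)) \<longlongrightarrow> c * 0 * (1 + M)) (at_right 0)"
      by (intro tendsto_intros)
    ultimately have "((\<lambda>t. j t - a) \<longlongrightarrow> 0) (at_right 0)"
      using Lim_null_comparison[of "\<lambda>t. j t - a" "\<lambda>t. c * t * (1 + M)"] by simp
    then show ?thesis by (simp add: LIM_zero_iff)
  qed
  have lim: "(j\<^sub>1 \<longlongrightarrow> a\<^sub>1) (at_right 0)" "(j\<^sub>2 \<longlongrightarrow> a\<^sub>2) (at_right 0)"
    by (rule to_a, rule eventually_mono[OF small], simp)+
  have quot: "((\<lambda>t. (1 / t) *\<^sub>R (j t - a)) \<longlongrightarrow> s - jet_map a\<^sub>1 a\<^sub>2 \<omega>) (at_right 0)"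
    if est: "\<And>\<eta>. 0 < \<eta> \<Longrightarrow> \<forall>\<^sub>F t in at_right 0.
      norm (a + t *\<^sub>R s - (j t + t *\<^sub>R jet_map (j\<^sub>1 t) (j\<^sub>2 t) \<omega>)) \<le> (1 + norm (j\<^sub>1 t) + norm (j\<^sub>2 t)) * (\<eta> * t)"
    for j :: "real \<Rightarrow> 'a" and a s \<omega>
  proof -
    let ?r = "\<lambda>t. s - (1 / t) *\<^sub>R (j t - a) - jet_map (j\<^sub>1 t) (j\<^sub>2 t) \<omega>"
    have r0: "(?r \<longlongrightarrow> 0) (at_right 0)"
    proof (rule tendstoI)
      fix e :: real assume "0 < e"
      define \<eta> where "\<eta> = e / 2 / (1 + M)"
      have "0 < \<eta>" using \<open>0 < e\<close> \<open>0 \<le> M\<close> by (simp add: \<eta>_def)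
      have "(1 + M) * \<eta> = e / 2"
        unfolding \<eta>_def using \<open>0 \<le> M\<close> nonzero_mult_div_cancel_left[of "1 + M" "e / 2"] by simp
      then have \<eta>: "(1 + M) * \<eta> < e" using \<open>0 < e\<close> by linarith
      show "\<forall>\<^sub>F t in at_right 0. dist (?r t) 0 < e"
        using est[OF \<open>0 < \<eta>\<close>] bdd eventually_at_right_less[of "0::real"]
      proof eventually_elim
        case (elim t)
        have "?r t = (1 / t) *\<^sub>R (a + t *\<^sub>R s - (j t + t *\<^sub>R jet_map (j\<^sub>1 t) (j\<^sub>2 t) \<omega>))"
          using elim by (simp add: algebra_simps)
        then have "norm (?r t) = norm (a + t *\<^sub>R s - (j t + t *\<^sub>R jet_map (j\<^sub>1 t) (j\<^sub>2 t) \<omega>)) / t"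
          using elim(3) by simp
        also have "\<dots> \<le> (1 + norm (j\<^sub>1 t) + norm (j\<^sub>2 t)) * (\<eta> * t) / t"
          using elim(1,3) by (intro divide_right_mono) auto
        also have "\<dots> = (1 + m t) * \<eta>"
          using elim by (simp add: m_def)
        also have "\<dots> \<le> (1 + M) * \<eta>"
          using elim \<open>0 < \<eta>\<close> by (intro mult_right_mono) auto
        finally show ?case using \<eta> by simp
      qed
    qed
    have "((\<lambda>t. jet_map (j\<^sub>1 t) (j\<^sub>2 t) \<omega>) \<longlongrightarrow> jet_map a\<^sub>1 a\<^sub>2 \<omega>) (at_right 0)"
      unfolding jet_map_def by (intro tendsto_intros lim)
    with r0 have "((\<lambda>t. s - ?r t - jet_map (j\<^sub>1 t) (j\<^sub>2 t) \<omega>) \<longlongrightarrow> s - 0 - jet_map a\<^sub>1 a\<^sub>2 \<omega>) (at_right 0)"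
      by (rule tendsto_diff[OF tendsto_diff[OF tendsto_const]])
    then show ?thesis by simp
  qed
  show "((\<lambda>t. (1 / t) *\<^sub>R (j\<^sub>1 t - a\<^sub>1)) \<longlongrightarrow> s\<^sub>1 - jet_map a\<^sub>1 a\<^sub>2 \<omega>\<^sub>1) (at_right 0)"
  proof (rule quot)
    fix \<eta> :: real assume "0 < \<eta>"
    then show "\<forall>\<^sub>F t in at_right 0. norm (a\<^sub>1 + t *\<^sub>R s\<^sub>1 - (j\<^sub>1 t + t *\<^sub>R jet_map (j\<^sub>1 t) (j\<^sub>2 t) \<omega>\<^sub>1))
        \<le> (1 + norm (j\<^sub>1 t) + norm (j\<^sub>2 t)) * (\<eta> * t)"
      by (rule eventually_mono[OF est conjunct1])
  qed
  show "((\<lambda>t. (1 / t) *\<^sub>R (j\<^sub>2 t - a\<^sub>2)) \<longlongrightarrow> s\<^sub>2 - jet_map a\<^sub>1 a\<^sub>2 \<omega>\<^sub>2) (at_right 0)"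
  proof (rule quot)
    fix \<eta> :: real assume "0 < \<eta>"
    then show "\<forall>\<^sub>F t in at_right 0. norm (a\<^sub>2 + t *\<^sub>R s\<^sub>2 - (j\<^sub>2 t + t *\<^sub>R jet_map (j\<^sub>1 t) (j\<^sub>2 t) \<omega>\<^sub>2))
        \<le> (1 + norm (j\<^sub>1 t) + norm (j\<^sub>2 t)) * (\<eta> * t)"
      by (rule eventually_mono[OF est conjunct2])
  qed
qed


section \<open>The linearized system along a symmetry\<close>

text \<open>The system as a function on 1-jets. It is linear in the point (E, F, G) and linear in
  the pair of partial derivatives, so difference quotients, scaling and separation by degree become
  algebra.\<close>

definition pde_form :: "real \<times> real \<times> real \<Rightarrow> real \<times> real \<times> real \<Rightarrow> real \<times> real \<times> real \<Rightarrow> real \<times> real \<times> real" where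
  "pde_form = (\<lambda>(E, F, G) (Eu, Fu, Gu) (Ev, Fv, Gv).
     (2 * E * Fu - F * Eu - E * Ev, 2 * G * Fv - F * Gv - G * Gu,
      G * Eu + E * Gv - 2 * F * (Fu + Fv) + (3 * F - 2 * G) * Ev + (3 * F - 2 * E) * Gu))"

lemma pde_system_iff_form:
  "pde_system_at E F G u v \<longleftrightarrow> pde_form (E u v, F u v, G u v)
     (pd_u E u v, pd_u F u v, pd_u G u v) (pd_v E u v, pd_v F u v, pd_v G u v) = 0"
  by (simp add: pde_system_at_def pde_form_def zero_prod_def)

lemma pde_form_add_left: "pde_form (s + s') j j' = pde_form s j j' + pde_form s' j j'"
  and pde_form_add_right: "pde_form s (j + k) (j' + k') = pde_form s j j' + pde_form s k k'"
  and pde_form_scaleR_left: "pde_form (c *\<^sub>R s) j j' = c *\<^sub>R pde_form s j j'"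
  and pde_form_scaleR_right: "pde_form s (c *\<^sub>R j) (c *\<^sub>R j') = c *\<^sub>R pde_form s j j'"
  by (auto simp: pde_form_def algebra_simps split: prod.split)

lemma tendsto_pde_form:
  assumes "(s \<longlongrightarrow> s\<^sub>0) Fi" "(j \<longlongrightarrow> j\<^sub>0) Fi" "(j' \<longlongrightarrow> j'\<^sub>0) Fi"
  shows "((\<lambda>t. pde_form (s t) (j t) (j' t)) \<longlongrightarrow> pde_form s\<^sub>0 j\<^sub>0 j'\<^sub>0) Fi"
  unfolding pde_form_def split_beta by (intro tendsto_intros assms)

lemma partial_derivatives:
  assumes "(\<lambda>(u, v). f u v) differentiable (at (u, v))"
  shows "((\<lambda>w. f (fst w) (snd w)) has_derivative (\<lambda>h. fst h * pd_u f u v + snd h * pd_v f u v)) (at (u, v))"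
    and "((\<lambda>x. f x v) has_field_derivative pd_u f u v) (at u)"
    and "((\<lambda>y. f u y) has_field_derivative pd_v f u v) (at v)"
proof -
  obtain D where D: "((\<lambda>w. f (fst w) (snd w)) has_derivative D) (at (u, v))"
    using assms unfolding differentiable_def case_prod_beta' by blast
  then interpret D: bounded_linear D by (rule has_derivative_bounded_linear)
  have D_sum: "D h = fst h * D (1, 0) + snd h * D (0, 1)" for h
    using D.add[of "fst h *\<^sub>R (1, 0)" "snd h *\<^sub>R (0, 1)"]
    by (simp only: D.scaleR) simp
  have "((\<lambda>x. f (fst (x, v)) (snd (x, v))) has_derivative (\<lambda>h. D (h, 0))) (at u)"
    using D by (intro has_derivative_compose[of "\<lambda>x. (x, v)" "\<lambda>h. (h, 0)" u UNIV "\<lambda>w. f (fst w) (snd w)" D])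
      (auto intro!: derivative_eq_intros)
  then have u: "((\<lambda>x. f x v) has_field_derivative D (1, 0)) (at u)"
    unfolding has_field_derivative_def by (subst (asm) D_sum) (simp add: mult_commute_abs)
  then have pu: "pd_u f u v = D (1, 0)"
    unfolding pd_u_def by (rule DERIV_imp_deriv)
  have "((\<lambda>y. f (fst (u, y)) (snd (u, y))) has_derivative (\<lambda>h. D (0, h))) (at v)"
    using D by (intro has_derivative_compose[of "\<lambda>y. (u, y)" "\<lambda>h. (0, h)" v UNIV "\<lambda>w. f (fst w) (snd w)" D])
      (auto intro!: derivative_eq_intros)
  then have v: "((\<lambda>y. f u y) has_field_derivative D (0, 1)) (at v)"
    unfolding has_field_derivative_def by (subst (asm) D_sum) (simp add: mult_commute_abs)
  then have pv: "pd_v f u v = D (0, 1)"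
    unfolding pd_v_def by (rule DERIV_imp_deriv)
  show "((\<lambda>x. f x v) has_field_derivative pd_u f u v) (at u)" using u pu by simp
  show "((\<lambda>y. f u y) has_field_derivative pd_v f u v) (at v)" using v pv by simp
  show "((\<lambda>w. f (fst w) (snd w)) has_derivative (\<lambda>h. fst h * pd_u f u v + snd h * pd_v f u v)) (at (u, v))"
    using D unfolding pu pv by (subst (asm) D_sum[abs_def])
qed

lemma smooth_on_differentiable: "smooth_on f S \<Longrightarrow> x \<in> S \<Longrightarrow> f differentiable (at x)"
  unfolding smooth_on_def using Ck_on.simps(2) by metis

lemma solution_has_derivative:
  assumes "is_local_solution W E F G" "(u, v) \<in> W"
  shows "((\<lambda>w. (E (fst w) (snd w), F (fst w) (snd w), G (fst w) (snd w))) has_derivative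
     jet_map (pd_u E u v, pd_u F u v, pd_u G u v) (pd_v E u v, pd_v F u v, pd_v G u v)) (at (u, v))"
proof -
  have "(\<lambda>(u, v). E u v) differentiable (at (u, v))" "(\<lambda>(u, v). F u v) differentiable (at (u, v))"
    "(\<lambda>(u, v). G u v) differentiable (at (u, v))"
    using assms unfolding is_local_solution_def by (blast intro: smooth_on_differentiable)+
  note partial_derivatives(1)[OF this(1)] partial_derivatives(1)[OF this(2)] partial_derivatives(1)[OF this(3)]
  then show ?thesis
    by (auto intro!: derivative_eq_intros simp: jet_map_def[abs_def])
qed

text \<open>The determining equation, namely the derivative of the system at t = 0 along the first
  prolongation of \<open>X\<close>. \<open>A\<^sub>u\<close> and \<open>A\<^sub>v\<close> are the
  derivatives of \<open>X\<close> along the coordinate tangent vectors of the surface, so the two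
  arguments of the second form are the components of the prolonged field.\<close>

lemma symmetry_linearized:
  assumes sym: "infinitesimal_symmetry U X" and "open U"
    and sol: "is_local_solution W E F G" and W: "surface W E F G \<subseteq> U" and uv: "(u, v) \<in> W"
  defines "s \<equiv> (E u v, F u v, G u v)"
    and "j\<^sub>u \<equiv> (pd_u E u v, pd_u F u v, pd_u G u v)" and "j\<^sub>v \<equiv> (pd_v E u v, pd_v F u v, pd_v G u v)"
  defines "A \<equiv> frechet_derivative X (at (lift (u, v) s))"
  defines "A\<^sub>u \<equiv> A (lift (1, 0) j\<^sub>u)" and "A\<^sub>v \<equiv> A (lift (0, 1) j\<^sub>v)"
  shows "pde_form (ver (X (lift (u, v) s))) j\<^sub>u j\<^sub>v +
    pde_form s (ver A\<^sub>u - jet_map j\<^sub>u j\<^sub>v (hor A\<^sub>u)) (ver A\<^sub>v - jet_map j\<^sub>u j\<^sub>v (hor A\<^sub>v)) = 0"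
proof -
  define f where "f w = (E (fst w) (snd w), F (fst w) (snd w), G (fst w) (snd w))" for w
  define p where "p = lift (u, v) s"
  define \<tau> where "\<tau> e = lift e (jet_map j\<^sub>u j\<^sub>v e)" for e
  have smooth: "smooth_on X U"
    using sym by (simp add: infinitesimal_symmetry_def vector_fields_def)
  have surf: "lift w (f w) \<in> surface W' E F G \<longleftrightarrow> w \<in> W'" for w W'
    by (cases w) (auto simp: surface_def lift_def f_def)
  have fs: "f (u, v) = s" by (simp add: f_def s_def)
  have "p \<in> U" using W surf[of "(u, v)" W] uv by (auto simp: p_def fs)
  have df: "(f has_derivative jet_map j\<^sub>u j\<^sub>v) (at (u, v))"
    using solution_has_derivative[OF sol uv] by (simp add: f_def[abs_def] j\<^sub>u_def j\<^sub>v_def)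
  have A_p: "frechet_derivative X (at p) = A"
    by (simp add: A_def p_def)
  have "(X has_derivative A) (at p)"
    unfolding A_p[symmetric] using smooth_on_differentiable[OF smooth \<open>p \<in> U\<close>]
    by (simp add: frechet_derivative_works)
  then have blA: "bounded_linear A" by (rule has_derivative_bounded_linear)
  define \<gamma> where "\<gamma> e h = lift ((u, v) + h *\<^sub>R e) (f ((u, v) + h *\<^sub>R e))" for e h
  have \<gamma>: "(\<gamma> e has_vector_derivative \<tau> e) (at 0)" for e
  proof -
    have line: "((\<lambda>h. (u, v) + h *\<^sub>R e) has_derivative (\<lambda>h. h *\<^sub>R e)) (at 0)"
      by (auto intro!: derivative_eq_intros)
    have fline: "((\<lambda>h. f ((u, v) + h *\<^sub>R e)) has_derivative (\<lambda>h. jet_map j\<^sub>u j\<^sub>v (h *\<^sub>R e))) (at 0)"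
      using has_derivative_compose[OF line, of f "jet_map j\<^sub>u j\<^sub>v"] df by simp
    have "(\<gamma> e has_derivative (\<lambda>h. lift (h *\<^sub>R e) (jet_map j\<^sub>u j\<^sub>v (h *\<^sub>R e)))) (at 0)"
      unfolding \<gamma>_def[abs_def] lift_def
      by (rule has_derivative_Pair[OF has_derivative_fst[OF line]
            has_derivative_Pair[OF has_derivative_snd[OF line] fline]])
    then show ?thesis
      by (simp add: has_vector_derivative_def \<tau>_def lift_def jet_map_def scaleR_add_right)
  qed
  obtain W\<^sub>0 \<delta>\<^sub>0 where H: "open W\<^sub>0 \<and> (u, v) \<in> W\<^sub>0 \<and> W\<^sub>0 \<subseteq> W \<and> \<delta>\<^sub>0 > 0 \<and>
         (\<forall>t. \<bar>t\<bar> < \<delta>\<^sub>0 \<longrightarrow>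
           (\<forall>p\<in>surface W\<^sub>0 E F G. \<exists>q. flows_to U X t p q) \<and>
           (\<exists>W' E' F' G'. is_local_solution W' E' F' G' \<and>
              flow_image U X t (surface W\<^sub>0 E F G) = surface W' E' F' G'))"
    using conjunct2[OF sym[unfolded infinitesimal_symmetry_def], rule_format, OF conjI[OF sol W] uv]
    by (elim exE) (rule that)
  then have "open W\<^sub>0" "(u, v) \<in> W\<^sub>0" "0 < \<delta>\<^sub>0" by simp_all
  have flow: "\<exists>q. flows_to U X t p' q" if "\<bar>t\<bar> < \<delta>\<^sub>0" "p' \<in> surface W\<^sub>0 E F G" for t p'
    using H that by blast
  have image: "\<exists>W' E' F' G'. is_local_solution W' E' F' G' \<and>
      flow_image U X t (surface W\<^sub>0 E F G) = surface W' E' F' G'" if "\<bar>t\<bar> < \<delta>\<^sub>0" for t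
    using H that by blast
  \<comment> \<open>Naming \<open>close\<close> and \<open>tangent\<close> settles the order of
    quantifiers: \<open>q\<close>, \<open>j\<close> and \<open>j'\<close> are chosen for each
    \<open>t\<close> before \<epsilon> and \<open>r\<close> are known, so that the same jets obey
    the tangent estimate for every later \<eta>.\<close>
  define close where "close t q \<epsilon> r \<longleftrightarrow> (\<forall>p'\<in>ball p r. \<forall>q'. flows_to U X t p' q' \<longrightarrow>
    norm (q' - q - (p' - p) - t *\<^sub>R A (p' - p)) \<le> \<epsilon> * norm (p' - p))" for t q \<epsilon> r
  define tangent where "tangent t \<epsilon> j j' \<longleftrightarrow> (\<forall>e. norm (ver (\<tau> e + t *\<^sub>R A (\<tau> e)) - jet_map j j' (hor (\<tau> e + t *\<^sub>R A (\<tau> e))))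
    \<le> (1 + norm j + norm j') * \<epsilon> * norm (\<tau> e))" for t \<epsilon> j j'
  have "\<exists>q j j'. flows_to U X t p q \<and> pde_form (ver q) j j' = 0 \<and>
      (\<forall>\<epsilon> r. 0 \<le> \<epsilon> \<longrightarrow> 0 < r \<longrightarrow> close t q \<epsilon> r \<longrightarrow> tangent t \<epsilon> j j')" if t: "\<bar>t\<bar> < \<delta>\<^sub>0" for t
  proof -
    have p_surf: "p \<in> surface W\<^sub>0 E F G"
      using surf[of "(u, v)" W\<^sub>0] \<open>(u, v) \<in> W\<^sub>0\<close> by (simp add: p_def fs)
    then obtain q where q: "flows_to U X t p q" using flow[OF t] by blast
    obtain W' E' F' G' where sol': "is_local_solution W' E' F' G'"
      and im: "flow_image U X t (surface W\<^sub>0 E F G) = surface W' E' F' G'"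
      using image[OF t] by blast
    define f' where "f' w = (E' (fst w) (snd w), F' (fst w) (snd w), G' (fst w) (snd w))" for w
    have on': "ver q' = f' (hor q')" if "flows_to U X t p' q'" "p' \<in> surface W\<^sub>0 E F G" for p' q'
    proof -
      have "q' \<in> surface W' E' F' G'" using im that by (auto simp: flow_image_def)
      then show ?thesis by (auto simp: surface_def ver_def hor_def f'_def)
    qed
    have "q \<in> surface W' E' F' G'" using im q p_surf by (auto simp: flow_image_def)
    then obtain u' v' where uv': "(u', v') \<in> W'" and hq: "hor q = (u', v')"
      by (auto simp: surface_def hor_def)
    define j where "j = (pd_u E' u' v', pd_u F' u' v', pd_u G' u' v')"
    define j' where "j' = (pd_v E' u' v', pd_v F' u' v', pd_v G' u' v')"
    have df': "(f' has_derivative jet_map j j') (at (hor q))"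
      using solution_has_derivative[OF sol' uv'] by (simp add: f'_def[abs_def] j_def j'_def hq)
    have "pde_form (ver q) j j' = 0"
      using sol' uv' on'[OF q p_surf] unfolding is_local_solution_def
      by (auto simp: pde_system_iff_form f'_def hq j_def j'_def)
    moreover have "tangent t \<epsilon> j j'" if "0 \<le> \<epsilon>" "0 < r" "close t q \<epsilon> r" for \<epsilon> r
      unfolding tangent_def
    proof
      fix e
      \<comment> \<open>An endpoint is chosen for each point of the curve; at \<open>h = 0\<close>
        it must be the given \<open>q\<close>, where the jet of the moved solution was
        taken.\<close>
      define qq where "qq h = (if h = 0 then q else SOME q'. flows_to U X t (\<gamma> e h) q')" for h
      have \<gamma>0: "\<gamma> e 0 = p" by (simp add: \<gamma>_def p_def fs)
      have "((\<lambda>h. (u, v) + h *\<^sub>R e) \<longlongrightarrow> (u, v) + 0 *\<^sub>R e) (at 0)"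
        by (intro tendsto_intros)
      then have ev_W: "\<forall>\<^sub>F h in at 0. (u, v) + h *\<^sub>R e \<in> W\<^sub>0"
        using \<open>open W\<^sub>0\<close> \<open>(u, v) \<in> W\<^sub>0\<close> by (simp add: topological_tendstoD)
      have ev_surf: "\<forall>\<^sub>F h in at 0. \<gamma> e h \<in> surface W\<^sub>0 E F G \<and> flows_to U X t (\<gamma> e h) (qq h)"
        using ev_W eventually_neq_at_within[of 0 0 UNIV]
      proof eventually_elim
        case (elim h)
        then have "\<gamma> e h \<in> surface W\<^sub>0 E F G" by (simp add: \<gamma>_def surf)
        with someI_ex[OF flow[OF t this]] elim show ?case by (simp add: qq_def)
      qed
      have "(\<gamma> e \<longlongrightarrow> p) (at 0)"
        using has_vector_derivative_continuous[OF \<gamma>[of e]] by (simp add: isCont_def \<gamma>0)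
      then have ev_ball: "\<forall>\<^sub>F h in at 0. \<gamma> e h \<in> ball p r"
        by (rule topological_tendstoD) (use \<open>0 < r\<close> in auto)
      show "norm (ver (\<tau> e + t *\<^sub>R A (\<tau> e)) - jet_map j j' (hor (\<tau> e + t *\<^sub>R A (\<tau> e))))
          \<le> (1 + norm j + norm j') * \<epsilon> * norm (\<tau> e)"
      proof (rule moved_tangent[where q = qq and f = f', OF _ _ _ \<gamma> blA \<open>0 \<le> \<epsilon>\<close>])
        show "(f' has_derivative jet_map j j') (at (hor (qq 0)))"
          using df' by (simp add: qq_def)
        show "ver (qq 0) = f' (hor (qq 0))"
          using on'[OF q p_surf] by (simp add: qq_def)
        show "\<forall>\<^sub>F h in at 0. ver (qq h) = f' (hor (qq h))"
          using ev_surf by eventually_elim (auto intro: on')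
        show "\<forall>\<^sub>F h in at 0. norm (qq h - qq 0 - (\<gamma> e h - \<gamma> e 0) - t *\<^sub>R A (\<gamma> e h - \<gamma> e 0))
            \<le> \<epsilon> * norm (\<gamma> e h - \<gamma> e 0)"
          using ev_surf ev_ball
        proof eventually_elim
          case (elim h)
          have "qq 0 = q" by (simp add: qq_def)
          with \<open>close t q \<epsilon> r\<close>[unfolded close_def, rule_format, OF elim(2) conjunct2[OF elim(1)]]
          show ?case by (simp only: \<gamma>0)
        qed
      qed
    qed
    ultimately show ?thesis using q by blast
  qed
  then obtain q j j' where q: "\<And>t. \<bar>t\<bar> < \<delta>\<^sub>0 \<Longrightarrow> flows_to U X t p (q t)"
    and pde: "\<And>t. \<bar>t\<bar> < \<delta>\<^sub>0 \<Longrightarrow> pde_form (ver (q t)) (j t) (j' t) = 0"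
    and tang: "\<And>t \<epsilon> r. \<lbrakk>\<bar>t\<bar> < \<delta>\<^sub>0; 0 \<le> \<epsilon>; 0 < r; close t (q t) \<epsilon> r\<rbrakk> \<Longrightarrow> tangent t \<epsilon> (j t) (j' t)"
    by metis
  have ev: "\<forall>\<^sub>F t in at_right 0. 0 < t \<and> t < d \<and> \<bar>t\<bar> < \<delta>\<^sub>0" if "0 < d" for d
    by (rule eventually_at_rightI[of 0 "min d \<delta>\<^sub>0"]) (use that \<open>0 < \<delta>\<^sub>0\<close> in auto)
  have tangent: "\<forall>\<^sub>F t in at_right 0. tangent t (\<eta> * t) (j t) (j' t)" if \<eta>: "0 < \<eta>" for \<eta>
  proof -
    obtain r \<delta> where r: "0 < r" and "0 < \<delta>" and est: "\<And>t p\<^sub>1 q\<^sub>1 p\<^sub>2 q\<^sub>2. \<lbrakk>0 < t; t < \<delta>; p\<^sub>1 \<in> ball p r; p\<^sub>2 \<in> ball p r; flows_to U X t p\<^sub>1 q\<^sub>1; flows_to U X t p\<^sub>2 q\<^sub>2\<rbrakk>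
      \<Longrightarrow> norm (q\<^sub>2 - q\<^sub>1 - (p\<^sub>2 - p\<^sub>1) - t *\<^sub>R A (p\<^sub>2 - p\<^sub>1)) \<le> \<eta> * t * norm (p\<^sub>2 - p\<^sub>1)"
      by (rule flow_estimates[OF smooth \<open>open U\<close> \<open>p \<in> U\<close> \<eta>, unfolded A_p]) (rule that)
    show ?thesis
      using ev[OF \<open>0 < \<delta>\<close>]
    proof eventually_elim
      case (elim t)
      have "close t (q t) (\<eta> * t) r"
        unfolding close_def
      proof (intro ballI allI impI)
        fix p' q' assume "p' \<in> ball p r" "flows_to U X t p' q'"
        then show "norm (q' - q t - (p' - p) - t *\<^sub>R A (p' - p)) \<le> \<eta> * t * norm (p' - p)"
          using elim r q[of t] by (intro est) auto
      qed
      then show ?case using tang[of t "\<eta> * t" r] elim r \<eta> by auto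
    qed
  qed
  have quot: "((\<lambda>t. (1 / t) *\<^sub>R (q t - p)) \<longlongrightarrow> X p) (at_right 0)"
  proof (rule tendstoI)
    fix e :: real assume "0 < e"
    then have "0 < e / 2" by simp
    obtain \<delta> where "0 < \<delta>" and est: "\<And>t q. \<lbrakk>0 < t; t < \<delta>; flows_to U X t p q\<rbrakk> \<Longrightarrow> norm (q - p - t *\<^sub>R X p) \<le> e / 2 * t"
      by (rule flow_estimates[OF smooth \<open>open U\<close> \<open>p \<in> U\<close> \<open>0 < e / 2\<close>]) (rule that)
    show "\<forall>\<^sub>F t in at_right 0. dist ((1 / t) *\<^sub>R (q t - p)) (X p) < e"
      using ev[OF \<open>0 < \<delta>\<close>]
    proof eventually_elim
      case (elim t)
      have "(1 / t) *\<^sub>R (q t - p) - X p = (1 / t) *\<^sub>R (q t - p - t *\<^sub>R X p)"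
        using elim by (simp add: algebra_simps)
      then have "dist ((1 / t) *\<^sub>R (q t - p)) (X p) = (1 / t) * norm (q t - p - t *\<^sub>R X p)"
        using elim by (simp add: dist_norm)
      also have "\<dots> \<le> (1 / t) * (e / 2 * t)"
        using elim by (intro mult_left_mono est q) auto
      finally have "dist ((1 / t) *\<^sub>R (q t - p)) (X p) \<le> (1 / t) * (e / 2 * t)" .
      then show ?case using elim \<open>0 < e\<close> by simp
    qed
  qed
  define \<omega>\<^sub>u where "\<omega>\<^sub>u = hor A\<^sub>u" define \<omega>\<^sub>v where "\<omega>\<^sub>v = hor A\<^sub>v"
  have \<tau>: "\<tau> (1, 0) = lift (1, 0) j\<^sub>u" "\<tau> (0, 1) = lift (0, 1) j\<^sub>v"
    by (simp_all add: \<tau>_def jet_map_def)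
  have jets: "\<forall>\<^sub>F t in at_right 0.
      norm (j\<^sub>u + t *\<^sub>R ver A\<^sub>u - (j t + t *\<^sub>R jet_map (j t) (j' t) \<omega>\<^sub>u)) \<le> (1 + norm (j t) + norm (j' t)) * (\<eta> * t) \<and>
      norm (j\<^sub>v + t *\<^sub>R ver A\<^sub>v - (j' t + t *\<^sub>R jet_map (j t) (j' t) \<omega>\<^sub>v)) \<le> (1 + norm (j t) + norm (j' t)) * (\<eta> * t)"
    if "0 < \<eta>" for \<eta>
  proof -
    \<comment> \<open>\<open>N\<close> bounds the lengths of both coordinate tangent vectors, so the
      tangent estimate for \<open>\<eta> / N\<close> leaves an error with \<eta> alone.\<close>
    define N where "N = 1 + norm (\<tau> (1, 0)) + norm (\<tau> (0, 1))"
    have "0 < N" by (simp add: N_def add_pos_nonneg)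
    then have "0 < \<eta> / N" using that by simp
    show ?thesis
      using tangent[OF \<open>0 < \<eta> / N\<close>] eventually_at_right_less[of "0::real"]
    proof eventually_elim
      case (elim t)
      have shape: "ver (\<tau> (1, 0) + t *\<^sub>R A (\<tau> (1, 0))) = j\<^sub>u + t *\<^sub>R ver A\<^sub>u"
        "jet_map (j t) (j' t) (hor (\<tau> (1, 0) + t *\<^sub>R A (\<tau> (1, 0)))) = j t + t *\<^sub>R jet_map (j t) (j' t) \<omega>\<^sub>u"
        "ver (\<tau> (0, 1) + t *\<^sub>R A (\<tau> (0, 1))) = j\<^sub>v + t *\<^sub>R ver A\<^sub>v"
        "jet_map (j t) (j' t) (hor (\<tau> (0, 1) + t *\<^sub>R A (\<tau> (0, 1)))) = j' t + t *\<^sub>R jet_map (j t) (j' t) \<omega>\<^sub>v"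
        by (simp_all add: \<tau> A\<^sub>u_def A\<^sub>v_def \<omega>\<^sub>u_def \<omega>\<^sub>v_def) (simp_all add: jet_map_def algebra_simps)
      have le: "(1 + norm (j t) + norm (j' t)) * (\<eta> / N * t) * norm (\<tau> e) \<le> (1 + norm (j t) + norm (j' t)) * (\<eta> * t)"
        if e: "norm (\<tau> e) \<le> N" for e
      proof -
        have "0 \<le> \<eta> / N * t" using elim(2) \<open>0 < \<eta> / N\<close> by (intro mult_nonneg_nonneg) auto
        then have "\<eta> / N * t * norm (\<tau> e) \<le> \<eta> / N * t * N"
          using e by (intro mult_left_mono)
        also have "\<dots> = \<eta> * t" using \<open>0 < N\<close> by simp
        finally have "\<eta> / N * t * norm (\<tau> e) \<le> \<eta> * t" .
        then show ?thesis unfolding mult.assoc[of "1 + norm (j t) + norm (j' t)"]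
          by (intro mult_left_mono) auto
      qed
      have N: "norm (\<tau> (1, 0)) \<le> N" "norm (\<tau> (0, 1)) \<le> N" by (simp_all add: N_def)
      show ?case
        using order_trans[OF elim(1)[unfolded tangent_def, rule_format, of "(1, 0)"] le[OF N(1)]]
          order_trans[OF elim(1)[unfolded tangent_def, rule_format, of "(0, 1)"] le[OF N(2)]]
        unfolding shape by (rule conjI)
    qed
  qed
  have jq: "((\<lambda>t. (1 / t) *\<^sub>R (j t - j\<^sub>u)) \<longlongrightarrow> ver A\<^sub>u - jet_map j\<^sub>u j\<^sub>v \<omega>\<^sub>u) (at_right 0)"
    "((\<lambda>t. (1 / t) *\<^sub>R (j' t - j\<^sub>v)) \<longlongrightarrow> ver A\<^sub>v - jet_map j\<^sub>u j\<^sub>v \<omega>\<^sub>v) (at_right 0)"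
    using jet_difference_quotient[OF jets] by blast+
  have to_limit: "(g \<longlongrightarrow> a) (at_right 0)" if "((\<lambda>t. (1 / t) *\<^sub>R (g t - a)) \<longlongrightarrow> b) (at_right 0)"
    for g :: "real \<Rightarrow> real \<times> real \<times> real" and a b
  proof -
    have "((\<lambda>t. a + t *\<^sub>R ((1 / t) *\<^sub>R (g t - a))) \<longlongrightarrow> a + 0 *\<^sub>R b) (at_right 0)"
      by (intro tendsto_intros that)
    moreover have "\<forall>\<^sub>F t in at_right 0. a + t *\<^sub>R ((1 / t) *\<^sub>R (g t - a)) = g t"
      using eventually_at_right_less[of "0::real"] by eventually_elim simp
    ultimately show ?thesis by (simp add: tendsto_cong)
  qed
  have sq: "((\<lambda>t. (1 / t) *\<^sub>R (ver (q t) - s)) \<longlongrightarrow> ver (X p)) (at_right 0)"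
    using bounded_linear.tendsto[OF bounded_linear_ver quot] by (simp add: p_def)
  have "pde_form s j\<^sub>u j\<^sub>v = 0"
    using sol uv unfolding is_local_solution_def s_def j\<^sub>u_def j\<^sub>v_def
    by (auto simp: pde_system_iff_form)
  \<comment> \<open>The original and the moved solution both satisfy the system; bilinearity turns
    the difference of the two equations into difference quotients.\<close>
  have zero: "\<forall>\<^sub>F t in at_right 0. pde_form ((1 / t) *\<^sub>R (ver (q t) - s)) (j t) (j' t) +
      pde_form s ((1 / t) *\<^sub>R (j t - j\<^sub>u)) ((1 / t) *\<^sub>R (j' t - j\<^sub>v)) = 0"
    using ev[OF zero_less_one]
  proof eventually_elim
    case (elim t)
    have "pde_form (ver (q t) - s) (j t) (j' t) + pde_form s (j t - j\<^sub>u) (j' t - j\<^sub>v) = 0"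
      using pde[of t] elim \<open>pde_form s j\<^sub>u j\<^sub>v = 0\<close> pde_form_add_left[of "ver (q t) - s" s "j t" "j' t"]
        pde_form_add_right[of s "j t - j\<^sub>u" j\<^sub>u "j' t - j\<^sub>v" j\<^sub>v] by auto
    then show ?case
      by (simp add: pde_form_scaleR_left pde_form_scaleR_right flip: scaleR_add_right)
  qed
  have "((\<lambda>t. pde_form ((1 / t) *\<^sub>R (ver (q t) - s)) (j t) (j' t) +
      pde_form s ((1 / t) *\<^sub>R (j t - j\<^sub>u)) ((1 / t) *\<^sub>R (j' t - j\<^sub>v))) \<longlongrightarrow>
      pde_form (ver (X p)) j\<^sub>u j\<^sub>v + pde_form s (ver A\<^sub>u - jet_map j\<^sub>u j\<^sub>v \<omega>\<^sub>u) (ver A\<^sub>v - jet_map j\<^sub>u j\<^sub>v \<omega>\<^sub>v)) (at_right 0)"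
    by (intro tendsto_add tendsto_pde_form sq jq tendsto_const to_limit[OF jq(1)] to_limit[OF jq(2)])
  from tendsto_unique[OF trivial_limit_at_right_real this tendsto_eventually[OF zero]]
  have "pde_form (ver (X p)) j\<^sub>u j\<^sub>v + pde_form s (ver A\<^sub>u - jet_map j\<^sub>u j\<^sub>v \<omega>\<^sub>u) (ver A\<^sub>v - jet_map j\<^sub>u j\<^sub>v \<omega>\<^sub>v) = 0"
    .
  then show ?thesis by (simp add: p_def \<omega>\<^sub>u_def \<omega>\<^sub>v_def)
qed


section \<open>Smooth functions\<close>

text \<open>On an open set the values determine all derivatives. This lets a field be exchanged for
  its restriction, which jumps to 0 outside the set.\<close>

lemma Ck_on_cong:
  assumes "open S" "\<And>x. x \<in> S \<Longrightarrow> f x = g x"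
  shows "Ck_on k f S \<longleftrightarrow> Ck_on k g S"
  using assms(2)
proof (induction k arbitrary: f g)
  case 0
  then show ?case by (simp cong: continuous_on_cong)
next
  case (Suc k)
  have D: "(f has_derivative D) (at x) \<longleftrightarrow> (g has_derivative D) (at x)" if "x \<in> S" for x D
    using has_derivative_transform_within_open[OF _ \<open>open S\<close> that, of f D UNIV g]
      has_derivative_transform_within_open[OF _ \<open>open S\<close> that, of g D UNIV f] Suc.prems by auto
  then have "f differentiable (at x) \<longleftrightarrow> g differentiable (at x)" if "x \<in> S" for x
    using that by (simp add: differentiable_def)
  moreover have "frechet_derivative f (at x) = frechet_derivative g (at x)" if "x \<in> S" for x
    unfolding frechet_derivative_def using D[OF that] by simp
  then have "Ck_on k (\<lambda>x. frechet_derivative f (at x) h) S \<longleftrightarrow> Ck_on k (\<lambda>x. frechet_derivative g (at x) h) S" for h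
    by (intro Suc.IH) simp
  ultimately show ?case by simp
qed

lemma Ck_on_SucI:
  assumes "open S" "\<And>x. x \<in> S \<Longrightarrow> (f has_derivative f' x) (at x)" "\<And>h. Ck_on k (\<lambda>x. f' x h) S"
  shows "Ck_on (Suc k) f S"
proof -
  have "frechet_derivative f (at x) = f' x" if "x \<in> S" for x
    using frechet_derivative_at[OF assms(2)[OF that]] by simp
  then have "Ck_on k (\<lambda>x. frechet_derivative f (at x) h) S" for h
    using Ck_on_cong[OF \<open>open S\<close>, of "\<lambda>x. frechet_derivative f (at x) h" "\<lambda>x. f' x h"] assms(3) by simp
  then show ?thesis
    using assms(2) by (auto simp: differentiable_def)
qed

lemma Ck_on_SucD: "Ck_on (Suc k) f S \<Longrightarrow> x \<in> S \<Longrightarrow> (f has_derivative frechet_derivative f (at x)) (at x)"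
  by (simp add: frechet_derivative_works)

lemma Ck_on_Suc_imp: "Ck_on (Suc k) f S \<Longrightarrow> Ck_on k f S"
proof (induction k arbitrary: f)
  case 0
  then show ?case
    by (auto intro!: continuous_at_imp_continuous_on differentiable_imp_continuous_within)
next
  case (Suc k)
  then show ?case by simp
qed

lemma Ck_on_const: "open S \<Longrightarrow> Ck_on k (\<lambda>x. c) S"
proof (induction k arbitrary: c)
  case (Suc k)
  show ?case by (rule Ck_on_SucI[where f' = "\<lambda>x h. 0"]) (use Suc in auto)
qed simp

lemma Ck_on_bounded_linear:
  assumes "open S" "bounded_linear l"
  shows "Ck_on k l S"
proof (cases k)
  case 0
  then show ?thesis using assms by (simp add: linear_continuous_on)
next
  case (Suc k)
  then show ?thesis
    using assms by (auto intro!: Ck_on_SucI[where f' = "\<lambda>x. l"] Ck_on_const bounded_linear_imp_has_derivative simp del: Ck_on.simps)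
qed

lemma Ck_on_add: "open S \<Longrightarrow> Ck_on k f S \<Longrightarrow> Ck_on k g S \<Longrightarrow> Ck_on k (\<lambda>x. f x + g x) S"
proof (induction k arbitrary: f g)
  case 0
  then show ?case by (simp add: continuous_on_add)
next
  case (Suc k)
  show ?case
  proof (rule Ck_on_SucI[OF \<open>open S\<close>])
    show "((\<lambda>x. f x + g x) has_derivative (\<lambda>h. frechet_derivative f (at x) h + frechet_derivative g (at x) h)) (at x)"
      if "x \<in> S" for x
      using Suc.prems that by (intro has_derivative_add Ck_on_SucD)
    show "Ck_on k (\<lambda>x. frechet_derivative f (at x) h + frechet_derivative g (at x) h) S" for h
      using Suc.prems by (intro Suc.IH) auto
  qed
qed

lemma Ck_on_mult:
  fixes f g :: "'a::real_normed_vector \<Rightarrow> real"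
  shows "open S \<Longrightarrow> Ck_on k f S \<Longrightarrow> Ck_on k g S \<Longrightarrow> Ck_on k (\<lambda>x. f x * g x) S"
proof (induction k arbitrary: f g)
  case 0
  then show ?case by (simp add: continuous_on_mult)
next
  case (Suc k)
  show ?case
  proof (rule Ck_on_SucI[OF \<open>open S\<close>])
    show "((\<lambda>x. f x * g x) has_derivative (\<lambda>h. f x * frechet_derivative g (at x) h + frechet_derivative f (at x) h * g x)) (at x)"
      if "x \<in> S" for x
      using Suc.prems that by (intro has_derivative_mult Ck_on_SucD)
    show "Ck_on k (\<lambda>x. f x * frechet_derivative g (at x) h + frechet_derivative f (at x) h * g x) S" for h
      using Suc.prems Suc.prems(2,3)[THEN Ck_on_Suc_imp]
      by (intro Ck_on_add Suc.IH) auto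
  qed
qed

lemma Ck_on_inverse:
  fixes f :: "'a::real_normed_vector \<Rightarrow> real"
  assumes "open S" "\<And>x. x \<in> S \<Longrightarrow> f x \<noteq> 0"
  shows "Ck_on k f S \<Longrightarrow> Ck_on k (\<lambda>x. inverse (f x)) S"
proof (induction k)
  case 0
  then show ?case using assms by (simp add: continuous_on_inverse)
next
  case (Suc k)
  have inv: "Ck_on k (\<lambda>x. inverse (f x)) S"
    using Suc Ck_on_Suc_imp by blast
  show ?case
  proof (rule Ck_on_SucI[OF \<open>open S\<close>])
    show "((\<lambda>x. inverse (f x)) has_derivative
        (\<lambda>h. (-1) * (inverse (f x) * frechet_derivative f (at x) h * inverse (f x)))) (at x)" if "x \<in> S" for x
      using Deriv.has_derivative_inverse[OF assms(2)[OF that] Ck_on_SucD[OF Suc.prems that]] by simp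
    show "Ck_on k (\<lambda>x. (-1) * (inverse (f x) * frechet_derivative f (at x) h * inverse (f x))) S" for h
      using Suc.prems by (intro Ck_on_mult Ck_on_const inv \<open>open S\<close>) auto
  qed
qed

lemma Ck_on_exp:
  fixes f :: "'a::real_normed_vector \<Rightarrow> real"
  assumes "open S"
  shows "Ck_on k f S \<Longrightarrow> Ck_on k (\<lambda>x. exp (f x)) S"
proof (induction k)
  case 0
  then show ?case by (simp add: continuous_on_exp)
next
  case (Suc k)
  have e: "Ck_on k (\<lambda>x. exp (f x)) S"
    using Suc Ck_on_Suc_imp by blast
  show ?case
  proof (rule Ck_on_SucI[OF \<open>open S\<close>])
    show "((\<lambda>x. exp (f x)) has_derivative (\<lambda>h. exp (f x) * frechet_derivative f (at x) h)) (at x)" if "x \<in> S" for x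
      using Ck_on_SucD[OF Suc.prems that] by (auto intro!: derivative_eq_intros)
    show "Ck_on k (\<lambda>x. exp (f x) * frechet_derivative f (at x) h) S" for h
      using Suc.prems by (intro Ck_on_mult e \<open>open S\<close>) auto
  qed
qed

lemma Ck_on_affine_arg:
  assumes "open T" "bounded_linear l" "\<And>x. x \<in> T \<Longrightarrow> a + l x \<in> S"
  shows "Ck_on k f S \<Longrightarrow> Ck_on k (\<lambda>x. f (a + l x)) T"
proof (induction k arbitrary: f)
  case 0
  have "continuous_on T (\<lambda>x. a + l x)"
    using assms(2) by (intro continuous_intros linear_continuous_on)
  then show ?case
    using 0 assms(3) by (auto intro!: continuous_on_compose2[of S f])
next
  case (Suc k)
  show ?case
  proof (rule Ck_on_SucI[OF \<open>open T\<close>])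
    fix x assume "x \<in> T"
    have "((\<lambda>x. a + l x) has_derivative l) (at x)"
      using assms(2) by (auto intro!: derivative_eq_intros bounded_linear_imp_has_derivative)
    then show "((\<lambda>x. f (a + l x)) has_derivative (\<lambda>h. frechet_derivative f (at (a + l x)) (l h))) (at x)"
      using has_derivative_compose[of "\<lambda>x. a + l x" l x UNIV f] Ck_on_SucD[OF Suc.prems assms(3)[OF \<open>x \<in> T\<close>]]
      by simp
  next
    show "Ck_on k (\<lambda>x. frechet_derivative f (at (a + l x)) (l h)) T" for h
      using Suc.prems by (intro Suc.IH) auto
  qed
qed

lemma smooth_on_const: "open S \<Longrightarrow> smooth_on (\<lambda>x. c) S"
  and smooth_on_bounded_linear: "open S \<Longrightarrow> bounded_linear l \<Longrightarrow> smooth_on l S"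
  and smooth_on_add: "open S \<Longrightarrow> smooth_on f S \<Longrightarrow> smooth_on g S \<Longrightarrow> smooth_on (\<lambda>x. f x + g x) S"
  and smooth_on_affine_arg: "open T \<Longrightarrow> bounded_linear m \<Longrightarrow> (\<And>x. x \<in> T \<Longrightarrow> a + m x \<in> S) \<Longrightarrow>
    smooth_on f S \<Longrightarrow> smooth_on (\<lambda>x. f (a + m x)) T"
  unfolding smooth_on_def
  by (auto intro: Ck_on_const Ck_on_bounded_linear Ck_on_add Ck_on_affine_arg)

lemma smooth_on_mult: "open S \<Longrightarrow> smooth_on f S \<Longrightarrow> smooth_on g S \<Longrightarrow> smooth_on (\<lambda>x. f x * g x) S"
  and smooth_on_inverse: "open S \<Longrightarrow> smooth_on f S \<Longrightarrow> (\<And>x. x \<in> S \<Longrightarrow> f x \<noteq> 0) \<Longrightarrow> smooth_on (\<lambda>x. inverse (f x)) S"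
  and smooth_on_exp: "open S \<Longrightarrow> smooth_on f S \<Longrightarrow> smooth_on (\<lambda>x. exp (f x)) S"
  for f g :: "'a::real_normed_vector \<Rightarrow> real"
  unfolding smooth_on_def by (auto intro: Ck_on_mult Ck_on_inverse Ck_on_exp)

lemma smooth_on_cong:
  "open S \<Longrightarrow> (\<And>x. x \<in> S \<Longrightarrow> f x = g x) \<Longrightarrow> smooth_on f S \<longleftrightarrow> smooth_on g S"
  unfolding smooth_on_def using Ck_on_cong[of S f g] by auto

lemma smooth_on_imp_continuous_on: "smooth_on f S \<Longrightarrow> continuous_on S f"
  unfolding smooth_on_def using Ck_on.simps(1) by blast

lemma smooth_on_subset: "smooth_on f S \<Longrightarrow> T \<subseteq> S \<Longrightarrow> smooth_on f T"
proof -
  have "Ck_on k f S \<Longrightarrow> T \<subseteq> S \<Longrightarrow> Ck_on k f T" for k and f :: "'a \<Rightarrow> 'b"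
    by (induction k arbitrary: f) (auto intro: continuous_on_subset)
  then show "smooth_on f S \<Longrightarrow> T \<subseteq> S \<Longrightarrow> smooth_on f T"
    unfolding smooth_on_def by blast
qed

lemma smooth_on_affine_form:
  "open S \<Longrightarrow> smooth_on (\<lambda>w :: real \<times> real. a + b * fst w + c * snd w) S"
  by (intro smooth_on_add smooth_on_mult smooth_on_const smooth_on_bounded_linear
      bounded_linear_fst bounded_linear_snd)


section \<open>Explicit solutions\<close>

lemma metric_domain_iff: "lift w s \<in> metric_domain \<longleftrightarrow> (case s of (E, F, G) \<Rightarrow> E > 0 \<and> E * G - F\<^sup>2 > 0)"
  by (cases s) (simp add: metric_domain_def lift_def)

text \<open>The symmetry condition concerns only solutions with surface inside \<open>U\<close>, so
  the domain is cut down to the preimage of \<open>U\<close> under the graph map. Positivity of the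
  metric is then inherited from \<open>U\<close>.\<close>

lemma local_solution_through:
  assumes "open U" "U \<subseteq> metric_domain" and W: "open W" "(u\<^sub>0, v\<^sub>0) \<in> W"
    and start: "lift (u\<^sub>0, v\<^sub>0) (E u\<^sub>0 v\<^sub>0, F u\<^sub>0 v\<^sub>0, G u\<^sub>0 v\<^sub>0) \<in> U"
    and smooth: "smooth_on (\<lambda>(u, v). E u v) W" "smooth_on (\<lambda>(u, v). F u v) W" "smooth_on (\<lambda>(u, v). G u v) W"
    and pde: "\<And>u v. (u, v) \<in> W \<Longrightarrow> pde_system_at E F G u v"
  obtains W' where "is_local_solution W' E F G" "surface W' E F G \<subseteq> U" "(u\<^sub>0, v\<^sub>0) \<in> W'"
proof -
  define f where "f w = lift w (E (fst w) (snd w), F (fst w) (snd w), G (fst w) (snd w))" for w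
  have "continuous_on W f"
    unfolding f_def lift_def
    using smooth[THEN smooth_on_imp_continuous_on] unfolding case_prod_beta'
    by (intro continuous_intros)
  define W' where "W' = W \<inter> f -` U"
  have "open W'"
    unfolding W'_def using \<open>continuous_on W f\<close> W(1) \<open>open U\<close>
    by (metis continuous_on_open_vimage Int_commute)
  have surf: "surface W' E F G \<subseteq> U"
    by (auto simp: surface_def W'_def f_def lift_def)
  have "W' \<subseteq> W" by (auto simp: W'_def)
  then have "is_local_solution W' E F G"
    unfolding is_local_solution_def using surf assms \<open>open W'\<close>
    by (auto intro: smooth_on_subset)
  moreover have "(u\<^sub>0, v\<^sub>0) \<in> W'"
    using start W by (simp add: W'_def f_def)
  ultimately show ?thesis using that surf by blast
qed

text \<open>The metrics for which all straight lines of the \<open>(u, v)\<close>-plane are geodesics: the system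
  becomes linear for \<open>(A, B, C) = (E, F, G) / (EG - F\<^sup>2)\<^bsup>2/3\<^esup>\<close>, and the solutions used here are
  those with affine linear \<open>A, B, C\<close>.\<close>

lemma projectively_flat_solution:
  fixes b c :: real
  assumes U: "open U" "U \<subseteq> metric_domain" and p: "lift (u\<^sub>0, v\<^sub>0) (E\<^sub>0, F\<^sub>0, G\<^sub>0) \<in> U"
  defines "D \<equiv> E\<^sub>0 * G\<^sub>0 - F\<^sub>0\<^sup>2"
  defines "p \<equiv> b * F\<^sub>0 + c * E\<^sub>0" and "q \<equiv> b * G\<^sub>0 + c * F\<^sub>0"
  obtains W E F G where "is_local_solution W E F G" "surface W E F G \<subseteq> U" "(u\<^sub>0, v\<^sub>0) \<in> W"
    "(E u\<^sub>0 v\<^sub>0, F u\<^sub>0 v\<^sub>0, G u\<^sub>0 v\<^sub>0) = (E\<^sub>0, F\<^sub>0, G\<^sub>0)"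
    "(pd_u E u\<^sub>0 v\<^sub>0, pd_u F u\<^sub>0 v\<^sub>0, pd_u G u\<^sub>0 v\<^sub>0) = (4 * E\<^sub>0 * p, b * D + 4 * F\<^sub>0 * p, - 2 * c * D + 4 * G\<^sub>0 * p)"
    "(pd_v E u\<^sub>0 v\<^sub>0, pd_v F u\<^sub>0 v\<^sub>0, pd_v G u\<^sub>0 v\<^sub>0) = (- 2 * b * D + 4 * E\<^sub>0 * q, c * D + 4 * F\<^sub>0 * q, 4 * G\<^sub>0 * q)"
proof -
  have "0 < D"
    using p U(2) by (auto simp: metric_domain_iff D_def)
  \<comment> \<open>Slopes scaled by \<open>D\<close> make the jet at the base point polynomial in
    the data, which keeps the later eliminations polynomial.\<close>
  define \<beta> \<gamma> where "\<beta> = b * D" and "\<gamma> = c * D"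
  \<comment> \<open>Straightness of the geodesics means A_u = 0, A_v + 2 B_u = 0, C_u + 2 B_v = 0,
    C_v = 0. These affine functions satisfy it and start at the prescribed values.\<close>
  define A B C :: "real \<Rightarrow> real \<Rightarrow> real" where "A = (\<lambda>u v. E\<^sub>0 - 2 * \<beta> * (v - v\<^sub>0))" and "B = (\<lambda>u v. F\<^sub>0 + \<beta> * (u - u\<^sub>0) + \<gamma> * (v - v\<^sub>0))"
    and "C = (\<lambda>u v. G\<^sub>0 - 2 * \<gamma> * (u - u\<^sub>0))"
  define Q where "Q = (\<lambda>u v. A u v * C u v - (B u v)\<^sup>2)"
  \<comment> \<open>Undoes the rescaling: the metric (A, B, C) / Q^2 has determinant Q^(-3), whose
    power 2/3 is Q^(-2). The factor \<open>D\<^sup>2\<close> normalizes the value at the base point,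
    where Q = D.\<close>
  define N where "N = (\<lambda>(X :: real \<Rightarrow> real \<Rightarrow> real) u v. D\<^sup>2 * X u v * inverse (Q u v * Q u v))"
  define W where "W = {w :: real \<times> real. Q (fst w) (snd w) > 0}"
  have smooth_ABC: "smooth_on (\<lambda>w. A (fst w) (snd w)) S" "smooth_on (\<lambda>w. B (fst w) (snd w)) S"
    "smooth_on (\<lambda>w. C (fst w) (snd w)) S" if "open S" for S
  proof -
    have "smooth_on (\<lambda>w. (E\<^sub>0 + 2 * \<beta> * v\<^sub>0) + 0 * fst w + (- 2 * \<beta>) * snd w) S"
      "smooth_on (\<lambda>w. (F\<^sub>0 - \<beta> * u\<^sub>0 - \<gamma> * v\<^sub>0) + \<beta> * fst w + \<gamma> * snd w) S"
      "smooth_on (\<lambda>w. (G\<^sub>0 + 2 * \<gamma> * u\<^sub>0) + (- 2 * \<gamma>) * fst w + 0 * snd w) S"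
      by (rule smooth_on_affine_form[OF that])+
    then show "smooth_on (\<lambda>w. A (fst w) (snd w)) S" "smooth_on (\<lambda>w. B (fst w) (snd w)) S"
      "smooth_on (\<lambda>w. C (fst w) (snd w)) S"
      by (auto simp: A_def B_def C_def algebra_simps)
  qed
  have smooth_Q: "smooth_on (\<lambda>w. Q (fst w) (snd w)) S" if "open S" for S
  proof -
    have "smooth_on (\<lambda>w. A (fst w) (snd w) * C (fst w) (snd w) + (-1) * (B (fst w) (snd w) * B (fst w) (snd w))) S"
      by (intro smooth_on_add smooth_on_mult smooth_on_const smooth_ABC that)
    then show ?thesis by (simp add: Q_def power2_eq_square)
  qed
  have "open W"
    unfolding W_def using smooth_on_imp_continuous_on[OF smooth_Q[OF open_UNIV]]
    by (intro open_Collect_less) auto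
  have QW: "Q (fst w) (snd w) \<noteq> 0" if "w \<in> W" for w
    using that by (auto simp: W_def)
  have smooth_N: "smooth_on (\<lambda>(u, v). N X u v) W" if "smooth_on (\<lambda>w. X (fst w) (snd w)) W" for X
    unfolding N_def case_prod_beta'
    by (intro smooth_on_mult smooth_on_inverse smooth_on_const smooth_Q that \<open>open W\<close>) (simp add: QW)
  \<comment> \<open>The partial derivatives of Q are - 2 P and - 2 R.\<close>
  define P R where "P = (\<lambda>u v. \<beta> * B u v + \<gamma> * A u v)" and "R = (\<lambda>u v. \<beta> * C u v + \<gamma> * B u v)"
  have Qu: "((\<lambda>x. Q x v) has_field_derivative - 2 * P u v) (at u)"
    and Qv: "((\<lambda>y. Q u y) has_field_derivative - 2 * R u v) (at v)" for u v
    unfolding Q_def A_def B_def C_def P_def R_def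
    by (auto intro!: derivative_eq_intros simp: algebra_simps)
  have Nu: "pd_u (N X) u v = D\<^sup>2 / Q u v ^ 3 * (X' * Q u v + 4 * X u v * P u v)"
    if "((\<lambda>x. X x v) has_field_derivative X') (at u)" "Q u v \<noteq> 0" for X X' u v
    unfolding pd_u_def
  proof (rule DERIV_imp_deriv)
    show "((\<lambda>x. N X x v) has_field_derivative D\<^sup>2 / Q u v ^ 3 * (X' * Q u v + 4 * X u v * P u v)) (at u)"
      unfolding N_def
      by (rule derivative_eq_intros refl that Qu | simp add: that)+
         (use that(2) in \<open>simp add: field_simps power2_eq_square power3_eq_cube\<close>)
  qed
  have Nv: "pd_v (N X) u v = D\<^sup>2 / Q u v ^ 3 * (X' * Q u v + 4 * X u v * R u v)"
    if "((\<lambda>y. X u y) has_field_derivative X') (at v)" "Q u v \<noteq> 0" for X X' u v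
    unfolding pd_v_def
  proof (rule DERIV_imp_deriv)
    show "((\<lambda>y. N X u y) has_field_derivative D\<^sup>2 / Q u v ^ 3 * (X' * Q u v + 4 * X u v * R u v)) (at v)"
      unfolding N_def
      by (rule derivative_eq_intros refl that Qv | simp add: that)+
         (use that(2) in \<open>simp add: field_simps power2_eq_square power3_eq_cube\<close>)
  qed
  have ABC: "((\<lambda>x. A x v) has_field_derivative 0) (at u)" "((\<lambda>y. A u y) has_field_derivative - 2 * \<beta>) (at v)"
    "((\<lambda>x. B x v) has_field_derivative \<beta>) (at u)" "((\<lambda>y. B u y) has_field_derivative \<gamma>) (at v)"
    "((\<lambda>x. C x v) has_field_derivative - 2 * \<gamma>) (at u)" "((\<lambda>y. C u y) has_field_derivative 0) (at v)" for u v
    unfolding A_def B_def C_def by (auto intro!: derivative_eq_intros)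
  have jets: "(pd_u (N A) u v, pd_u (N B) u v, pd_u (N C) u v) = (D\<^sup>2 / Q u v ^ 3) *\<^sub>R
      (4 * A u v * P u v, \<beta> * Q u v + 4 * B u v * P u v, - 2 * \<gamma> * Q u v + 4 * C u v * P u v)"
    "(pd_v (N A) u v, pd_v (N B) u v, pd_v (N C) u v) = (D\<^sup>2 / Q u v ^ 3) *\<^sub>R
      (- 2 * \<beta> * Q u v + 4 * A u v * R u v, \<gamma> * Q u v + 4 * B u v * R u v, 4 * C u v * R u v)"
    if "Q u v \<noteq> 0" for u v
    using that by (simp_all add: Nu[OF ABC(1)] Nu[OF ABC(3)] Nu[OF ABC(5)] Nv[OF ABC(2)] Nv[OF ABC(4)] Nv[OF ABC(6)])
  have pde: "pde_system_at (N A) (N B) (N C) u v" if "(u, v) \<in> W" for u v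
  proof -
    have "Q u v \<noteq> 0" using QW[OF that] by simp
    have "(N A u v, N B u v, N C u v) = (D\<^sup>2 * inverse (Q u v * Q u v)) *\<^sub>R (A u v, B u v, C u v)"
      by (simp add: N_def)
    moreover have "pde_form (A u v, B u v, C u v)
      (4 * A u v * P u v, \<beta> * Q u v + 4 * B u v * P u v, - 2 * \<gamma> * Q u v + 4 * C u v * P u v)
      (- 2 * \<beta> * Q u v + 4 * A u v * R u v, \<gamma> * Q u v + 4 * B u v * R u v, 4 * C u v * R u v) = 0"
      unfolding pde_form_def Q_def P_def R_def prod.case zero_prod_def prod.inject
      by (intro conjI; algebra)
    ultimately show ?thesis
      unfolding pde_system_iff_form jets[OF \<open>Q u v \<noteq> 0\<close>]
      by (simp only: pde_form_scaleR_left pde_form_scaleR_right scaleR_zero_right)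
  qed
  have at0: "A u\<^sub>0 v\<^sub>0 = E\<^sub>0" "B u\<^sub>0 v\<^sub>0 = F\<^sub>0" "C u\<^sub>0 v\<^sub>0 = G\<^sub>0" "Q u\<^sub>0 v\<^sub>0 = D" "P u\<^sub>0 v\<^sub>0 = D * p" "R u\<^sub>0 v\<^sub>0 = D * q"
    by (simp_all add: A_def B_def C_def Q_def P_def R_def D_def \<beta>_def \<gamma>_def p_def q_def algebra_simps)
  then have N0: "N A u\<^sub>0 v\<^sub>0 = E\<^sub>0" "N B u\<^sub>0 v\<^sub>0 = F\<^sub>0" "N C u\<^sub>0 v\<^sub>0 = G\<^sub>0"
    using \<open>0 < D\<close> by (simp_all add: N_def field_simps power2_eq_square)
  have "(u\<^sub>0, v\<^sub>0) \<in> W" using at0 \<open>0 < D\<close> by (simp add: W_def)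
  moreover have "lift (u\<^sub>0, v\<^sub>0) (N A u\<^sub>0 v\<^sub>0, N B u\<^sub>0 v\<^sub>0, N C u\<^sub>0 v\<^sub>0) \<in> U"
    using p by (simp add: N0)
  ultimately obtain W' where W': "is_local_solution W' (N A) (N B) (N C)" "surface W' (N A) (N B) (N C) \<subseteq> U"
    "(u\<^sub>0, v\<^sub>0) \<in> W'"
    using local_solution_through[OF U \<open>open W\<close>, of u\<^sub>0 v\<^sub>0 "N A" "N B" "N C"]
      smooth_N smooth_ABC[OF \<open>open W\<close>] pde by blast
  show ?thesis
  proof (rule that[OF W'])
    show "(N A u\<^sub>0 v\<^sub>0, N B u\<^sub>0 v\<^sub>0, N C u\<^sub>0 v\<^sub>0) = (E\<^sub>0, F\<^sub>0, G\<^sub>0)" by (simp add: N0)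
    have "Q u\<^sub>0 v\<^sub>0 \<noteq> 0" using at0 \<open>0 < D\<close> by simp
    note j = jets[OF this, unfolded at0]
    show "(pd_u (N A) u\<^sub>0 v\<^sub>0, pd_u (N B) u\<^sub>0 v\<^sub>0, pd_u (N C) u\<^sub>0 v\<^sub>0) =
        (4 * E\<^sub>0 * p, b * D + 4 * F\<^sub>0 * p, - 2 * c * D + 4 * G\<^sub>0 * p)"
      unfolding j(1) \<beta>_def \<gamma>_def using \<open>0 < D\<close> by (simp add: field_simps power2_eq_square power3_eq_cube)
    show "(pd_v (N A) u\<^sub>0 v\<^sub>0, pd_v (N B) u\<^sub>0 v\<^sub>0, pd_v (N C) u\<^sub>0 v\<^sub>0) =
        (- 2 * b * D + 4 * E\<^sub>0 * q, c * D + 4 * F\<^sub>0 * q, 4 * G\<^sub>0 * q)"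
      unfolding j(2) \<beta>_def \<gamma>_def using \<open>0 < D\<close> by (simp add: field_simps power2_eq_square power3_eq_cube)
  qed
qed

text \<open>For nonzero \<open>k\<close> this is a constant metric in the coordinates exp(k u) / k
  and - exp(- k v) / k, up to shifts of u and v. Its jet is independent of those of the projectively
  flat family and supplies the third dimension of admissible jets.\<close>

lemma exponential_solution:
  assumes U: "open U" "U \<subseteq> metric_domain" and p: "lift (u\<^sub>0, v\<^sub>0) (E\<^sub>0, F\<^sub>0, G\<^sub>0) \<in> U"
  obtains W E F G where "is_local_solution W E F G" "surface W E F G \<subseteq> U" "(u\<^sub>0, v\<^sub>0) \<in> W"
    "(E u\<^sub>0 v\<^sub>0, F u\<^sub>0 v\<^sub>0, G u\<^sub>0 v\<^sub>0) = (E\<^sub>0, F\<^sub>0, G\<^sub>0)"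
    "(pd_u E u\<^sub>0 v\<^sub>0, pd_u F u\<^sub>0 v\<^sub>0, pd_u G u\<^sub>0 v\<^sub>0) = (2 * k * E\<^sub>0, k * F\<^sub>0, 0)"
    "(pd_v E u\<^sub>0 v\<^sub>0, pd_v F u\<^sub>0 v\<^sub>0, pd_v G u\<^sub>0 v\<^sub>0) = (0, - k * F\<^sub>0, - 2 * k * G\<^sub>0)"
proof -
  define N :: "real \<Rightarrow> real \<Rightarrow> real \<Rightarrow> real \<Rightarrow> real \<Rightarrow> real" where "N = (\<lambda>X b c u v. X * exp (b * (u - u\<^sub>0) + c * (v - v\<^sub>0)))"
  have smooth: "smooth_on (\<lambda>(u, v). N X b c u v) UNIV" for X b c
  proof -
    have "smooth_on (\<lambda>w. X * exp ((- b * u\<^sub>0 - c * v\<^sub>0) + b * fst w + c * snd w)) UNIV"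
      by (intro smooth_on_mult smooth_on_exp smooth_on_affine_form smooth_on_const open_UNIV)
    then show ?thesis by (simp add: N_def case_prod_beta' algebra_simps)
  qed
  have pd: "pd_u (N X b c) u v = b * N X b c u v" "pd_v (N X b c) u v = c * N X b c u v" for X b c u v
    unfolding pd_u_def pd_v_def N_def by (rule DERIV_imp_deriv; auto intro!: derivative_eq_intros)+
  define E F G where "E = N E\<^sub>0 (2 * k) 0" and "F = N F\<^sub>0 k (- k)" and "G = N G\<^sub>0 0 (- 2 * k)"
  have pde: "pde_system_at E F G u v" for u v
    unfolding pde_system_at_def E_def F_def G_def pd by (intro conjI; algebra)
  have N0: "N X b c u\<^sub>0 v\<^sub>0 = X" for X b c by (simp add: N_def)
  obtain W where W: "is_local_solution W E F G" "surface W E F G \<subseteq> U" "(u\<^sub>0, v\<^sub>0) \<in> W"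
    using local_solution_through[OF U open_UNIV UNIV_I, of u\<^sub>0 v\<^sub>0 E F G] p smooth pde
    by (auto simp: E_def F_def G_def N0)
  show ?thesis
    by (rule that[OF W]) (simp_all add: E_def F_def G_def pd N0)
qed


section \<open>The determining equations\<close>

text \<open>The jets realized at the point (E, F, G) by \<open>projectively_flat_solution\<close>.
  They are linear in (b, c), so multiples stay in the family; \<open>exp_jet\<close> is the case
  \<open>k = 1\<close> of the exponential family.\<close>

definition proj_jet :: "real \<times> real \<times> real \<Rightarrow> real \<Rightarrow> real \<Rightarrow> (real \<times> real \<times> real) \<times> (real \<times> real \<times> real)" where
  "proj_jet = (\<lambda>(E, F, G) b c.
     ((4 * E * (b * F + c * E), b * (E * G - F\<^sup>2) + 4 * F * (b * F + c * E), - 2 * c * (E * G - F\<^sup>2) + 4 * G * (b * F + c * E)),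
      (- 2 * b * (E * G - F\<^sup>2) + 4 * E * (b * G + c * F), c * (E * G - F\<^sup>2) + 4 * F * (b * G + c * F), 4 * G * (b * G + c * F))))"

definition exp_jet :: "real \<times> real \<times> real \<Rightarrow> (real \<times> real \<times> real) \<times> (real \<times> real \<times> real)" where
  "exp_jet = (\<lambda>(E, F, G). ((2 * E, F, 0), (0, - F, - 2 * G)))"

text \<open>The expression is a quadratic form in (b, c). Its three coefficients, taken in the first
  two components of the system, are six linear equations for the six entries of \<open>B\<close>,
  and they form a nonsingular system.\<close>

lemma quadratic_part_zero:
  fixes E F G a\<^sub>E a\<^sub>F a\<^sub>G b\<^sub>E b\<^sub>F b\<^sub>G :: real
  assumes "0 < E" and D: "0 < E * G - F\<^sup>2"
  defines "B \<equiv> (\<lambda>(x, y, z). (a\<^sub>E * x + a\<^sub>F * y + a\<^sub>G * z, b\<^sub>E * x + b\<^sub>F * y + b\<^sub>G * z))"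
  assumes eq: "\<And>b c. case proj_jet (E, F, G) b c of (j, j') \<Rightarrow>
    pde_form (E, F, G) (jet_map j j' (B j)) (jet_map j j' (B j')) = 0"
  shows "a\<^sub>E = 0 \<and> a\<^sub>F = 0 \<and> a\<^sub>G = 0 \<and> b\<^sub>E = 0 \<and> b\<^sub>F = 0 \<and> b\<^sub>G = 0"
proof -
  have "0 < E * G" using D by (smt (verit) zero_le_power2)
  then have "0 < G" using \<open>0 < E\<close> by (simp add: zero_less_mult_iff)
  define T where "T b c = (case proj_jet (E, F, G) b c of (j, j') \<Rightarrow>
    pde_form (E, F, G) (jet_map j j' (B j)) (jet_map j j' (B j')))" for b c
  have T: "T b c = (0, 0, 0)" for b c using eq[of b c] unfolding T_def zero_prod_def by (cases "proj_jet (E, F, G) b c") (simp only: prod.case)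
  note unfold = T_def proj_jet_def B_def jet_map_def pde_form_def prod.case fst_conv snd_conv
    scaleR_prod_def real_scaleR_def plus_prod_def
  let ?D = "E * G - F\<^sup>2"
  have "fst (T 1 0) = - ?D * ((6*E*F^2 - 2*E^2*G) * a\<^sub>F + 8*E*F*G * a\<^sub>G + (4*E^2*G - 12*E*F^2) * b\<^sub>E
      + (2*E*F*G - 6*F^3) * b\<^sub>F + 8*G*?D * b\<^sub>G)"
    unfolding unfold by algebra
  then have b1: "(6*E*F^2 - 2*E^2*G) * a\<^sub>F + 8*E*F*G * a\<^sub>G + (4*E^2*G - 12*E*F^2) * b\<^sub>E
      + (2*E*F*G - 6*F^3) * b\<^sub>F + 8*G*?D * b\<^sub>G = 0"
    using D by (simp add: T)
  have "fst (T 0 1) = - ?D * (4*E^3 * a\<^sub>F + 8*E^2*F * a\<^sub>G - 8*E^3 * b\<^sub>E - 4*E^2*F * b\<^sub>F - 4*E*?D * b\<^sub>G)"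
    unfolding unfold by algebra
  then have c1: "4*E^3 * a\<^sub>F + 8*E^2*F * a\<^sub>G - 8*E^3 * b\<^sub>E - 4*E^2*F * b\<^sub>F - 4*E*?D * b\<^sub>G = 0"
    using D by (simp add: T)
  \<comment> \<open>Polarization gives the coefficient of the mixed term bc.\<close>
  have "fst (T 1 1) - fst (T 1 0) - fst (T 0 1) =
      - ?D * (8*E^2*F * a\<^sub>F + (12*E^2*G + 4*E*F^2) * a\<^sub>G - 16*E^2*F * b\<^sub>E - 8*E*F^2 * b\<^sub>F + 4*F*?D * b\<^sub>G)"
    unfolding unfold by algebra
  then have x1: "8*E^2*F * a\<^sub>F + (12*E^2*G + 4*E*F^2) * a\<^sub>G - 16*E^2*F * b\<^sub>E - 8*E*F^2 * b\<^sub>F + 4*F*?D * b\<^sub>G = 0"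
    using D by (simp add: T)
  \<comment> \<open>The second component mirrors the first under exchanging E with G, b with c, and
    \<open>a\<^sub>E, a\<^sub>F, a\<^sub>G\<close> with
    \<open>b\<^sub>G, b\<^sub>F, b\<^sub>E\<close>.\<close>
  have "fst (snd (T 1 0)) = - ?D * (4*G^3 * b\<^sub>F + 8*F*G^2 * b\<^sub>E - 8*G^3 * a\<^sub>G - 4*F*G^2 * a\<^sub>F - 4*G*?D * a\<^sub>E)"
    unfolding unfold by algebra
  then have b2: "4*G^3 * b\<^sub>F + 8*F*G^2 * b\<^sub>E - 8*G^3 * a\<^sub>G - 4*F*G^2 * a\<^sub>F - 4*G*?D * a\<^sub>E = 0"
    using D by (simp add: T)
  have "fst (snd (T 0 1)) = - ?D * ((6*F^2*G - 2*E*G^2) * b\<^sub>F + 8*E*F*G * b\<^sub>E + (4*E*G^2 - 12*F^2*G) * a\<^sub>G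
      + (2*E*F*G - 6*F^3) * a\<^sub>F + 8*E*?D * a\<^sub>E)"
    unfolding unfold by algebra
  then have c2: "(6*F^2*G - 2*E*G^2) * b\<^sub>F + 8*E*F*G * b\<^sub>E + (4*E*G^2 - 12*F^2*G) * a\<^sub>G
      + (2*E*F*G - 6*F^3) * a\<^sub>F + 8*E*?D * a\<^sub>E = 0"
    using D by (simp add: T)
  have "fst (snd (T 1 1)) - fst (snd (T 1 0)) - fst (snd (T 0 1)) =
      - ?D * (8*F*G^2 * b\<^sub>F + (12*E*G^2 + 4*F^2*G) * b\<^sub>E - 16*F*G^2 * a\<^sub>G - 8*F^2*G * a\<^sub>F + 4*F*?D * a\<^sub>E)"
    unfolding unfold by algebra
  then have x2: "8*F*G^2 * b\<^sub>F + (12*E*G^2 + 4*F^2*G) * b\<^sub>E - 16*F*G^2 * a\<^sub>G - 8*F^2*G * a\<^sub>F + 4*F*?D * a\<^sub>E = 0"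
    using D by (simp add: T)
  \<comment> \<open>The equations \<open>b1, c1, x1\<close> determine \<open>b\<^sub>G\<close>,
    their mirror images \<open>a\<^sub>E\<close>; then \<open>a\<^sub>G\<close> and
    \<open>b\<^sub>E\<close> separate, and \<open>a\<^sub>F, b\<^sub>F\<close> are left with a 2 by
    2 system of determinant EG - F^2.\<close>
  have "12 * E * ?D\<^sup>2 * b\<^sub>G = 0" using b1 c1 x1 by algebra
  then have [simp]: "b\<^sub>G = 0" using D \<open>0 < E\<close> by simp
  have "12 * G * ?D\<^sup>2 * a\<^sub>E = 0" using b2 c2 x2 by algebra
  then have [simp]: "a\<^sub>E = 0" using D \<open>0 < G\<close> by simp
  have "12 * E\<^sup>2 * ?D * a\<^sub>G = 0" using c1 x1 \<open>b\<^sub>G = 0\<close> by algebra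
  then have [simp]: "a\<^sub>G = 0" using D \<open>0 < E\<close> by simp
  have "12 * G\<^sup>2 * ?D * b\<^sub>E = 0" using b2 x2 \<open>a\<^sub>E = 0\<close> by algebra
  then have [simp]: "b\<^sub>E = 0" using D \<open>0 < G\<close> by simp
  have "E\<^sup>2 * (E * a\<^sub>F - F * b\<^sub>F) = 0"
    using c1 \<open>a\<^sub>G = 0\<close> \<open>b\<^sub>E = 0\<close> \<open>b\<^sub>G = 0\<close> by algebra
  then have aF: "E * a\<^sub>F = F * b\<^sub>F" using \<open>0 < E\<close> by simp
  have "G\<^sup>2 * (G * b\<^sub>F - F * a\<^sub>F) = 0"
    using b2 \<open>a\<^sub>G = 0\<close> \<open>b\<^sub>E = 0\<close> \<open>a\<^sub>E = 0\<close> by algebra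
  then have bF: "G * b\<^sub>F = F * a\<^sub>F" using \<open>0 < G\<close> by simp
  have "?D * a\<^sub>F = 0" "?D * b\<^sub>F = 0" using aF bF by algebra+
  then show ?thesis using D by simp
qed

text \<open>The multipliers in the three linear combinations below come from solving a linear system over
  the polynomials in \<open>E, F, G\<close>.\<close>

lemma linear_part_consequences:
  fixes E F G e f g a\<^sub>u a\<^sub>v b\<^sub>u b\<^sub>v e\<^sub>E e\<^sub>F e\<^sub>G f\<^sub>E f\<^sub>F f\<^sub>G g\<^sub>E g\<^sub>F g\<^sub>G :: real
  assumes D: "0 < E * G - F\<^sup>2"
  defines "S \<equiv> (\<lambda>(x, y, z). (e\<^sub>E * x + e\<^sub>F * y + e\<^sub>G * z, f\<^sub>E * x + f\<^sub>F * y + f\<^sub>G * z, g\<^sub>E * x + g\<^sub>F * y + g\<^sub>G * z))"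
  defines "L \<equiv> (\<lambda>(j, j'). pde_form (e, f, g) j j' +
    pde_form (E, F, G) (S j - jet_map j j' (a\<^sub>u, b\<^sub>u)) (S j' - jet_map j j' (a\<^sub>v, b\<^sub>v)))"
  assumes eq: "\<And>b c. L (proj_jet (E, F, G) b c) = 0" "L (exp_jet (E, F, G)) = 0"
  shows "F * e - E * f = - 3 * E\<^sup>2 * a\<^sub>v + E * (2 * E - F) * (a\<^sub>u - b\<^sub>v) + (2 * E * (2 * G - F) + (2 * E - F)\<^sup>2) * b\<^sub>u"
    and "E * g - G * e = 3 * E * G * (a\<^sub>u - b\<^sub>v) + G * (2 * E - F) * b\<^sub>u - E * (2 * G - F) * a\<^sub>v"
    and "(2 * E + 2 * G + F) * (a\<^sub>u - b\<^sub>v) + (7 * G + 4 * E - 4 * F) * b\<^sub>u - (7 * E + 4 * G - 4 * F) * a\<^sub>v = 0"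
proof -
  \<comment> \<open>Three jets spanning the admissible ones, with three components each: nine
    equations from which the nine entries of \<open>S\<close> are to be eliminated.\<close>
  define B C K where "B = L (proj_jet (E, F, G) 1 0)" and "C = L (proj_jet (E, F, G) 0 1)"
    and "K = L (exp_jet (E, F, G))"
  have zero: "B = (0, 0, 0)" "C = (0, 0, 0)" "K = (0, 0, 0)"
    using eq by (simp_all add: B_def C_def K_def zero_prod_def)
  let ?D = "E * G - F\<^sup>2"
  note unfold = B_def C_def K_def L_def proj_jet_def exp_jet_def S_def jet_map_def pde_form_def
    prod.case fst_conv snd_conv scaleR_prod_def real_scaleR_def plus_prod_def minus_prod_def
  have "2 * ?D\<^sup>2 * (F * e - E * f - (- 3 * E\<^sup>2 * a\<^sub>v + E * (2 * E - F) * (a\<^sub>u - b\<^sub>v) + (2 * E * (2 * G - F) + (2 * E - F)\<^sup>2) * b\<^sub>u))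
    = (3*E*F^2 - 3*E*F*G - F^3) * fst B - E^3 * fst (snd B) + E^2*F * snd (snd B)
      + (2*E*G^2 + 2*F^2*G - 3*E*F*G) * fst C + E^2*F * fst (snd C) - E^2*G * snd (snd C)
      + 3 * ?D * (2*E*F - E*G - F^2) * fst K + 2*E^2 * ?D * snd (snd K)"
    unfolding unfold by algebra
  then show "F * e - E * f = - 3 * E\<^sup>2 * a\<^sub>v + E * (2 * E - F) * (a\<^sub>u - b\<^sub>v) + (2 * E * (2 * G - F) + (2 * E - F)\<^sup>2) * b\<^sub>u"
    using D by (simp add: zero)
  have "2 * ?D\<^sup>2 * (E * g - G * e - (3 * E * G * (a\<^sub>u - b\<^sub>v) + G * (2 * E - F) * b\<^sub>u - E * (2 * G - F) * a\<^sub>v))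
    = G*(E*G + F^2) * fst B + 2*E^2*F * fst (snd B) - 2*F*G^2 * fst C - E*(E*G + F^2) * fst (snd C)
      + 3*F*G * ?D * fst K + 3*E*F * ?D * fst (snd K) + E*G * ?D * snd (snd K)"
    unfolding unfold by algebra
  then show "E * g - G * e = 3 * E * G * (a\<^sub>u - b\<^sub>v) + G * (2 * E - F) * b\<^sub>u - E * (2 * G - F) * a\<^sub>v"
    using D by (simp add: zero)
  \<comment> \<open>This combination cancels (e, f, g) together with the entries of
    \<open>S\<close>, so it constrains the derivative of \<xi> alone.\<close>
  have "2 * ?D\<^sup>2 * ((2 * E + 2 * G + F) * (a\<^sub>u - b\<^sub>v) + (7 * G + 4 * E - 4 * F) * b\<^sub>u - (7 * E + 4 * G - 4 * F) * a\<^sub>v)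
    = 3*F*(G - F) * fst B + 3*E*(E - F) * fst (snd B) - E*(F + G) * snd (snd B)
      + 3*G*(F - G) * fst C + 3*F*(F - E) * fst (snd C) + G*(E + F) * snd (snd C)
      + 3 * ?D * (G - 2*F) * fst K + 3 * ?D * (E - 2*F) * fst (snd K) - ?D * (2*E + F + 2*G) * snd (snd K)"
    unfolding unfold by algebra
  then show "(2 * E + 2 * G + F) * (a\<^sub>u - b\<^sub>v) + (7 * G + 4 * E - 4 * F) * b\<^sub>u - (7 * E + 4 * G - 4 * F) * a\<^sub>v = 0"
    using D by (simp add: zero)
qed

text \<open>The first two components are a homogeneous linear system for \<open>x\<close> and
  \<open>y\<close> whose determinant is a nonzero multiple of EG - F^2. This is what will annihilate
  the derivative of the scaling factor.\<close>

lemma pde_form_parallel_zero: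
  assumes "0 < E" "0 < E * G - F\<^sup>2" "pde_form (E, F, G) (x *\<^sub>R (E, F, G)) (y *\<^sub>R (E, F, G)) = 0"
  shows "x = 0 \<and> y = 0"
proof -
  have "0 < E * G" using assms by (smt (verit) zero_le_power2)
  then have "0 < G" using \<open>0 < E\<close> by (simp add: zero_less_mult_iff)
  have "E * (F * x - E * y) = 0" "G * (F * y - G * x) = 0"
    using assms(3) by (simp_all add: pde_form_def zero_prod_def algebra_simps)
  then have "F * x = E * y" "F * y = G * x"
    using \<open>0 < E\<close> \<open>0 < G\<close> by auto
  then have "(E * G - F\<^sup>2) * x = 0" "(E * G - F\<^sup>2) * y = 0" by algebra+
  then show ?thesis using assms by simp
qed

lemma pde_form_jets:
  "case proj_jet s b c of (j, j') \<Rightarrow> pde_form s j j' = 0" "case exp_jet s of (j, j') \<Rightarrow> pde_form s j j' = 0"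
proof -
  obtain E F G where s: "s = (E, F, G)" by (cases s)
  show "case proj_jet s b c of (j, j') \<Rightarrow> pde_form s j j' = 0"
    unfolding s proj_jet_def pde_form_def prod.case zero_prod_def prod.inject by (intro conjI; algebra)
  show "case exp_jet s of (j, j') \<Rightarrow> pde_form s j j' = 0"
    unfolding s exp_jet_def pde_form_def prod.case zero_prod_def prod.inject by (intro conjI; algebra)
qed

section \<open>Separating the determining equation by degree in the jet\<close>

definition linearized :: "(pt \<Rightarrow> pt) \<Rightarrow> real \<times> real \<times> real \<Rightarrow> real \<times> real \<times> real \<Rightarrow> (real \<times> real \<times> real) \<times> (real \<times> real \<times> real) \<Rightarrow> bool" where
  "linearized A \<sigma> s = (\<lambda>(j, j'). pde_form \<sigma> j j' +
     pde_form s (ver (A (lift (1, 0) j)) - jet_map j j' (hor (A (lift (1, 0) j))))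
       (ver (A (lift (0, 1) j')) - jet_map j j' (hor (A (lift (0, 1) j')))) = 0)"

text \<open>The jets are realized by actual solutions through the point. The factor \<open>k\<close>
  is free because \<open>b\<close>, \<open>c\<close> and the exponent may be rescaled; this freedom
  separates the degrees.\<close>

lemma symmetry_linearized_at_jets:
  assumes "infinitesimal_symmetry U X" "open U" "U \<subseteq> metric_domain" "lift w s \<in> U"
  defines "A \<equiv> frechet_derivative X (at (lift w s))" and "\<sigma> \<equiv> ver (X (lift w s))"
  shows "linearized A \<sigma> s (k *\<^sub>R proj_jet s b c)" and "linearized A \<sigma> s (k *\<^sub>R exp_jet s)"
proof -
  obtain u\<^sub>0 v\<^sub>0 where w: "w = (u\<^sub>0, v\<^sub>0)" by (cases w)
  obtain E\<^sub>0 F\<^sub>0 G\<^sub>0 where s: "s = (E\<^sub>0, F\<^sub>0, G\<^sub>0)" by (cases s)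
  have p: "lift (u\<^sub>0, v\<^sub>0) (E\<^sub>0, F\<^sub>0, G\<^sub>0) \<in> U" using assms(4) by (simp add: w s)
  note lin = symmetry_linearized[OF assms(1,2)]
  show "linearized A \<sigma> s (k *\<^sub>R proj_jet s b c)"
  proof -
    obtain W E F G where W: "is_local_solution W E F G" "surface W E F G \<subseteq> U" "(u\<^sub>0, v\<^sub>0) \<in> W"
      and start: "(E u\<^sub>0 v\<^sub>0, F u\<^sub>0 v\<^sub>0, G u\<^sub>0 v\<^sub>0) = (E\<^sub>0, F\<^sub>0, G\<^sub>0)"
      and jets: "(pd_u E u\<^sub>0 v\<^sub>0, pd_u F u\<^sub>0 v\<^sub>0, pd_u G u\<^sub>0 v\<^sub>0) = k *\<^sub>R fst (proj_jet s b c)"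
        "(pd_v E u\<^sub>0 v\<^sub>0, pd_v F u\<^sub>0 v\<^sub>0, pd_v G u\<^sub>0 v\<^sub>0) = k *\<^sub>R snd (proj_jet s b c)"
      by (rule projectively_flat_solution[OF assms(2,3) p, of "k * b" "k * c"])
         (simp add: s proj_jet_def algebra_simps)
    show ?thesis
      using lin[OF W, unfolded start jets]
      by (simp add: linearized_def A_def \<sigma>_def w s case_prod_beta)
  qed
  show "linearized A \<sigma> s (k *\<^sub>R exp_jet s)"
  proof -
    obtain W E F G where W: "is_local_solution W E F G" "surface W E F G \<subseteq> U" "(u\<^sub>0, v\<^sub>0) \<in> W"
      and start: "(E u\<^sub>0 v\<^sub>0, F u\<^sub>0 v\<^sub>0, G u\<^sub>0 v\<^sub>0) = (E\<^sub>0, F\<^sub>0, G\<^sub>0)"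
      and jets: "(pd_u E u\<^sub>0 v\<^sub>0, pd_u F u\<^sub>0 v\<^sub>0, pd_u G u\<^sub>0 v\<^sub>0) = k *\<^sub>R fst (exp_jet s)"
        "(pd_v E u\<^sub>0 v\<^sub>0, pd_v F u\<^sub>0 v\<^sub>0, pd_v G u\<^sub>0 v\<^sub>0) = k *\<^sub>R snd (exp_jet s)"
      by (rule exponential_solution[OF assms(2,3) p, of k]) (simp add: s exp_jet_def)
    show ?thesis
      using lin[OF W, unfolded start jets]
      by (simp add: linearized_def A_def \<sigma>_def w s case_prod_beta)
  qed
qed

text \<open>For a fixed point the equation at the jet scaled by \<open>k\<close> is the polynomial
  \<open>P\<^sub>0 + k *\<^sub>R P\<^sub>1 - k\<^sup>2 *\<^sub>R P\<^sub>2\<close>; its zeros k = 0,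
  1, -1 make all three coefficients vanish. \<open>H\<^sub>u\<close> and \<open>H\<^sub>v\<close>
  differentiate the field along the base, \<open>V\<close> along the fibre.\<close>

lemma linearized_degrees:
  assumes A: "linear A" and eq: "\<And>k. linearized A \<sigma> s (k *\<^sub>R (j, j'))"
  defines "H\<^sub>u \<equiv> A (lift (1, 0) 0)" and "H\<^sub>v \<equiv> A (lift (0, 1) 0)"
  defines "V \<equiv> (\<lambda>j. A (lift 0 j))"
  shows "pde_form s (ver H\<^sub>u) (ver H\<^sub>v) = 0"
    and "pde_form \<sigma> j j' + pde_form s (ver (V j) - jet_map j j' (hor H\<^sub>u)) (ver (V j') - jet_map j j' (hor H\<^sub>v)) = 0"
    and "pde_form s (jet_map j j' (hor (V j))) (jet_map j j' (hor (V j'))) = 0"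
proof -
  define P\<^sub>0 where "P\<^sub>0 = pde_form s (ver H\<^sub>u) (ver H\<^sub>v)"
  define P\<^sub>1 where "P\<^sub>1 = pde_form \<sigma> j j' + pde_form s (ver (V j) - jet_map j j' (hor H\<^sub>u)) (ver (V j') - jet_map j j' (hor H\<^sub>v))"
  define P\<^sub>2 where "P\<^sub>2 = pde_form s (jet_map j j' (hor (V j))) (jet_map j j' (hor (V j')))"
  have split: "A (lift e (k *\<^sub>R i)) = A (lift e 0) + k *\<^sub>R V i" for e k i
  proof -
    have "lift e (k *\<^sub>R i) = lift e 0 + k *\<^sub>R lift 0 i" by (simp add: lift_def)
    then show ?thesis by (simp add: V_def linear_add[OF A] linear_scale[OF A])
  qed
  have jm: "jet_map (k *\<^sub>R j) (k *\<^sub>R j') (x + k *\<^sub>R y) = k *\<^sub>R jet_map j j' x + k\<^sup>2 *\<^sub>R jet_map j j' y" for k x y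
    by (simp add: jet_map_def algebra_simps power2_eq_square)
  have poly: "P\<^sub>0 + k *\<^sub>R P\<^sub>1 - k\<^sup>2 *\<^sub>R P\<^sub>2 = 0" for k
  proof -
    let ?x = "ver (V j) - jet_map j j' (hor H\<^sub>u)" and ?y = "ver (V j') - jet_map j j' (hor H\<^sub>v)"
    have shape: "ver (H + k *\<^sub>R v) - (k *\<^sub>R jet_map j j' (hor H) + k\<^sup>2 *\<^sub>R jet_map j j' (hor v))
        = ver H + (k *\<^sub>R (ver v - jet_map j j' (hor H)) + (- k\<^sup>2) *\<^sub>R jet_map j j' (hor v))" for H v
      by (simp add: algebra_simps)
    have "0 = pde_form \<sigma> (k *\<^sub>R j) (k *\<^sub>R j') +
        pde_form s (ver H\<^sub>u + (k *\<^sub>R ?x + (- k\<^sup>2) *\<^sub>R jet_map j j' (hor (V j))))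
          (ver H\<^sub>v + (k *\<^sub>R ?y + (- k\<^sup>2) *\<^sub>R jet_map j j' (hor (V j'))))"
      using eq[of k] unfolding linearized_def scaleR_Pair prod.case split H\<^sub>u_def[symmetric] H\<^sub>v_def[symmetric]
        hor_add hor_scaleR jm shape by simp
    also have "\<dots> = P\<^sub>0 + k *\<^sub>R P\<^sub>1 - k\<^sup>2 *\<^sub>R P\<^sub>2"
      unfolding pde_form_add_right pde_form_scaleR_right P\<^sub>0_def P\<^sub>1_def P\<^sub>2_def by (simp add: algebra_simps)
    finally show ?thesis by simp
  qed
  have "P\<^sub>0 = 0" using poly[of 0] by simp
  moreover from this have "P\<^sub>1 - P\<^sub>2 = 0" "- P\<^sub>1 - P\<^sub>2 = 0" using poly[of 1] poly[of "-1"] by simp_all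
  then have "P\<^sub>1 = P\<^sub>2" "P\<^sub>1 = - P\<^sub>2" by (auto simp: algebra_simps)
  then have "P\<^sub>2 = - P\<^sub>2" by simp
  then have "2 *\<^sub>R P\<^sub>2 = 0" by (simp add: scaleR_2 eq_neg_iff_add_eq_0)
  with \<open>P\<^sub>1 = P\<^sub>2\<close> have "P\<^sub>2 = 0" "P\<^sub>1 = 0" by simp_all
  ultimately show "pde_form s (ver H\<^sub>u) (ver H\<^sub>v) = 0"
    "pde_form \<sigma> j j' + pde_form s (ver (V j) - jet_map j j' (hor H\<^sub>u)) (ver (V j') - jet_map j j' (hor H\<^sub>v)) = 0"
    "pde_form s (jet_map j j' (hor (V j))) (jet_map j j' (hor (V j'))) = 0"
    by (simp_all add: P\<^sub>0_def P\<^sub>1_def P\<^sub>2_def)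
qed

text \<open>A derivative vanishing along \<open>d\<close> makes \<open>f\<close> invariant under
  translation by \<open>d\<close> inside the convex ball, so its derivatives at both ends agree.
  This takes the place of exchanging second derivatives.\<close>

lemma derivative_invariant_translation:
  fixes f :: "'a::real_normed_vector \<Rightarrow> 'b::real_normed_vector"
  assumes f: "\<And>x. x \<in> ball c r \<Longrightarrow> (f has_derivative f' x) (at x)"
    and d: "\<And>x. x \<in> ball c r \<Longrightarrow> f' x d = 0"
    and x: "x \<in> ball c r" "x + d \<in> ball c r"
  shows "f' (x + d) = f' x"
proof -
  have const: "f (y + d) = f y" if y: "y \<in> ball c r" "y + d \<in> ball c r" for y
  proof -
    have "((\<lambda>t. f (y + t *\<^sub>R d)) has_derivative (\<lambda>h. 0)) (at t within {0..1})" if "t \<in> {0..1}" for t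
    proof -
      have "(1 - t) *\<^sub>R y + t *\<^sub>R (y + d) \<in> ball c r"
        using y that convex_ball[of c r] by (intro convexD) auto
      then have in_ball: "y + t *\<^sub>R d \<in> ball c r" by (simp add: algebra_simps)
      have "((\<lambda>t. y + t *\<^sub>R d) has_derivative (\<lambda>h. h *\<^sub>R d)) (at t within {0..1})"
        by (auto intro!: derivative_eq_intros)
      from has_derivative_compose[OF this, of f "f' (y + t *\<^sub>R d)"] f[OF in_ball]
      have "((\<lambda>t. f (y + t *\<^sub>R d)) has_derivative (\<lambda>h. f' (y + t *\<^sub>R d) (h *\<^sub>R d))) (at t within {0..1})"
        by simp
      then show ?thesis
        using d[OF in_ball] linear_scale[OF has_derivative_linear[OF f[OF in_ball]]] by simp
    qed
    then obtain k where "\<forall>t\<in>{0..1}. f (y + t *\<^sub>R d) = k"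
      using has_derivative_zero_constant[of "{0..1::real}" "\<lambda>t. f (y + t *\<^sub>R d)"] by auto
    from this[rule_format, of 0] this[rule_format, of 1] show ?thesis by simp
  qed
  have "((\<lambda>y. y + d) has_derivative (\<lambda>h. h)) (at x)"
    by (auto intro!: derivative_eq_intros)
  from has_derivative_compose[OF this, of f "f' (x + d)"] f[OF x(2)]
  have "((\<lambda>y. f (y + d)) has_derivative f' (x + d)) (at x)" by simp
  moreover have "open {y \<in> ball c r. y + d \<in> ball c r}"
  proof -
    have "{y \<in> ball c r. y + d \<in> ball c r} = ball c r \<inter> ball (c - d) r"
      by (auto simp: dist_norm algebra_simps)
    then show ?thesis by (metis open_Int open_ball)
  qed
  ultimately have "(f has_derivative f' (x + d)) (at x)"
    by (rule has_derivative_transform_within_open) (use x const in auto)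
  then show ?thesis using f[OF x(1)] by (rule has_derivative_unique)
qed

lemma linear_triple:
  assumes "linear L"
  shows "L (x, y, z :: real) = x *\<^sub>R L (1, 0, 0) + y *\<^sub>R L (0, 1, 0) + z *\<^sub>R L (0, 0, 1)"
proof -
  have "(x, y, z) = x *\<^sub>R (1, 0, 0) + y *\<^sub>R (0, 1, 0) + z *\<^sub>R (0, 0, 1)" by simp
  then have "L (x, y, z) = L (x *\<^sub>R (1, 0, 0) + y *\<^sub>R (0, 1, 0) + z *\<^sub>R (0, 0, 1))" by (rule arg_cong)
  then show ?thesis by (simp only: linear_add[OF assms] linear_scale[OF assms])
qed

text \<open>Collects what a single point yields, in degrees 2, 1 and 0. The lemmas after it compare
  different points.\<close>

lemma symmetry_pointwise:
  assumes sym: "infinitesimal_symmetry U X" "open U" "U \<subseteq> metric_domain" "lift w s \<in> U"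
    and s: "s = (E, F, G)"
  defines "A \<equiv> frechet_derivative X (at (lift w s))"
  defines "H\<^sub>u \<equiv> A (lift (1, 0) 0)" and "H\<^sub>v \<equiv> A (lift (0, 1) 0)"
  defines "a\<^sub>u \<equiv> fst (hor H\<^sub>u)" and "b\<^sub>u \<equiv> snd (hor H\<^sub>u)" and "a\<^sub>v \<equiv> fst (hor H\<^sub>v)" and "b\<^sub>v \<equiv> snd (hor H\<^sub>v)"
  obtains e f g where "ver (X (lift w s)) = (e, f, g)" "linear A"
    "\<And>j. hor (A (lift 0 j)) = 0"
    "F * e - E * f = - 3 * E\<^sup>2 * a\<^sub>v + E * (2 * E - F) * (a\<^sub>u - b\<^sub>v) + (2 * E * (2 * G - F) + (2 * E - F)\<^sup>2) * b\<^sub>u"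
    "E * g - G * e = 3 * E * G * (a\<^sub>u - b\<^sub>v) + G * (2 * E - F) * b\<^sub>u - E * (2 * G - F) * a\<^sub>v"
    "(2 * E + 2 * G + F) * (a\<^sub>u - b\<^sub>v) + (7 * G + 4 * E - 4 * F) * b\<^sub>u - (7 * E + 4 * G - 4 * F) * a\<^sub>v = 0"
    "pde_form s (ver H\<^sub>u) (ver H\<^sub>v) = 0"
    "\<And>j j' b c. (j, j') = proj_jet s b c \<or> (j, j') = exp_jet s \<Longrightarrow> pde_form (e, f, g) j j' +
       pde_form s (ver (A (lift 0 j)) - jet_map j j' (hor H\<^sub>u)) (ver (A (lift 0 j')) - jet_map j j' (hor H\<^sub>v)) = 0"
proof -
  have metric: "0 < E" "0 < E * G - F\<^sup>2"
    using sym(3,4) by (auto simp: metric_domain_iff s)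
  have "smooth_on X U"
    using sym(1) by (simp add: infinitesimal_symmetry_def vector_fields_def)
  then have "(X has_derivative A) (at (lift w s))"
    unfolding A_def using sym(4) smooth_on_differentiable frechet_derivative_works by blast
  then have A: "linear A" by (rule has_derivative_linear)
  obtain e f g where \<sigma>: "ver (X (lift w s)) = (e, f, g)" by (cases "ver (X (lift w s))")
  note lin = symmetry_linearized_at_jets[OF sym, folded A_def, unfolded \<sigma>]
  have jet: "linearized A (e, f, g) s (k *\<^sub>R (j, j'))" if "(j, j') = proj_jet s b c \<or> (j, j') = exp_jet s" for j j' b c k
    using that lin(1)[of k b c] lin(2)[of k] by (elim disjE) (simp_all only:)
  have deg: "pde_form s (ver H\<^sub>u) (ver H\<^sub>v) = 0"
    "pde_form (e, f, g) j j' + pde_form s (ver (A (lift 0 j)) - jet_map j j' (hor H\<^sub>u))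
       (ver (A (lift 0 j')) - jet_map j j' (hor H\<^sub>v)) = 0"
    "pde_form s (jet_map j j' (hor (A (lift 0 j)))) (jet_map j j' (hor (A (lift 0 j')))) = 0"
    if "(j, j') = proj_jet s b c \<or> (j, j') = exp_jet s" for j j' b c
    using linearized_degrees[OF A jet[OF that]] unfolding H\<^sub>u_def H\<^sub>v_def by blast+
  have "linear (\<lambda>j. lift 0 j)" by (rule linearI) (simp_all add: lift_def)
  then have lift: "linear (\<lambda>j. A (lift 0 j))"
    using linear_compose[OF _ A] by (simp add: o_def)
  then have lin_hor: "linear (\<lambda>j. hor (A (lift 0 j)))" and lin_ver: "linear (\<lambda>j. ver (A (lift 0 j)))"
    using linear_compose[OF lift] bounded_linear.linear[OF bounded_linear_hor] bounded_linear.linear[OF bounded_linear_ver]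
    by (simp_all add: o_def)
  obtain a\<^sub>E b\<^sub>E where hE: "hor (A (lift 0 (1, 0, 0))) = (a\<^sub>E, b\<^sub>E)" by (cases "hor (A (lift 0 (1, 0, 0)))")
  obtain a\<^sub>F b\<^sub>F where hF: "hor (A (lift 0 (0, 1, 0))) = (a\<^sub>F, b\<^sub>F)" by (cases "hor (A (lift 0 (0, 1, 0)))")
  obtain a\<^sub>G b\<^sub>G where hG: "hor (A (lift 0 (0, 0, 1))) = (a\<^sub>G, b\<^sub>G)" by (cases "hor (A (lift 0 (0, 0, 1)))")
  have hor: "hor (A (lift 0 (x, y, z))) = (a\<^sub>E * x + a\<^sub>F * y + a\<^sub>G * z, b\<^sub>E * x + b\<^sub>F * y + b\<^sub>G * z)" for x y z
    using linear_triple[OF lin_hor, of x y z] by (simp add: hE hF hG mult.commute)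
  have "a\<^sub>E = 0 \<and> a\<^sub>F = 0 \<and> a\<^sub>G = 0 \<and> b\<^sub>E = 0 \<and> b\<^sub>F = 0 \<and> b\<^sub>G = 0"
  proof (rule quadratic_part_zero[OF metric])
    fix b c
    obtain j j' where j: "(j, j') = proj_jet s b c" by (cases "proj_jet s b c") auto
    have B: "(\<lambda>(x, y, z). (a\<^sub>E * x + a\<^sub>F * y + a\<^sub>G * z, b\<^sub>E * x + b\<^sub>F * y + b\<^sub>G * z)) i = hor (A (lift 0 i))" for i
      by (cases i) (simp add: hor)
    show "case proj_jet (E, F, G) b c of (j, j') \<Rightarrow>
      pde_form (E, F, G) (jet_map j j' ((\<lambda>(x, y, z). (a\<^sub>E * x + a\<^sub>F * y + a\<^sub>G * z, b\<^sub>E * x + b\<^sub>F * y + b\<^sub>G * z)) j))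
        (jet_map j j' ((\<lambda>(x, y, z). (a\<^sub>E * x + a\<^sub>F * y + a\<^sub>G * z, b\<^sub>E * x + b\<^sub>F * y + b\<^sub>G * z)) j')) = 0"
      unfolding B using deg(3)[of j j' b c] by (simp add: s flip: j[unfolded s])
  qed
  then have hor0: "hor (A (lift 0 j)) = 0" for j
    by (cases j) (simp add: hor flip: zero_prod_def)
  obtain e\<^sub>E f\<^sub>E g\<^sub>E where vE: "ver (A (lift 0 (1, 0, 0))) = (e\<^sub>E, f\<^sub>E, g\<^sub>E)" by (cases "ver (A (lift 0 (1, 0, 0)))")
  obtain e\<^sub>F f\<^sub>F g\<^sub>F where vF: "ver (A (lift 0 (0, 1, 0))) = (e\<^sub>F, f\<^sub>F, g\<^sub>F)" by (cases "ver (A (lift 0 (0, 1, 0)))")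
  obtain e\<^sub>G f\<^sub>G g\<^sub>G where vG: "ver (A (lift 0 (0, 0, 1))) = (e\<^sub>G, f\<^sub>G, g\<^sub>G)" by (cases "ver (A (lift 0 (0, 0, 1)))")
  define S where "S = (\<lambda>(x, y, z). (e\<^sub>E * x + e\<^sub>F * y + e\<^sub>G * z, f\<^sub>E * x + f\<^sub>F * y + f\<^sub>G * z, g\<^sub>E * x + g\<^sub>F * y + g\<^sub>G * z))"
  have S: "ver (A (lift 0 j)) = S j" for j
    using linear_triple[OF lin_ver] by (cases j) (simp add: S_def vE vF vG mult.commute)
  define L where "L = (\<lambda>(j, j'). pde_form (e, f, g) j j' +
    pde_form (E, F, G) (S j - jet_map j j' (a\<^sub>u, b\<^sub>u)) (S j' - jet_map j j' (a\<^sub>v, b\<^sub>v)))"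
  have hor_uv: "hor H\<^sub>u = (a\<^sub>u, b\<^sub>u)" "hor H\<^sub>v = (a\<^sub>v, b\<^sub>v)"
    by (simp_all add: a\<^sub>u_def b\<^sub>u_def a\<^sub>v_def b\<^sub>v_def)
  have L: "L (j, j') = 0" if "(j, j') = proj_jet s b c \<or> (j, j') = exp_jet s" for j j' b c
    using deg(2)[OF that] unfolding L_def prod.case S hor_uv s .
  have L': "L (proj_jet (E, F, G) b c) = 0" "L (exp_jet (E, F, G)) = 0" for b c
    using L[of "fst (proj_jet s b c)" "snd (proj_jet s b c)" b c] L[of "fst (exp_jet s)" "snd (exp_jet s)"]
    by (simp_all add: s)
  note lp = linear_part_consequences[OF metric(2) L'[unfolded L_def S_def]]
  show ?thesis
  proof (rule that[OF \<sigma> A hor0 lp])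
    show "pde_form s (ver H\<^sub>u) (ver H\<^sub>v) = 0"
      using deg(1)[of "fst (exp_jet s)" "snd (exp_jet s)"] by simp
  qed (rule deg(2))
qed


section \<open>From local to global\<close>

lemma lift_add: "lift w s + lift w' s' = lift (w + w') (s + s')"
  and lift_scaleR: "k *\<^sub>R lift w s = lift (k *\<^sub>R w) (k *\<^sub>R s)"
  by (simp_all add: lift_def)

text \<open>Moving \<open>p\<close> within its fibre changes E, F, G but, by \<open>shift\<close>,
  not the derivative of the base part. Hence \<open>cons\<close> is an affine identity in (x, y, z)
  with fixed \<open>a\<^sub>u, a\<^sub>v, b\<^sub>u, b\<^sub>v\<close>, and its three linear
  coefficients force \<open>a\<^sub>v = 0\<close>, \<open>b\<^sub>u = 0\<close> and
  \<open>b\<^sub>v = a\<^sub>u\<close>.\<close>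

lemma symmetry_horizontal_part:
  assumes sym: "infinitesimal_symmetry U X" "open U" "U \<subseteq> metric_domain" "p \<in> U"
  defines "A \<equiv> frechet_derivative X (at p)"
  shows "hor (A h) = fst (hor (A (lift (1, 0) 0))) *\<^sub>R hor h"
proof -
  obtain w E F G where p: "p = lift w (E, F, G)"
    by (metis hor_ver_lift(3) prod_cases3)
  obtain r where "0 < r" and r: "ball p r \<subseteq> U"
    using sym(2,4) open_contains_ball by blast
  define D where "D x = frechet_derivative X (at x)" for x
  have "smooth_on X U"
    using sym(1) by (simp add: infinitesimal_symmetry_def vector_fields_def)
  then have D: "(X has_derivative D x) (at x)" if "x \<in> U" for x
    unfolding D_def using that smooth_on_differentiable frechet_derivative_works by blast
  have vertical: "hor (D x (lift 0 j)) = 0" if "x \<in> U" for x j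
  proof -
    have U: "lift (hor x) (ver x) \<in> U" using that by simp
    obtain E' F' G' where s: "ver x = (E', F', G')" by (cases "ver x")
    have "hor (D (lift (hor x) (ver x)) (lift 0 j)) = 0"
      unfolding D_def by (rule symmetry_pointwise[OF sym(1-3) U s])
    then show ?thesis by simp
  qed
  have shift: "hor (D (p + lift 0 j) h) = hor (D p h)" if "norm (lift 0 j) < r" for j h
  proof -
    have "(\<lambda>h. hor (D (p + lift 0 j) h)) = (\<lambda>h. hor (D p h))"
    proof (rule derivative_invariant_translation[where f = "\<lambda>x. hor (X x)"])
      fix x assume "x \<in> ball p r"
      then have "x \<in> U" using r by blast
      show "((\<lambda>x. hor (X x)) has_derivative (\<lambda>h. hor (D x h))) (at x)"
        by (rule bounded_linear.has_derivative[OF bounded_linear_hor D[OF \<open>x \<in> U\<close>]])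
      show "hor (D x (lift 0 j)) = 0" by (rule vertical[OF \<open>x \<in> U\<close>])
    qed (use \<open>0 < r\<close> that in \<open>auto simp: dist_norm\<close>)
    then show ?thesis by metis
  qed
  define a\<^sub>u b\<^sub>u a\<^sub>v b\<^sub>v where "a\<^sub>u = fst (hor (D p (lift (1, 0) 0)))" and "b\<^sub>u = snd (hor (D p (lift (1, 0) 0)))"
    and "a\<^sub>v = fst (hor (D p (lift (0, 1) 0)))" and "b\<^sub>v = snd (hor (D p (lift (0, 1) 0)))"
  have cons: "(2 * (E + x) + 2 * (G + z) + (F + y)) * (a\<^sub>u - b\<^sub>v) + (7 * (G + z) + 4 * (E + x) - 4 * (F + y)) * b\<^sub>u
      - (7 * (E + x) + 4 * (G + z) - 4 * (F + y)) * a\<^sub>v = 0" if "norm (lift 0 (x, y, z)) < r" for x y z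
  proof -
    have q: "p + lift 0 (x, y, z) = lift w (E + x, F + y, G + z)"
      by (simp add: p lift_add)
    have "p + lift 0 (x, y, z) \<in> U"
      by (rule subsetD[OF r]) (use that in \<open>simp add: dist_norm\<close>)
    then have U: "lift w (E + x, F + y, G + z) \<in> U" by (simp add: q)
    show ?thesis
      unfolding a\<^sub>u_def b\<^sub>u_def a\<^sub>v_def b\<^sub>v_def
      by (rule symmetry_pointwise[OF sym(1-3) U refl, folded q D_def, unfolded shift[OF that]])
  qed
  \<comment> \<open>Steps of this length along the three fibre axes, compared with no step, read off
    the coefficients of E, F and G in \<open>cons\<close>.\<close>
  define \<eta> where "\<eta> = r / 2"
  have "0 < \<eta>" "\<eta> < r" using \<open>0 < r\<close> by (simp_all add: \<eta>_def)
  then have norms: "norm (lift 0 (\<eta>, 0, 0)) < r" "norm (lift 0 (0, \<eta>, 0)) < r" "norm (lift 0 (0, 0, \<eta>)) < r"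
    "norm (lift 0 (0, 0, 0 :: real)) < r"
    using \<open>0 < r\<close> by (simp_all add: lift_def norm_Pair)
  have "\<eta> * (2 * (a\<^sub>u - b\<^sub>v) + 4 * b\<^sub>u - 7 * a\<^sub>v) = 0" "\<eta> * ((a\<^sub>u - b\<^sub>v) - 4 * b\<^sub>u + 4 * a\<^sub>v) = 0"
    "\<eta> * (2 * (a\<^sub>u - b\<^sub>v) + 7 * b\<^sub>u - 4 * a\<^sub>v) = 0"
    using cons[OF norms(1)] cons[OF norms(2)] cons[OF norms(3)] cons[OF norms(4)] by algebra+
  then have "2 * (a\<^sub>u - b\<^sub>v) + 4 * b\<^sub>u - 7 * a\<^sub>v = 0" "(a\<^sub>u - b\<^sub>v) - 4 * b\<^sub>u + 4 * a\<^sub>v = 0"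
    "2 * (a\<^sub>u - b\<^sub>v) + 7 * b\<^sub>u - 4 * a\<^sub>v = 0"
    using \<open>0 < \<eta>\<close> by simp_all
  then have "a\<^sub>v = 0 \<and> b\<^sub>u = 0 \<and> b\<^sub>v = a\<^sub>u" by (intro conjI; algebra)
  then have uv: "hor (D p (lift (1, 0) 0)) = (a\<^sub>u, 0)" "hor (D p (lift (0, 1) 0)) = (0, a\<^sub>u)"
    by (simp_all add: a\<^sub>u_def b\<^sub>u_def a\<^sub>v_def b\<^sub>v_def prod_eq_iff)
  have lin: "linear (D p)" using D[OF sym(4)] by (rule has_derivative_linear)
  have "h = fst (hor h) *\<^sub>R lift (1, 0) 0 + snd (hor h) *\<^sub>R lift (0, 1) 0 + lift 0 (ver h)"
    by (simp add: lift_def hor_def ver_def prod_eq_iff)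
  then have "D p h = fst (hor h) *\<^sub>R D p (lift (1, 0) 0) + snd (hor h) *\<^sub>R D p (lift (0, 1) 0) + D p (lift 0 (ver h))"
    using linear_add[OF lin] linear_scale[OF lin] by metis
  then have "hor (D p h) = a\<^sub>u *\<^sub>R hor h"
    by (cases "hor h") (simp add: uv vertical[OF sym(4)] mult.commute)
  then show ?thesis by (simp add: A_def D_def[symmetric] a\<^sub>u_def)
qed

text \<open>With the base derivative a multiple of the identity, the right sides of the first two
  degree 1 relations vanish, and their left sides say that the fibre part is parallel to (E, F,
  G).\<close>

lemma symmetry_vertical_part:
  assumes sym: "infinitesimal_symmetry U X" "open U" "U \<subseteq> metric_domain" "p \<in> U"
  obtains \<mu> where "ver (X p) = \<mu> *\<^sub>R ver p"
proof -
  obtain w E F G where p: "p = lift w (E, F, G)"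
    by (metis hor_ver_lift(3) prod_cases3)
  note hp = symmetry_horizontal_part[OF sym, unfolded p]
  let ?A = "frechet_derivative X (at (lift w (E, F, G)))"
  define \<kappa> where "\<kappa> = fst (hor (?A (lift (1, 0) 0)))"
  have uv: "hor (?A (lift (1, 0) 0)) = (\<kappa>, 0)" "hor (?A (lift (0, 1) 0)) = (0, \<kappa>)"
    using hp[of "lift (1, 0) 0"] hp[of "lift (0, 1) 0"] by (simp_all add: \<kappa>_def)
  have "0 < E" using sym(3,4) by (auto simp: p metric_domain_iff)
  from sym(4) have "lift w (E, F, G) \<in> U" by (simp add: p)
  then obtain e f g where X: "ver (X (lift w (E, F, G))) = (e, f, g)"
    and eqs: "F * e - E * f = - 3 * E\<^sup>2 * 0 + E * (2 * E - F) * (\<kappa> - \<kappa>) + (2 * E * (2 * G - F) + (2 * E - F)\<^sup>2) * 0"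
    "E * g - G * e = 3 * E * G * (\<kappa> - \<kappa>) + G * (2 * E - F) * 0 - E * (2 * G - F) * 0"
    by (rule symmetry_pointwise[OF sym(1-3) _ refl, of w E F G, unfolded uv fst_conv snd_conv]) (rule that)
  then have "F * e = E * f" "E * g = G * e" by simp_all
  then have "(e, f, g) = (e / E) *\<^sub>R (E, F, G)"
    using \<open>0 < E\<close> by (simp add: field_simps)
  then show ?thesis
    by (intro that[of "e / E"]) (simp only: p X hor_ver_lift)
qed

text \<open>Let \<open>l\<close> be the derivative of the factor \<mu>. In degree 1 every term with
  \<mu> or \<kappa> multiplies the system evaluated at an admissible jet and drops out. What remains
  there, as in degree 0, is the system at jets parallel to (E, F, G), so \<open>l\<close> vanishes
  on base directions and on all components of admissible jets, which span the fibre.\<close>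

lemma symmetry_scaling_constant:
  assumes sym: "infinitesimal_symmetry U X" "open U" "U \<subseteq> metric_domain"
    and "connected U" "U \<noteq> {}"
  obtains d where "\<And>p. p \<in> U \<Longrightarrow> ver (X p) = d *\<^sub>R ver p"
proof -
  define \<mu> where "\<mu> p = fst (ver (X p)) / fst (ver p)" for p
  have pos: "0 < fst (ver p)" if "p \<in> U" for p
    using that sym(3) by (auto simp: metric_domain_def ver_def)
  have X: "ver (X p) = \<mu> p *\<^sub>R ver p" if p: "p \<in> U" for p
  proof -
    obtain m where m: "ver (X p) = m *\<^sub>R ver p"
      by (rule symmetry_vertical_part[OF sym p])
    with pos[OF p] have "\<mu> p = m" by (simp add: \<mu>_def)
    with m show ?thesis by simp
  qed
  define D where "D x = frechet_derivative X (at x)" for x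
  have "smooth_on X U"
    using sym(1) by (simp add: infinitesimal_symmetry_def vector_fields_def)
  then have D: "(X has_derivative D x) (at x)" if "x \<in> U" for x
    unfolding D_def using that smooth_on_differentiable frechet_derivative_works by blast
  have "(\<mu> has_derivative (\<lambda>h. 0)) (at p)" if "p \<in> U" for p
  proof -
    obtain w E F G where p: "p = lift w (E, F, G)"
      by (metis hor_ver_lift(3) prod_cases3)
    define s where "s = (E, F, G)"
    have metric: "0 < E" "0 < E * G - F\<^sup>2" using that sym(3) by (auto simp: p metric_domain_iff)
    have "0 < E * G" using metric by (smt (verit) zero_le_power2)
    then have "0 < G" using \<open>0 < E\<close> by (simp add: zero_less_mult_iff)
    have dX: "((\<lambda>p. ver (X p)) has_derivative (\<lambda>h. ver (D p h))) (at p)"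
      by (rule bounded_linear.has_derivative[OF bounded_linear_ver D[OF that]])
    have dv: "(ver has_derivative ver) (at p)"
      by (rule bounded_linear_imp_has_derivative[OF bounded_linear_ver])
    have "\<mu> differentiable (at p)"
      unfolding \<mu>_def using pos[OF that]
      by (intro differentiable_divide differentiableI[OF has_derivative_fst[OF dX]]
          differentiableI[OF has_derivative_fst[OF dv]]) auto
    then obtain l where l: "(\<mu> has_derivative l) (at p)" by (auto simp: differentiable_def)
    then have "linear l" by (rule has_derivative_linear)
    have "((\<lambda>p. \<mu> p *\<^sub>R ver p) has_derivative (\<lambda>h. \<mu> p *\<^sub>R ver h + l h *\<^sub>R ver p)) (at p)"
      by (rule has_derivative_scaleR[OF l dv])
    then have "((\<lambda>p. ver (X p)) has_derivative (\<lambda>h. \<mu> p *\<^sub>R ver h + l h *\<^sub>R ver p)) (at p)"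
      by (rule has_derivative_transform_within_open[OF _ sym(2) that]) (simp add: X)
    from has_derivative_unique[OF dX this]
    have ver_D: "ver (D p h) = \<mu> p *\<^sub>R ver h + l h *\<^sub>R s" for h
      by (metis hor_ver_lift(2) p s_def)
    define \<kappa> where "\<kappa> = fst (hor (D p (lift (1, 0) 0)))"
    have hor_D: "hor (D p h) = \<kappa> *\<^sub>R hor h" for h
      unfolding \<kappa>_def D_def by (rule symmetry_horizontal_part[OF sym that])
    have U: "lift w s \<in> U" using that by (simp add: p s_def)
    have ps: "p = lift w s" by (simp add: p s_def)
    obtain e f g where efg: "ver (X p) = (e, f, g)"
      and deg0: "pde_form s (ver (D p (lift (1, 0) 0))) (ver (D p (lift (0, 1) 0))) = 0"
      and deg1: "\<And>j j' b c. (j, j') = proj_jet s b c \<or> (j, j') = exp_jet s \<Longrightarrow> pde_form (e, f, g) j j' +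
       pde_form s (ver (D p (lift 0 j)) - jet_map j j' (hor (D p (lift (1, 0) 0))))
         (ver (D p (lift 0 j')) - jet_map j j' (hor (D p (lift (0, 1) 0)))) = 0"
      by (rule symmetry_pointwise[OF sym U s_def, folded ps D_def]) (rule that)
    have "pde_form s (l (lift (1, 0) 0) *\<^sub>R s) (l (lift (0, 1) 0) *\<^sub>R s) = 0"
      using deg0 by (simp add: ver_D)
    then have l_uv: "l (lift (1, 0) 0) = 0" "l (lift (0, 1) 0) = 0"
      using pde_form_parallel_zero[OF metric] unfolding s_def by blast+
    have l_jet: "l (lift 0 j) = 0 \<and> l (lift 0 j') = 0" if J: "(j, j') = proj_jet s b c \<or> (j, j') = exp_jet s" for j j' b c
    proof -
      have jj: "pde_form s j j' = 0"
        using J pde_form_jets(1)[of s b c] pde_form_jets(2)[of s] by (auto split: prod.splits)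
      have efg': "(e, f, g) = \<mu> p *\<^sub>R s"
        using X[OF \<open>p \<in> U\<close>] efg by (simp add: p s_def)
      have "pde_form s ((l (lift 0 j) *\<^sub>R s) + (\<mu> p - \<kappa>) *\<^sub>R j) ((l (lift 0 j') *\<^sub>R s) + (\<mu> p - \<kappa>) *\<^sub>R j') = 0"
        using deg1[OF J] jj unfolding efg' pde_form_scaleR_left
        by (simp add: ver_D hor_D jet_map_def algebra_simps)
      then have "pde_form s (l (lift 0 j) *\<^sub>R s) (l (lift 0 j') *\<^sub>R s) = 0"
        unfolding pde_form_add_right pde_form_scaleR_right jj by simp
      then show ?thesis using pde_form_parallel_zero[OF metric] unfolding s_def by blast
    qed
    have lin: "linear (\<lambda>j. l (lift 0 j))"
      using linear_add[OF \<open>linear l\<close>] linear_scale[OF \<open>linear l\<close>]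
      by (intro linearI) (metis lift_add add_0, metis lift_scaleR scaleR_zero_right)
    define l\<^sub>E l\<^sub>F l\<^sub>G where "l\<^sub>E = l (lift 0 (1, 0, 0))" and "l\<^sub>F = l (lift 0 (0, 1, 0))" and "l\<^sub>G = l (lift 0 (0, 0, 1))"
    have l_ver: "l (lift 0 (x, y, z)) = x * l\<^sub>E + y * l\<^sub>F + z * l\<^sub>G" for x y z
      using linear_triple[OF lin, of x y z] by (simp add: l\<^sub>E_def l\<^sub>F_def l\<^sub>G_def)
    have e: "2 * E * l\<^sub>E + F * l\<^sub>F = 0" "- F * l\<^sub>F - 2 * G * l\<^sub>G = 0"
      using l_jet[of "(2 * E, F, 0)" "(0, - F, - 2 * G)"] by (simp_all add: s_def exp_jet_def l_ver)
    \<comment> \<open>Subtracting the two exponential relations with multipliers 2 F and - 2 F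
      leaves \<open>(E * G - F\<^sup>2) * l\<^sub>F\<close>.\<close>
    have "4 * E * F * l\<^sub>E + (E * G - F\<^sup>2 + 4 * F * F) * l\<^sub>F + 4 * G * F * l\<^sub>G = 0"
      using l_jet[of "fst (proj_jet s 1 0)" "snd (proj_jet s 1 0)" 1 0] by (simp add: s_def proj_jet_def l_ver)
    with e have "(E * G - F\<^sup>2) * l\<^sub>F = 0" by algebra
    then have "l\<^sub>F = 0" using metric by simp
    with e have "l\<^sub>E = 0" "l\<^sub>G = 0" using \<open>0 < E\<close> \<open>0 < G\<close> by simp_all
    have "l h = 0" for h
    proof -
      obtain x y z where xyz: "ver h = (x, y, z)" by (cases "ver h")
      have "h = fst (hor h) *\<^sub>R lift (1, 0) 0 + snd (hor h) *\<^sub>R lift (0, 1) 0 + lift 0 (ver h)"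
        by (simp add: lift_def hor_def ver_def prod_eq_iff)
      then have "l h = fst (hor h) *\<^sub>R l (lift (1, 0) 0) + snd (hor h) *\<^sub>R l (lift (0, 1) 0) + l (lift 0 (ver h))"
        using linear_add[OF \<open>linear l\<close>] linear_scale[OF \<open>linear l\<close>] by metis
      then show ?thesis by (simp add: l_uv xyz l_ver \<open>l\<^sub>E = 0\<close> \<open>l\<^sub>F = 0\<close> \<open>l\<^sub>G = 0\<close>)
    qed
    then have "l = (\<lambda>h. 0)" by auto
    with l show ?thesis by simp
  qed
  then have "\<mu> p = \<mu> q" if "p \<in> U" "q \<in> U" for p q
    using has_derivative_zero_unique_connected[OF sym(2) \<open>connected U\<close>] that by blast
  then obtain d where "\<And>p. p \<in> U \<Longrightarrow> \<mu> p = d" by metis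
  then show ?thesis using that X by metis
qed

text \<open>Locally the first component of the base part depends on u only, so its u-derivative
  \<kappa> is unchanged by moves in v, E, F, G. The second component depends on v only and has
  v-derivative \<kappa>, which is thus unchanged by moves in u. Together \<kappa> is locally
  constant.\<close>

lemma symmetry_affine_horizontal:
  assumes sym: "infinitesimal_symmetry U X" "open U" "U \<subseteq> metric_domain"
    and "connected U" "U \<noteq> {}"
  obtains a c where "\<And>p. p \<in> U \<Longrightarrow> hor (X p) = a + c *\<^sub>R hor p"
proof -
  define D where "D x = frechet_derivative X (at x)" for x
  define \<kappa> where "\<kappa> x = fst (hor (D x (lift (1, 0) 0)))" for x
  have "smooth_on X U"
    using sym(1) by (simp add: infinitesimal_symmetry_def vector_fields_def)
  then have "(X has_derivative D x) (at x)" if "x \<in> U" for x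
    unfolding D_def using that smooth_on_differentiable frechet_derivative_works by blast
  then have "((\<lambda>x. hor (X x)) has_derivative (\<lambda>h. hor (D x h))) (at x)" if "x \<in> U" for x
    using that by (intro bounded_linear.has_derivative[OF bounded_linear_hor])
  moreover have "hor (D x h) = \<kappa> x *\<^sub>R hor h" if "x \<in> U" for x h
    unfolding \<kappa>_def D_def by (rule symmetry_horizontal_part[OF sym that])
  ultimately have dX: "((\<lambda>x. hor (X x)) has_derivative (\<lambda>h. \<kappa> x *\<^sub>R hor h)) (at x)" if "x \<in> U" for x
    using that by simp
  have local: "\<kappa> q = \<kappa> p" if r: "ball p r \<subseteq> U" "q \<in> ball p r" for p q r
  proof -
    \<comment> \<open>A path from \<open>p\<close> to \<open>q\<close> in two legs:
      \<open>d\<^sub>1\<close> changes v and the fibre, \<open>d\<^sub>2\<close> only u. The corner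
      stays in the ball because \<open>d\<^sub>1\<close> is not longer than
      \<open>q - p\<close>.\<close>
    define d\<^sub>1 where "d\<^sub>1 = lift (0, snd (hor (q - p))) (ver (q - p))"
    define d\<^sub>2 where "d\<^sub>2 = lift (fst (hor (q - p)), 0) 0"
    have q: "q = p + d\<^sub>1 + d\<^sub>2"
      by (simp add: d\<^sub>1_def d\<^sub>2_def lift_add flip: zero_prod_def) (simp add: lift_def hor_def ver_def prod_eq_iff)
    have "norm d\<^sub>1 \<le> norm (q - p)"
      by (simp add: d\<^sub>1_def lift_def hor_def ver_def norm_prod_def)
    then have ball: "p \<in> ball p r" "p + d\<^sub>1 \<in> ball p r"
      using r(2) by (auto simp: dist_norm norm_minus_commute intro: le_less_trans[OF norm_ge_zero])
    have "(\<lambda>h. fst (\<kappa> (p + d\<^sub>1) *\<^sub>R hor h)) = (\<lambda>h. fst (\<kappa> p *\<^sub>R hor h))"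
    proof (rule derivative_invariant_translation[where f = "\<lambda>x. fst (hor (X x))", OF _ _ ball])
      show "((\<lambda>x. fst (hor (X x))) has_derivative (\<lambda>h. fst (\<kappa> x *\<^sub>R hor h))) (at x)" if "x \<in> ball p r" for x
        by (rule has_derivative_fst[OF dX[OF subsetD[OF r(1) that]]])
    qed (simp add: d\<^sub>1_def)
    from fun_cong[OF this, of "lift (1, 0) 0"] have "\<kappa> (p + d\<^sub>1) = \<kappa> p" by simp
    have "(\<lambda>h. snd (\<kappa> (p + d\<^sub>1 + d\<^sub>2) *\<^sub>R hor h)) = (\<lambda>h. snd (\<kappa> (p + d\<^sub>1) *\<^sub>R hor h))"
    proof (rule derivative_invariant_translation[where f = "\<lambda>x. snd (hor (X x))", OF _ _ ball(2)])
      show "((\<lambda>x. snd (hor (X x))) has_derivative (\<lambda>h. snd (\<kappa> x *\<^sub>R hor h))) (at x)" if "x \<in> ball p r" for x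
        by (rule has_derivative_snd[OF dX[OF subsetD[OF r(1) that]]])
      show "p + d\<^sub>1 + d\<^sub>2 \<in> ball p r" using r(2) by (simp only: q)
    qed (simp add: d\<^sub>2_def)
    from fun_cong[OF this, of "lift (0, 1) 0"] have "\<kappa> q = \<kappa> (p + d\<^sub>1)" by (simp add: q)
    with \<open>\<kappa> (p + d\<^sub>1) = \<kappa> p\<close> show ?thesis by simp
  qed
  have "\<kappa> constant_on U"
  proof (rule locally_constant_imp_constant[OF \<open>connected U\<close>])
    fix p assume "p \<in> U"
    then obtain r where r: "0 < r" "ball p r \<subseteq> U" using sym(2) open_contains_ball by blast
    show "\<exists>T. openin (top_of_set U) T \<and> p \<in> T \<and> (\<forall>q\<in>T. \<kappa> q = \<kappa> p)"
    proof (intro exI conjI ballI)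
      show "openin (top_of_set U) (ball p r)" using r(2) by (rule open_subset[OF _ open_ball])
      show "p \<in> ball p r" using r(1) by simp
      show "\<kappa> q = \<kappa> p" if "q \<in> ball p r" for q by (rule local[OF r(2) that])
    qed
  qed
  then obtain c where c: "\<And>p. p \<in> U \<Longrightarrow> \<kappa> p = c" by (auto simp: constant_on_def)
  have "((\<lambda>p. hor (X p) - c *\<^sub>R hor p) has_derivative (\<lambda>h. \<kappa> p *\<^sub>R hor h - c *\<^sub>R hor h)) (at p)" if "p \<in> U" for p
    by (intro has_derivative_diff dX that has_derivative_scaleR_right
        bounded_linear_imp_has_derivative[OF bounded_linear_hor])
  then have "((\<lambda>p. hor (X p) - c *\<^sub>R hor p) has_derivative (\<lambda>h. 0)) (at p)" if "p \<in> U" for p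
    using that c by simp
  then have "hor (X p) - c *\<^sub>R hor p = hor (X q) - c *\<^sub>R hor q" if "p \<in> U" "q \<in> U" for p q
    using has_derivative_zero_unique_connected[OF sym(2) \<open>connected U\<close>, of "\<lambda>p. hor (X p) - c *\<^sub>R hor p"] that by blast
  then obtain a where "\<And>p. p \<in> U \<Longrightarrow> hor (X p) - c *\<^sub>R hor p = a" by metis
  then show ?thesis using that by (metis diff_add_cancel)
qed


section \<open>The affine symmetry fields\<close>

text \<open>The general linear combination of the four generators: \<open>fst a\<close> and
  \<open>snd a\<close> are the coefficients of \<open>vf_T1\<close> and \<open>vf_T2\<close>,
  \<open>c\<close> and \<open>d\<close> those of \<open>vf_D1\<close> and
  \<open>vf_D2\<close>.\<close>

definition affine_vf :: "real \<times> real \<Rightarrow> real \<Rightarrow> real \<Rightarrow> pt \<Rightarrow> pt" where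
  "affine_vf a c d p = lift (a + c *\<^sub>R hor p) (d *\<^sub>R ver p)"

lemma symmetry_imp_affine:
  assumes "infinitesimal_symmetry U X" "open U" "connected U" "U \<noteq> {}" "U \<subseteq> metric_domain"
  obtains a c d where "X = restrict_vf U (affine_vf a c d)"
proof -
  obtain d where d: "\<And>p. p \<in> U \<Longrightarrow> ver (X p) = d *\<^sub>R ver p"
    by (rule symmetry_scaling_constant[OF assms(1,2,5,3,4)]) (rule that)
  obtain a c where ac: "\<And>p. p \<in> U \<Longrightarrow> hor (X p) = a + c *\<^sub>R hor p"
    by (rule symmetry_affine_horizontal[OF assms(1,2,5,3,4)]) (rule that)
  have "X p = affine_vf a c d p" if "p \<in> U" for p
    using hor_ver_lift(3)[of "X p"] unfolding d[OF that] ac[OF that] affine_vf_def by simp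
  moreover have "X p = 0" if "p \<notin> U" for p
    using assms(1) that unfolding infinitesimal_symmetry_def vector_fields_def by blast
  ultimately show ?thesis
    by (intro that[of a c d]) (auto simp: restrict_vf_def)
qed

lemma bounded_linear_lift:
  assumes "bounded_linear f" "bounded_linear g"
  shows "bounded_linear (\<lambda>x. lift (f x) (g x))"
  unfolding lift_def
  by (intro bounded_linear_Pair bounded_linear_compose[OF bounded_linear_fst]
      bounded_linear_compose[OF bounded_linear_snd] assms)

lemma affine_vf_has_derivative:
  "(affine_vf a c d has_derivative (\<lambda>h. lift (c *\<^sub>R hor h) (d *\<^sub>R ver h))) (at p)"
proof -
  have "affine_vf a c d = (\<lambda>p. lift a 0 + lift (c *\<^sub>R hor p) (d *\<^sub>R ver p))"
    by (auto simp: affine_vf_def lift_add)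
  moreover have "bounded_linear (\<lambda>p. lift (c *\<^sub>R hor p) (d *\<^sub>R ver p))"
    by (intro bounded_linear_lift bounded_linear_hor bounded_linear_ver
        bounded_linear_compose[OF bounded_linear_scaleR_right])
  ultimately show ?thesis
    by (auto intro!: derivative_eq_intros bounded_linear_imp_has_derivative)
qed

lemma restrict_affine_has_derivative:
  assumes "open U" "p \<in> U"
  shows "(restrict_vf U (affine_vf a c d) has_derivative (\<lambda>h. lift (c *\<^sub>R hor h) (d *\<^sub>R ver h))) (at p)"
  by (rule has_derivative_transform_within_open[OF affine_vf_has_derivative assms])
     (simp add: restrict_vf_def)

lemma affine_in_vector_fields:
  assumes "open U"
  shows "restrict_vf U (affine_vf a c d) \<in> vector_fields U"
proof -
  have "smooth_on (\<lambda>p. lift a 0 + lift (c *\<^sub>R hor p) (d *\<^sub>R ver p)) U"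
    by (intro smooth_on_add smooth_on_const smooth_on_bounded_linear assms bounded_linear_lift
        bounded_linear_hor bounded_linear_ver bounded_linear_compose[OF bounded_linear_scaleR_right])
  moreover have "lift a 0 + lift (c *\<^sub>R hor p) (d *\<^sub>R ver p) = affine_vf a c d p" for p
    by (simp add: affine_vf_def lift_add)
  ultimately have "smooth_on (affine_vf a c d) U" by simp
  then show ?thesis
    using smooth_on_cong[OF assms, of "restrict_vf U (affine_vf a c d)" "affine_vf a c d"]
    by (simp add: vector_fields_def restrict_vf_def)
qed

text \<open>The integral of exp(c s) over s from 0 to t, which multiplies \<open>a\<close> in the
  solution of x' = a + c x. For \<open>c = 0\<close> the quotient would evaluate to 0 instead of
  \<open>t\<close>.\<close>

definition shift_time :: "real \<Rightarrow> real \<Rightarrow> real" where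
  "shift_time c t = (if c = 0 then t else (exp (c * t) - 1) / c)"

lemma shift_time_0 [simp]: "shift_time c 0 = 0"
  by (simp add: shift_time_def)

lemma shift_time_has_derivative:
  "(shift_time c has_field_derivative 1 + c * shift_time c t) (at t within S)"
proof (cases "c = 0")
  case True
  then have "shift_time c = (\<lambda>t. t)" by (auto simp: shift_time_def)
  with True show ?thesis by simp
next
  case False
  then have "shift_time c = (\<lambda>t. (exp (c * t) - 1) / c)" by (auto simp: shift_time_def)
  with False show ?thesis by (auto intro!: derivative_eq_intros)
qed

definition affine_flow :: "real \<times> real \<Rightarrow> real \<Rightarrow> real \<Rightarrow> real \<Rightarrow> pt \<Rightarrow> pt" where
  "affine_flow a c d t p = lift (exp (c * t) *\<^sub>R hor p + shift_time c t *\<^sub>R a) (exp (d * t) *\<^sub>R ver p)"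

lemma lift_has_vector_derivative:
  assumes "(f has_vector_derivative f') (at x within S)" "(g has_vector_derivative g') (at x within S)"
  shows "((\<lambda>t. lift (f t) (g t)) has_vector_derivative lift f' g') (at x within S)"
  using has_derivative_Pair[OF has_derivative_fst[OF assms(1)[unfolded has_vector_derivative_def]]
      has_derivative_Pair[OF has_derivative_snd[OF assms(1)[unfolded has_vector_derivative_def]]
        assms(2)[unfolded has_vector_derivative_def]]]
  by (simp add: has_vector_derivative_def lift_def)

lemma affine_flow_has_derivative:
  "((\<lambda>t. affine_flow a c d t p) has_vector_derivative affine_vf a c d (affine_flow a c d t p)) (at t within S)"
proof -
  have exp: "((\<lambda>t. exp (k * t)) has_field_derivative k * exp (k * t)) (at t within S)" for k
    by (auto intro!: derivative_eq_intros)
  have "((\<lambda>t. affine_flow a c d t p) has_vector_derivative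
      lift ((c * exp (c * t)) *\<^sub>R hor p + (1 + c * shift_time c t) *\<^sub>R a) ((d * exp (d * t)) *\<^sub>R ver p)) (at t within S)"
    unfolding affine_flow_def
    using has_vector_derivative_scaleR[OF exp[of c] has_vector_derivative_const, of "hor p"]
      has_vector_derivative_scaleR[OF exp[of d] has_vector_derivative_const, of "ver p"]
      has_vector_derivative_scaleR[OF shift_time_has_derivative[of c] has_vector_derivative_const, of a]
    by (intro lift_has_vector_derivative has_vector_derivative_add) simp_all
  then show ?thesis
    by (simp add: affine_vf_def affine_flow_def algebra_simps)
qed

text \<open>The difference from the explicit curve solves a homogeneous linear equation; the
  integrating factors exp(-c s) and exp(-d s) turn it into a constant, which is 0 at s = 0.\<close>

lemma affine_curve_unique:
  assumes c: "\<And>s. s \<in> S \<Longrightarrow> (\<gamma> has_vector_derivative affine_vf a c d (\<gamma> s)) (at s within S)"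
    and "convex S" "0 \<in> S" "t \<in> S"
  shows "\<gamma> t = affine_flow a c d t (\<gamma> 0)"
proof -
  define z where "z s = \<gamma> s - affine_flow a c d s (\<gamma> 0)" for s
  have z: "(z has_vector_derivative lift (c *\<^sub>R hor (z s)) (d *\<^sub>R ver (z s))) (at s within S)" if "s \<in> S" for s
  proof -
    have "affine_vf a c d (\<gamma> s) - affine_vf a c d (affine_flow a c d s (\<gamma> 0)) = lift (c *\<^sub>R hor (z s)) (d *\<^sub>R ver (z s))"
      by (simp add: z_def affine_vf_def algebra_simps) (simp add: lift_def algebra_simps)
    then show ?thesis
      unfolding z_def[abs_def]
      using has_vector_derivative_diff[OF c[OF that] affine_flow_has_derivative[of a c d "\<gamma> 0" s S]]
      by simp
  qed
  define y where "y s = lift (exp (- c * s) *\<^sub>R hor (z s)) (exp (- d * s) *\<^sub>R ver (z s))" for s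
  have "(y has_derivative (\<lambda>h. 0)) (at s within S)" if "s \<in> S" for s
  proof -
    have exp: "((\<lambda>t. exp (- k * t)) has_field_derivative - k * exp (- k * s)) (at s within S)" for k
      by (auto intro!: derivative_eq_intros)
    have "(y has_vector_derivative lift
        (exp (- c * s) *\<^sub>R hor (lift (c *\<^sub>R hor (z s)) (d *\<^sub>R ver (z s))) + (- c * exp (- c * s)) *\<^sub>R hor (z s))
        (exp (- d * s) *\<^sub>R ver (lift (c *\<^sub>R hor (z s)) (d *\<^sub>R ver (z s))) + (- d * exp (- d * s)) *\<^sub>R ver (z s))) (at s within S)"
      unfolding y_def[abs_def]
      by (intro lift_has_vector_derivative has_vector_derivative_scaleR exp
          bounded_linear.has_vector_derivative[OF bounded_linear_hor z[OF that]]
          bounded_linear.has_vector_derivative[OF bounded_linear_ver z[OF that]])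
    then have "(y has_vector_derivative lift 0 0) (at s within S)"
      by (simp add: mult.commute)
    then show ?thesis
      by (simp add: has_vector_derivative_def lift_def flip: zero_prod_def)
  qed
  then obtain k where "\<forall>s\<in>S. y s = k"
    using has_derivative_zero_constant[OF \<open>convex S\<close>, of y] by blast
  then have "y t = y 0" using assms by simp
  also have "y 0 = 0" by (simp add: y_def z_def affine_flow_def flip: zero_prod_def)
  finally have "hor (y t) = 0" "ver (y t) = 0" by (simp_all add: hor_def ver_def flip: zero_prod_def)
  then have "hor (z t) = 0" "ver (z t) = 0" by (simp_all add: y_def)
  then have "z t = 0" using hor_ver_lift(3)[of "z t"] by (simp add: lift_def zero_prod_def)
  then show ?thesis by (simp add: z_def)
qed

text \<open>Inside \<open>U\<close> the restricted field is affine, so an integral curve in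
  \<open>U\<close> is the explicit one, and only the condition of staying in \<open>U\<close>
  remains.\<close>

lemma flows_to_affine_iff:
  "flows_to U (restrict_vf U (affine_vf a c d)) t p q \<longleftrightarrow>
     q = affine_flow a c d t p \<and> (\<forall>s\<in>closed_segment 0 t. affine_flow a c d s p \<in> U)"
  (is "?L \<longleftrightarrow> ?R")
proof
  assume ?L
  then obtain \<gamma> where \<gamma>: "\<gamma> 0 = p" "\<gamma> t = q" "\<And>s. s \<in> closed_segment 0 t \<Longrightarrow> \<gamma> s \<in> U"
    "\<And>s. s \<in> closed_segment 0 t \<Longrightarrow>
      (\<gamma> has_vector_derivative restrict_vf U (affine_vf a c d) (\<gamma> s)) (at s within closed_segment 0 t)"
    unfolding flows_to_def by blast
  then have "(\<gamma> has_vector_derivative affine_vf a c d (\<gamma> s)) (at s within closed_segment 0 t)"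
    if "s \<in> closed_segment 0 t" for s
    using that by (metis restrict_vf_def)
  from affine_curve_unique[OF this convex_closed_segment ends_in_segment(1)]
  have "\<gamma> s = affine_flow a c d s p" if "s \<in> closed_segment 0 t" for s
    using that \<gamma>(1) by simp
  then show ?R
    using \<gamma>(2,3) ends_in_segment(2) by metis
next
  assume R: ?R
  show ?L
    unfolding flows_to_def
  proof (intro exI[of _ "\<lambda>s. affine_flow a c d s p"] conjI ballI)
    show "affine_flow a c d 0 p = p" by (simp add: affine_flow_def)
    show "affine_flow a c d t p = q" using R by simp
    fix s assume s: "s \<in> closed_segment 0 t"
    then show "affine_flow a c d s p \<in> U" using R by blast
    then have "restrict_vf U (affine_vf a c d) (affine_flow a c d s p) = affine_vf a c d (affine_flow a c d s p)"
      by (simp add: restrict_vf_def)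
    then show "((\<lambda>s. affine_flow a c d s p) has_vector_derivative
        restrict_vf U (affine_vf a c d) (affine_flow a c d s p)) (at s within closed_segment 0 t)"
      using affine_flow_has_derivative by metis
  qed
qed

section \<open>Affine fields carry solutions to solutions\<close>

lemma local_solution_subset:
  assumes "is_local_solution W E F G" "open W'" "W' \<subseteq> W"
  shows "is_local_solution W' E F G"
proof -
  have "surface W' E F G \<subseteq> surface W E F G"
    using assms(3) by (auto simp: surface_def)
  then show ?thesis
    using assms unfolding is_local_solution_def by (auto intro: smooth_on_subset)
qed

lemma surface_iff: "lift w s \<in> surface W E F G \<longleftrightarrow> w \<in> W \<and> s = (E (fst w) (snd w), F (fst w) (snd w), G (fst w) (snd w))"
  by (cases w) (auto simp: surface_def lift_def)

text \<open>Values get the factor \<mu> and partial derivatives the factor \<mu> r. The system is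
  homogeneous in the values and, separately, in the derivatives, so it is preserved, while the
  metric determinant is multiplied by the square of \<mu>.\<close>

lemma rescaled_solution:
  fixes b :: "real \<times> real" and r \<mu> :: real
  assumes sol: "is_local_solution W E F G" and "r \<noteq> 0" "0 < \<mu>"
  defines "T \<equiv> (\<lambda>w. b + r *\<^sub>R w)"
  defines "N \<equiv> (\<lambda>X u v. \<mu> * X (fst (T (u, v))) (snd (T (u, v))))"
  shows "is_local_solution {w. T w \<in> W} (N E) (N F) (N G)"
proof -
  define W' where "W' = {w. T w \<in> W}"
  have "open W" using sol by (simp add: is_local_solution_def)
  have "continuous_on UNIV T" unfolding T_def by (intro continuous_intros)
  then have "open W'"
    unfolding W'_def using open_vimage[OF \<open>open W\<close>, of T] by (simp add: vimage_def)
  have smooth: "smooth_on (\<lambda>(u, v). N X u v) W'" if "smooth_on (\<lambda>(u, v). X u v) W" for X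
  proof -
    have "smooth_on (\<lambda>w. \<mu> * (case b + r *\<^sub>R w of (u, v) \<Rightarrow> X u v)) W'"
      using that
      by (intro smooth_on_mult smooth_on_const \<open>open W'\<close> smooth_on_affine_arg[where S = W] bounded_linear_scaleR_right)
        (auto simp: W'_def T_def)
    then show ?thesis by (simp add: N_def T_def case_prod_beta')
  qed
  have pd: "pd_u (N X) u v = \<mu> * r * pd_u X (fst (T (u, v))) (snd (T (u, v)))"
    "pd_v (N X) u v = \<mu> * r * pd_v X (fst (T (u, v))) (snd (T (u, v)))"
    if "smooth_on (\<lambda>(u, v). X u v) W" "(u, v) \<in> W'" for X u v
  proof -
    have T: "T (u, v) = (fst b + r * u, snd b + r * v)" for u v
      by (simp add: T_def prod_eq_iff)
    have "(\<lambda>(u, v). X u v) differentiable (at (T (u, v)))"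
      using that by (auto intro: smooth_on_differentiable simp: W'_def)
    note D = partial_derivatives(2,3)[OF this[unfolded T]]
    have "((\<lambda>x. X (fst b + r * x) (snd b + r * v)) has_field_derivative pd_u X (fst b + r * u) (snd b + r * v) * r) (at u)"
      by (rule DERIV_chain2[of "\<lambda>x. X x (snd b + r * v)" _ "\<lambda>x. fst b + r * x" u r UNIV, OF D(1)])
        (auto intro!: derivative_eq_intros)
    from DERIV_cmult[OF this, of \<mu>]
    have "((\<lambda>x. N X x v) has_field_derivative \<mu> * r * pd_u X (fst (T (u, v))) (snd (T (u, v)))) (at u)"
      by (simp add: N_def T ac_simps)
    then show "pd_u (N X) u v = \<mu> * r * pd_u X (fst (T (u, v))) (snd (T (u, v)))"
      unfolding pd_u_def[of "N X"] by (rule DERIV_imp_deriv)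
    have "((\<lambda>y. X (fst b + r * u) (snd b + r * y)) has_field_derivative pd_v X (fst b + r * u) (snd b + r * v) * r) (at v)"
      by (rule DERIV_chain2[of "\<lambda>y. X (fst b + r * u) y" _ "\<lambda>y. snd b + r * y" v r UNIV, OF D(2)])
        (auto intro!: derivative_eq_intros)
    from DERIV_cmult[OF this, of \<mu>]
    have "((\<lambda>y. N X u y) has_field_derivative \<mu> * r * pd_v X (fst (T (u, v))) (snd (T (u, v)))) (at v)"
      by (simp add: N_def T ac_simps)
    then show "pd_v (N X) u v = \<mu> * r * pd_v X (fst (T (u, v))) (snd (T (u, v)))"
      unfolding pd_v_def[of "N X"] by (rule DERIV_imp_deriv)
  qed
  have smooth_EFG: "smooth_on (\<lambda>(u, v). E u v) W" "smooth_on (\<lambda>(u, v). F u v) W" "smooth_on (\<lambda>(u, v). G u v) W"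
    using sol by (simp_all add: is_local_solution_def)
  have pde: "pde_system_at (N E) (N F) (N G) u v" if w: "(u, v) \<in> W'" for u v
  proof -
    obtain u' v' where T: "T (u, v) = (u', v')" by (cases "T (u, v)")
    with w have "(u', v') \<in> W" by (simp add: W'_def)
    then have "pde_system_at E F G u' v'" using sol unfolding is_local_solution_def by blast
    moreover have "(N E u v, N F u v, N G u v) = \<mu> *\<^sub>R (E u' v', F u' v', G u' v')"
      "(pd_u (N E) u v, pd_u (N F) u v, pd_u (N G) u v) = (\<mu> * r) *\<^sub>R (pd_u E u' v', pd_u F u' v', pd_u G u' v')"
      "(pd_v (N E) u v, pd_v (N F) u v, pd_v (N G) u v) = (\<mu> * r) *\<^sub>R (pd_v E u' v', pd_v F u' v', pd_v G u' v')"
      using pd[OF smooth_EFG(1) w] pd[OF smooth_EFG(2) w] pd[OF smooth_EFG(3) w] by (simp_all add: T) (simp add: N_def T)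
    ultimately show ?thesis
      unfolding pde_system_iff_form by (simp only: pde_form_scaleR_left pde_form_scaleR_right scaleR_zero_right)
  qed
  have "(u, v, N E u v, N F u v, N G u v) \<in> metric_domain" if "(u, v) \<in> W'" for u v
  proof -
    obtain u' v' where T: "T (u, v) = (u', v')" by (cases "T (u, v)")
    with that have "(u', v') \<in> W" by (simp add: W'_def)
    then have "(u', v', E u' v', F u' v', G u' v') \<in> metric_domain"
      using sol unfolding is_local_solution_def surface_def by blast
    then have m: "0 < E u' v'" "0 < E u' v' * G u' v' - (F u' v')\<^sup>2" by (simp_all add: metric_domain_def)
    have "\<mu> * E u' v' * (\<mu> * G u' v') - (\<mu> * F u' v')\<^sup>2 = \<mu>\<^sup>2 * (E u' v' * G u' v' - (F u' v')\<^sup>2)"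
      by (simp add: algebra_simps power2_eq_square)
    also have "\<dots> > 0" using m \<open>0 < \<mu>\<close> by simp
    finally have "\<mu> * E u' v' * (\<mu> * G u' v') - (\<mu> * F u' v')\<^sup>2 > 0" .
    with m \<open>0 < \<mu>\<close> show ?thesis by (simp add: metric_domain_def N_def T)
  qed
  then have "surface W' (N E) (N F) (N G) \<subseteq> metric_domain" by (auto simp: surface_def)
  then have "is_local_solution W' (N E) (N F) (N G)"
    unfolding is_local_solution_def using \<open>open W'\<close> smooth smooth_EFG pde by blast
  then show ?thesis by (simp add: W'_def)
qed

lemma affine_is_symmetry:
  assumes "open U"
  shows "infinitesimal_symmetry U (restrict_vf U (affine_vf a c d))"
  unfolding infinitesimal_symmetry_def
proof (intro conjI allI impI ballI)
  show "restrict_vf U (affine_vf a c d) \<in> vector_fields U"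
    by (rule affine_in_vector_fields[OF assms])
next
  fix W E F G w assume sol: "is_local_solution W E F G \<and> surface W E F G \<subseteq> U" and w: "w \<in> W"
  define f where "f w = (E (fst w) (snd w), F (fst w) (snd w), G (fst w) (snd w))" for w
  let ?\<Phi> = "affine_flow a c d" and ?Y = "restrict_vf U (affine_vf a c d)"
  have "open W" and smooth: "smooth_on (\<lambda>(u, v). E u v) W" "smooth_on (\<lambda>(u, v). F u v) W" "smooth_on (\<lambda>(u, v). G u v) W"
    using sol by (simp_all add: is_local_solution_def)
  have f: "continuous_on W f"
    unfolding f_def using smooth[THEN smooth_on_imp_continuous_on] unfolding case_prod_beta'
    by (intro continuous_on_Pair)
  have shift: "continuous_on UNIV (shift_time c)"
    using shift_time_has_derivative[of c _ UNIV] DERIV_isCont by (auto simp: continuous_on_eq_continuous_at)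
  \<comment> \<open>Joint continuity in time and base point gives a box around \<open>(0, w)\<close>
    that is mapped into \<open>U\<close>, so that one \<delta> serves all of
    \<open>W\<^sub>0\<close>.\<close>
  define \<Psi> where "\<Psi> x = ?\<Phi> (fst x) (lift (snd x) (f (snd x)))" for x
  have "continuous_on (UNIV \<times> W) \<Psi>"
    unfolding \<Psi>_def affine_flow_def hor_ver_lift unfolding lift_def
    by (intro continuous_intros continuous_on_compose2[OF f] continuous_on_compose2[OF shift]) auto
  moreover have "open ((UNIV :: real set) \<times> W)" using \<open>open W\<close> by (intro open_Times) auto
  ultimately have "open ((UNIV \<times> W) \<inter> \<Psi> -` U)"
    using \<open>open U\<close> continuous_on_open_vimage by (metis Int_commute)
  moreover have "(0, w) \<in> (UNIV \<times> W) \<inter> \<Psi> -` U"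
  proof -
    have "lift w (f w) \<in> U" using sol w by (auto simp: surface_iff f_def)
    then show ?thesis using w by (simp add: \<Psi>_def affine_flow_def)
  qed
  ultimately obtain T W\<^sub>0 where T: "open T" "open W\<^sub>0" "(0, w) \<in> T \<times> W\<^sub>0" "T \<times> W\<^sub>0 \<subseteq> (UNIV \<times> W) \<inter> \<Psi> -` U"
    by (rule open_prod_elim)
  then obtain \<delta> where "0 < \<delta>" and \<delta>: "ball 0 \<delta> \<subseteq> T"
    using open_contains_ball by blast
  have "W\<^sub>0 \<subseteq> W" using T(3,4) by auto
  then have sol\<^sub>0: "is_local_solution W\<^sub>0 E F G"
    using local_solution_subset sol T(2) by blast
  have stays: "?\<Phi> s p \<in> U" if "\<bar>s\<bar> < \<delta>" "p \<in> surface W\<^sub>0 E F G" for s p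
  proof -
    have "lift (hor p) (ver p) \<in> surface W\<^sub>0 E F G" using that(2) by simp
    then have "hor p \<in> W\<^sub>0" "ver p = f (hor p)" unfolding surface_iff f_def by blast+
    then have p: "p = lift (hor p) (f (hor p))" "hor p \<in> W\<^sub>0" using hor_ver_lift(3)[of p] by simp_all
    have "s \<in> T" using \<delta> that(1) by auto
    with p(2) have "(s, hor p) \<in> (UNIV \<times> W) \<inter> \<Psi> -` U" using T(4) by blast
    then show ?thesis using p(1) by (simp add: \<Psi>_def)
  qed
  have flows: "flows_to U ?Y t p q \<longleftrightarrow> q = ?\<Phi> t p" if "\<bar>t\<bar> < \<delta>" "p \<in> surface W\<^sub>0 E F G" for t p q
  proof -
    have "\<bar>s\<bar> < \<delta>" if s: "s \<in> closed_segment 0 t" for s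
      using s \<open>\<bar>t\<bar> < \<delta>\<close> by (auto simp: closed_segment_eq_real_ivl split: if_splits)
    then show ?thesis using stays[OF _ that(2)] by (auto simp: flows_to_affine_iff)
  qed
  show "\<exists>W\<^sub>0 \<delta>. open W\<^sub>0 \<and> w \<in> W\<^sub>0 \<and> W\<^sub>0 \<subseteq> W \<and> \<delta> > 0 \<and>
    (\<forall>t. \<bar>t\<bar> < \<delta> \<longrightarrow> (\<forall>p\<in>surface W\<^sub>0 E F G. \<exists>q. flows_to U ?Y t p q) \<and>
      (\<exists>W' E' F' G'. is_local_solution W' E' F' G' \<and> flow_image U ?Y t (surface W\<^sub>0 E F G) = surface W' E' F' G'))"
  proof (rule exI[of _ W\<^sub>0], rule exI[of _ \<delta>], intro conjI allI impI)
    show "open W\<^sub>0" "w \<in> W\<^sub>0" "W\<^sub>0 \<subseteq> W" "0 < \<delta>" using T \<open>W\<^sub>0 \<subseteq> W\<close> \<open>0 < \<delta>\<close> by auto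
    fix t :: real assume t: "\<bar>t\<bar> < \<delta>"
    show "\<forall>p\<in>surface W\<^sub>0 E F G. \<exists>q. flows_to U ?Y t p q"
      using flows[OF t] by blast
    \<comment> \<open>With these constants \<open>R\<close> inverts the base part of the flow at
      time \<open>t\<close>, and the moved surface is the graph of \<mu> times the solution composed
      with \<open>R\<close>.\<close>
    define r where "r = exp (- (c * t))"
    define b where "b = - (r * shift_time c t) *\<^sub>R a"
    define \<mu> where "\<mu> = exp (d * t)"
    define R where "R w = b + r *\<^sub>R w" for w
    define N where "N X u v = \<mu> * X (fst (R (u, v))) (snd (R (u, v)))" for X u v
    have "r \<noteq> 0" "0 < \<mu>" by (simp_all add: r_def \<mu>_def)
    have R: "R (exp (c * t) *\<^sub>R w + shift_time c t *\<^sub>R a) = w" "exp (c * t) *\<^sub>R R w + shift_time c t *\<^sub>R a = w" for w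
    proof -
      have "r * exp (c * t) = 1" by (simp add: r_def exp_minus)
      moreover have "R (exp (c * t) *\<^sub>R w + shift_time c t *\<^sub>R a) = (r * exp (c * t)) *\<^sub>R w"
        by (simp add: R_def b_def scaleR_add_right)
      moreover have "exp (c * t) *\<^sub>R R w + shift_time c t *\<^sub>R a
          = (r * exp (c * t)) *\<^sub>R w + (shift_time c t - (r * exp (c * t)) * shift_time c t) *\<^sub>R a"
        by (simp add: R_def b_def algebra_simps)
      ultimately show "R (exp (c * t) *\<^sub>R w + shift_time c t *\<^sub>R a) = w" "exp (c * t) *\<^sub>R R w + shift_time c t *\<^sub>R a = w"
        by simp_all
    qed
    have "flow_image U ?Y t (surface W\<^sub>0 E F G) = surface {w. R w \<in> W\<^sub>0} (N E) (N F) (N G)"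
    proof (intro set_eqI)
      fix q
      have "q \<in> flow_image U ?Y t (surface W\<^sub>0 E F G) \<longleftrightarrow> (\<exists>w\<in>W\<^sub>0. q = ?\<Phi> t (lift w (f w)))"
      proof -
        have im: "q \<in> flow_image U ?Y t (surface W\<^sub>0 E F G) \<longleftrightarrow> (\<exists>p\<in>surface W\<^sub>0 E F G. q = ?\<Phi> t p)"
          using flows[OF t] by (auto simp: flow_image_def)
        have S: "surface W\<^sub>0 E F G = (\<lambda>w. lift w (f w)) ` W\<^sub>0"
          by (force simp: surface_def f_def lift_def image_iff)
        show ?thesis unfolding im unfolding S by blast
      qed
      also have "\<dots> \<longleftrightarrow> R (hor q) \<in> W\<^sub>0 \<and> ver q = \<mu> *\<^sub>R f (R (hor q))"
      proof
        assume "\<exists>w\<in>W\<^sub>0. q = ?\<Phi> t (lift w (f w))"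
        then obtain x where "x \<in> W\<^sub>0" "q = ?\<Phi> t (lift x (f x))" by blast
        then show "R (hor q) \<in> W\<^sub>0 \<and> ver q = \<mu> *\<^sub>R f (R (hor q))"
          by (simp add: affine_flow_def R \<mu>_def)
      next
        assume *: "R (hor q) \<in> W\<^sub>0 \<and> ver q = \<mu> *\<^sub>R f (R (hor q))"
        then have "q = ?\<Phi> t (lift (R (hor q)) (f (R (hor q))))"
          using hor_ver_lift(3)[of q] by (simp add: affine_flow_def R \<mu>_def)
        with * show "\<exists>w\<in>W\<^sub>0. q = ?\<Phi> t (lift w (f w))" by blast
      qed
      also have "\<dots> \<longleftrightarrow> q \<in> surface {w. R w \<in> W\<^sub>0} (N E) (N F) (N G)"
        using surface_iff[of "hor q" "ver q"] by (simp add: N_def f_def)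
      finally show "q \<in> flow_image U ?Y t (surface W\<^sub>0 E F G) \<longleftrightarrow> q \<in> surface {w. R w \<in> W\<^sub>0} (N E) (N F) (N G)" .
    qed
    moreover have "is_local_solution {w. R w \<in> W\<^sub>0} (N E) (N F) (N G)"
      using rescaled_solution[OF sol\<^sub>0 \<open>r \<noteq> 0\<close> \<open>0 < \<mu>\<close>, of b] unfolding R_def N_def .
    ultimately show "\<exists>W' E' F' G'. is_local_solution W' E' F' G' \<and> flow_image U ?Y t (surface W\<^sub>0 E F G) = surface W' E' F' G'"
      by blast
  qed
qed

section \<open>The symmetry algebra and its generators\<close>

lemma symmetry_algebra_eq:
  assumes "open U" "connected U" "U \<noteq> {}" "U \<subseteq> metric_domain"
  shows "symmetry_algebra U = {restrict_vf U (affine_vf a c d) | a c d. True}"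
proof (intro equalityI subsetI)
  fix X assume "X \<in> symmetry_algebra U"
  then have "infinitesimal_symmetry U X" by (simp add: symmetry_algebra_def)
  then obtain a c d where "X = restrict_vf U (affine_vf a c d)"
    by (rule symmetry_imp_affine[OF _ assms])
  then show "X \<in> {restrict_vf U (affine_vf a c d) | a c d. True}" by blast
next
  fix X assume "X \<in> {restrict_vf U (affine_vf a c d) | a c d. True}"
  then obtain a c d where "X = restrict_vf U (affine_vf a c d)" by blast
  then show "X \<in> symmetry_algebra U"
    using affine_is_symmetry[OF assms(1)] by (simp add: symmetry_algebra_def)
qed

text \<open>The linear parts are scalar on base and fibre and therefore commute; only a translation
  survives in the bracket.\<close>

lemma affine_lie_bracket:
  assumes "open U"
  shows "lie_bracket U (restrict_vf U (affine_vf a c d)) (restrict_vf U (affine_vf a' c' d'))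
    = restrict_vf U (affine_vf (c' *\<^sub>R a - c *\<^sub>R a') 0 0)"
proof
  fix p
  show "lie_bracket U (restrict_vf U (affine_vf a c d)) (restrict_vf U (affine_vf a' c' d')) p
    = restrict_vf U (affine_vf (c' *\<^sub>R a - c *\<^sub>R a') 0 0) p"
  proof (cases "p \<in> U")
    case True
    have "frechet_derivative (restrict_vf U (affine_vf a c d)) (at p) = (\<lambda>h. lift (c *\<^sub>R hor h) (d *\<^sub>R ver h))" for a c d
      using frechet_derivative_at[OF restrict_affine_has_derivative[OF assms True]] by metis
    then show ?thesis
      using True by (simp add: lie_bracket_def restrict_vf_def affine_vf_def)
        (simp add: lift_def algebra_simps)
  qed (simp add: lie_bracket_def restrict_vf_def)
qed

lemma affine_lie_subalgebra:
  assumes "open U"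
  shows "lie_subalgebra U {restrict_vf U (affine_vf a c d) | a c d. True}"
proof -
  have zero: "(\<lambda>p. 0) = restrict_vf U (affine_vf 0 0 0)"
    by (auto simp: restrict_vf_def affine_vf_def lift_def simp flip: zero_prod_def)
  have add: "(\<lambda>p. restrict_vf U (affine_vf a c d) p + restrict_vf U (affine_vf a' c' d') p)
    = restrict_vf U (affine_vf (a + a') (c + c') (d + d'))" for a c d a' c' d'
    by (auto simp: restrict_vf_def affine_vf_def lift_add algebra_simps)
  have scale: "(\<lambda>p. k *\<^sub>R restrict_vf U (affine_vf a c d) p) = restrict_vf U (affine_vf (k *\<^sub>R a) (k * c) (k * d))" for k a c d
    by (auto simp: restrict_vf_def affine_vf_def lift_scaleR algebra_simps)
  let ?L = "{restrict_vf U (affine_vf a c d) | a c d. True}"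
  have mem: "restrict_vf U (affine_vf a c d) \<in> ?L" for a c d by blast
  show ?thesis
    unfolding lie_subalgebra_def
  proof (intro conjI allI ballI)
    show "?L \<subseteq> vector_fields U" using affine_in_vector_fields[OF assms] by blast
    show "(\<lambda>p. 0) \<in> ?L" unfolding zero by (rule mem)
  next
    fix X k assume "X \<in> ?L"
    then obtain a c d where "X = restrict_vf U (affine_vf a c d)" by blast
    then show "(\<lambda>p. k *\<^sub>R X p) \<in> ?L" by (simp only: scale mem)
  next
    fix X Y assume "X \<in> ?L" "Y \<in> ?L"
    then obtain a c d a' c' d' where "X = restrict_vf U (affine_vf a c d)" "Y = restrict_vf U (affine_vf a' c' d')"
      by blast
    then show "(\<lambda>p. X p + Y p) \<in> ?L" "lie_bracket U X Y \<in> ?L"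
      by (simp_all only: add affine_lie_bracket[OF assms] mem)
  qed
qed

theorem theorem2:
  fixes U :: "pt set"
  assumes "open U" and "connected U" and "U \<noteq> {}" and "U \<subseteq> metric_domain"
  shows "lie_subalgebra U (symmetry_algebra U) \<and>
    symmetry_algebra U =
      lie_subalgebra U hull
        {restrict_vf U vf_T1, restrict_vf U vf_T2, restrict_vf U vf_D1, restrict_vf U vf_D2}"
proof -
  let ?L = "{restrict_vf U (affine_vf a c d) | a c d. True}"
  let ?gen = "{restrict_vf U vf_T1, restrict_vf U vf_T2, restrict_vf U vf_D1, restrict_vf U vf_D2}"
  have gens: "vf_T1 = affine_vf (1, 0) 0 0" "vf_T2 = affine_vf (0, 1) 0 0" "vf_D1 = affine_vf 0 1 0" "vf_D2 = affine_vf 0 0 1"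
    by (auto simp: vf_T1_def vf_T2_def vf_D1_def vf_D2_def affine_vf_def lift_def hor_def ver_def zero_prod_def)
  have "lie_subalgebra U hull ?gen \<subseteq> ?L"
  proof (rule hull_minimal)
    show "?gen \<subseteq> ?L" unfolding gens by blast
  qed (rule affine_lie_subalgebra[OF assms(1)])
  moreover have "?L \<subseteq> lie_subalgebra U hull ?gen"
    unfolding hull_def
  proof (intro subsetI InterI)
    fix X M assume "X \<in> ?L" "M \<in> {t. lie_subalgebra U t \<and> ?gen \<subseteq> t}"
    then obtain a c d where X: "X = restrict_vf U (affine_vf a c d)" and M: "lie_subalgebra U M" "?gen \<subseteq> M"
      by blast
    have add: "(\<lambda>p. Y p + Z p) \<in> M" if "Y \<in> M" "Z \<in> M" for Y Z
      using M(1) that unfolding lie_subalgebra_def by blast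
    have scale: "(\<lambda>p. k *\<^sub>R Y p) \<in> M" if "Y \<in> M" for Y k
      using M(1) that unfolding lie_subalgebra_def by blast
    \<comment> \<open>The coefficients are those encoded in \<open>affine_vf a c d\<close>, so
      closure under sums and multiples already puts every affine field into
      \<open>M\<close>.\<close>
    have "(\<lambda>p. (fst a *\<^sub>R restrict_vf U vf_T1 p + snd a *\<^sub>R restrict_vf U vf_T2 p)
        + (c *\<^sub>R restrict_vf U vf_D1 p + d *\<^sub>R restrict_vf U vf_D2 p)) \<in> M"
      using M(2) by (intro add scale) auto
    also have "(\<lambda>p. (fst a *\<^sub>R restrict_vf U vf_T1 p + snd a *\<^sub>R restrict_vf U vf_T2 p)
        + (c *\<^sub>R restrict_vf U vf_D1 p + d *\<^sub>R restrict_vf U vf_D2 p)) = X"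
      unfolding X restrict_vf_def gens
      by (rule ext, cases a) (simp add: affine_vf_def lift_scaleR lift_add)
    finally show "X \<in> M" .
  qed
  ultimately show ?thesis
    using symmetry_algebra_eq[OF assms] affine_lie_subalgebra[OF assms(1)] by auto
qed

end
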